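(* Let $\mathfrak{g}$ be a finite-dimensional simple Lie algebra over $\mathbb{C}$ with normalized Killing form $\langle\cdot,\cdot\rangle$ and let $\hat{\mathfrak{g}}$ be the associated (untwisted) affine Lie algebra. The irreducible integrable $\hat{\mathfrak{g}}$-modules in the category $\mathcal{E}$ are, up to isomorphism, exactly the evaluation modules $U_{1}(z_{1})\otimes\cdots\otimes U_{r}(z_{r})$, where $U_{1},\dots,U_{r}$ are finite-dimensional irreducible $\mathfrak{g}$-modules and $z_{1},\dots,z_{r}$ are distinct nonzero complex numbers.
   Context: The form $\langle\cdot,\cdot\rangle$ is normalized so that the squared length of the long roots is $2$. The affine Lie algebra is $\hat{\mathfrak{g}}=\mathfrak{g}\otimes\mathbb{C}[t,t^{-1}]\oplus\mathbb{C}\mathbf{k}$ with $\mathbf{k}$ central and $[a\otimes t^{m},b\otimes t^{n}]=[a,b]\otimes t^{m+n}+m\langle a,b\rangle\delta_{m+n,0}\mathbf{k}$. On a $\hat{\mathfrak{g}}$-module, $a(n)$ denotes the operator by which $a\otimes t^n$ acts, and $a(x)=\sum_{n\in\mathbb{Z}}a(n)x^{-n-1}$ for $a\in\mathfrak{g}$. Category $\mathcal{E}$: a $\hat{\mathfrak{g}}$-module $W$ is in $\mathcal{E}$ if there is a nonzero polynomial $p(x)\in\mathbb{C}[x]$ such that $p(x)a(x)w=0$ for all $a\in\mathfrak{g}$, $w\in W$. Fix a Cartan subalgebra $\mathfrak{h}$ with root set $\Delta$ and root spaces $\mathfrak{g}_\alpha$. A $\hat{\mathfrak{g}}$-module is integrable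 if for all $\alpha\in\Delta$, $a\in\mathfrak{g}_\alpha$, $n\in\mathbb{Z}$, the operator $a(n)$ acts locally nilpotently. For a $\mathfrak{g}$-module $U$ and $z\in\mathbb{C}\setminus\{0\}$, $U(z)$ is the $\hat{\mathfrak{g}}$-module with underlying space $U$, $\mathbf{k}$ acting as $0$ and $a(n)u=z^{n}(au)$ for $a\in\mathfrak{g}$, $n\in\mathbb{Z}$, $u\in U$. Tensor products are tensor product $\hat{\mathfrak{g}}$-modules. *)

theory Defs
  imports
    Complex_Main
    "HOL-Library.Poly_Mapping"
    "HOL-Library.Function_Algebras"
    "HOL-Library.Product_Plus"
    "HOL-Library.FuncSet"
    "HOL-Computational_Algebra.Polynomial"
begin

section \<open>Complex vector spaces\<close>

class complex_vector = ab_group_add +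
  fixes scaleC :: "complex \<Rightarrow> 'a \<Rightarrow> 'a" (infixr \<open>*\<^sub>C\<close> 75)
  assumes scaleC_add_right: "c *\<^sub>C (x + y) = c *\<^sub>C x + c *\<^sub>C y"
    and scaleC_add_left: "(c + d) *\<^sub>C x = c *\<^sub>C x + d *\<^sub>C x"
    and scaleC_scaleC: "c *\<^sub>C d *\<^sub>C x = (c * d) *\<^sub>C x"
    and scaleC_one: "1 *\<^sub>C x = x"

global_interpretation cvec: vector_space "scaleC :: complex \<Rightarrow> 'a \<Rightarrow> 'a::complex_vector"
  by unfold_locales
    (simp_all add: scaleC_add_right scaleC_add_left scaleC_scaleC scaleC_one)

instantiation complex :: complex_vector
begin
definition scaleC_complex :: "complex \<Rightarrow> complex \<Rightarrow> complex"
  where "scaleC_complex c x = c * x"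
instance by standard (simp_all add: scaleC_complex_def algebra_simps)
end

instantiation prod :: (complex_vector, complex_vector) complex_vector
begin
definition scaleC_prod :: "complex \<Rightarrow> 'a \<times> 'b \<Rightarrow> 'a \<times> 'b"
  where "scaleC_prod c x = (c *\<^sub>C fst x, c *\<^sub>C snd x)"
instance
  by standard
    (simp_all add: scaleC_prod_def scaleC_add_right scaleC_add_left scaleC_scaleC scaleC_one)
end

instantiation "fun" :: (type, complex_vector) complex_vector
begin
definition scaleC_fun :: "complex \<Rightarrow> ('a \<Rightarrow> 'b) \<Rightarrow> 'a \<Rightarrow> 'b"
  where "scaleC_fun c f = (\<lambda>x. c *\<^sub>C f x)"
instance
  by standard
    (simp_all add: scaleC_fun_def fun_eq_iff scaleC_add_right scaleC_add_left
      scaleC_scaleC scaleC_one)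
end

instantiation poly_mapping :: (type, complex_vector) complex_vector
begin
lift_definition scaleC_poly_mapping :: "complex \<Rightarrow> ('a \<Rightarrow>\<^sub>0 'b) \<Rightarrow> 'a \<Rightarrow>\<^sub>0 'b"
  is "\<lambda>c f k. c *\<^sub>C f k"
  by (erule rev_finite_subset) auto
instance
  by (standard; transfer)
    (simp_all add: fun_eq_iff scaleC_add_right scaleC_add_left scaleC_scaleC scaleC_one)
end

definition finite_dim :: "'a::complex_vector set \<Rightarrow> bool"
  where "finite_dim V \<longleftrightarrow> (\<exists>B. finite B \<and> V = cvec.span B)"

text \<open>Linearity of a map on a subspace \<open>V\<close> of its domain type.\<close>

definition linear_on :: "'a::complex_vector set \<Rightarrow> ('a \<Rightarrow> 'b::complex_vector) \<Rightarrow> bool"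
  where "linear_on V f \<longleftrightarrow>
    (\<forall>x\<in>V. \<forall>y\<in>V. f (x + y) = f x + f y) \<and> (\<forall>c. \<forall>x\<in>V. f (c *\<^sub>C x) = c *\<^sub>C f x)"

text \<open>The trace of an endomorphism of a finite-dimensional space; it does not depend on the
  chosen basis.\<close>

definition endo_trace :: "('a::complex_vector \<Rightarrow> 'a) \<Rightarrow> complex"
  where "endo_trace f =
    (let B = SOME B. \<not> cvec.dependent B \<and> cvec.span B = UNIV
     in \<Sum>b\<in>B. cvec.representation B (f b) b)"


section \<open>Lie algebras and their modules\<close>

locale lie_algebra =
  fixes br :: "'l::complex_vector \<Rightarrow> 'l \<Rightarrow> 'l"
  assumes br_linear_left: "linear_on UNIV (\<lambda>x. br x y)"
    and br_linear_right: "linear_on UNIV (br x)"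
    and br_self: "br x x = 0"
    and jacobi: "br x (br y z) + br y (br z x) + br z (br x y) = 0"

definition lie_ideal :: "('l::complex_vector \<Rightarrow> 'l \<Rightarrow> 'l) \<Rightarrow> 'l set \<Rightarrow> bool"
  where "lie_ideal br I \<longleftrightarrow> cvec.subspace I \<and> (\<forall>x. \<forall>y\<in>I. br x y \<in> I)"

definition simple_lie_algebra :: "('l::complex_vector \<Rightarrow> 'l \<Rightarrow> 'l) \<Rightarrow> bool"
  where "simple_lie_algebra br \<longleftrightarrow>
    lie_algebra br \<and> (\<exists>x y. br x y \<noteq> 0) \<and> (\<forall>I. lie_ideal br I \<longrightarrow> I = {0} \<or> I = UNIV)"

text \<open>A module has as underlying space a subspace of its type; outside this subspace the action
  is irrelevant.\<close>

record ('l, 'v) lie_mod =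
  mod_space :: "'v set"
  mod_act :: "'l \<Rightarrow> 'v \<Rightarrow> 'v"

definition lie_module ::
    "('l::complex_vector \<Rightarrow> 'l \<Rightarrow> 'l) \<Rightarrow> ('l, 'v::complex_vector) lie_mod \<Rightarrow> bool"
  where "lie_module br M \<longleftrightarrow>
    cvec.subspace (mod_space M) \<and>
    (\<forall>x. \<forall>v\<in>mod_space M. mod_act M x v \<in> mod_space M) \<and>
    (\<forall>x. linear_on (mod_space M) (mod_act M x)) \<and>
    (\<forall>v\<in>mod_space M. linear_on UNIV (\<lambda>x. mod_act M x v)) \<and>
    (\<forall>x y. \<forall>v\<in>mod_space M.
      mod_act M (br x y) v = mod_act M x (mod_act M y v) - mod_act M y (mod_act M x v))"

definition irreducible_module :: "('l, 'v::complex_vector) lie_mod \<Rightarrow> bool"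
  where "irreducible_module M \<longleftrightarrow>
    mod_space M \<noteq> {0} \<and>
    (\<forall>S. cvec.subspace S \<and> S \<subseteq> mod_space M \<and> (\<forall>x. \<forall>v\<in>S. mod_act M x v \<in> S) \<longrightarrow>
      S = {0} \<or> S = mod_space M)"

definition module_iso ::
    "('l, 'v::complex_vector) lie_mod \<Rightarrow> ('l, 'w::complex_vector) lie_mod \<Rightarrow> bool"
  where "module_iso M N \<longleftrightarrow>
    (\<exists>\<phi>. bij_betw \<phi> (mod_space M) (mod_space N) \<and> linear_on (mod_space M) \<phi> \<and>
      (\<forall>x. \<forall>v\<in>mod_space M. \<phi> (mod_act M x v) = mod_act N x (\<phi> v)))"


section \<open>Tensor products\<close>

text \<open>Multilinear maps on \<open>V 0 \<times> \<dots> \<times> V (r - 1)\<close>; the factors are subspaces of one common type.\<close>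

definition multilinear ::
    "nat \<Rightarrow> (nat \<Rightarrow> 'v::complex_vector set) \<Rightarrow> ((nat \<Rightarrow> 'v) \<Rightarrow> 'x::complex_vector) \<Rightarrow> bool"
  where "multilinear r V f \<longleftrightarrow>
    (\<forall>u \<in> Pi\<^sub>E {..<r} V. \<forall>i<r. linear_on (V i) (\<lambda>v. f (u(i := v))))"

text \<open>The pure tensor \<open>u 0 \<otimes> \<dots> \<otimes> u (r - 1)\<close> is evaluation at \<open>u\<close> on the space of multilinear forms,
  and the algebraic tensor product is the span of these evaluations. Lemmas \<open>tensor_universal\<close>
  and \<open>tensor_linear_unique\<close> below are the universal property.\<close>

definition pure_tensor ::
    "nat \<Rightarrow> (nat \<Rightarrow> 'v::complex_vector set) \<Rightarrow> (nat \<Rightarrow> 'v) \<Rightarrow> ((nat \<Rightarrow> 'v) \<Rightarrow> complex) \<Rightarrow> complex"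
  where "pure_tensor r V u = (\<lambda>f. if multilinear r V f then f u else 0)"

definition tensor_space ::
    "nat \<Rightarrow> (nat \<Rightarrow> 'v::complex_vector set) \<Rightarrow> (((nat \<Rightarrow> 'v) \<Rightarrow> complex) \<Rightarrow> complex) set"
  where "tensor_space r V = cvec.span (pure_tensor r V ` Pi\<^sub>E {..<r} V)"

lemma scaleC_fun_apply: "(c *\<^sub>C f) x = c *\<^sub>C f x"
  by (simp add: scaleC_fun_def)

lemma multilinear_pure_tensor: "multilinear r V (pure_tensor r V)"
  unfolding multilinear_def linear_on_def
proof (intro ballI allI impI conjI)
  fix u i x y assume u: "u \<in> Pi\<^sub>E {..<r} V" "i < r" "x \<in> V i" "y \<in> V i"
  show "pure_tensor r V (u(i := x + y)) = pure_tensor r V (u(i := x)) + pure_tensor r V (u(i := y))"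
    using u by (auto simp: pure_tensor_def fun_eq_iff multilinear_def linear_on_def)
next
  fix u i c x assume u: "u \<in> Pi\<^sub>E {..<r} V" "i < r" "x \<in> V i"
  show "pure_tensor r V (u(i := c *\<^sub>C x)) = c *\<^sub>C pure_tensor r V (u(i := x))"
    using u
    by (auto simp: pure_tensor_def fun_eq_iff multilinear_def linear_on_def scaleC_fun_apply)
qed

lemma linear_functional_nonzero:
  fixes d :: "'x::complex_vector"
  assumes "d \<noteq> 0"
  obtains l :: "'x \<Rightarrow> complex" where "linear_on UNIV l" "l d \<noteq> 0"
proof -
  interpret p: vector_space_pair "scaleC :: complex \<Rightarrow> 'x \<Rightarrow> 'x"
      "scaleC :: complex \<Rightarrow> complex \<Rightarrow> complex" ..
  have "\<not> cvec.dependent {d}" using assms by simp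
  from p.linear_independent_extend[OF this, of "\<lambda>_. 1"]
  obtain l :: "'x \<Rightarrow> complex" where l: "Vector_Spaces.linear scaleC scaleC l" "l d = 1"
    by auto
  show ?thesis
    by (rule that[of l])
      (use l in \<open>auto simp: linear_on_def p.linear_add p.linear_scale\<close>)
qed

lemma tensor_universal:
  fixes g :: "(nat \<Rightarrow> 'v::complex_vector) \<Rightarrow> 'x::complex_vector"
  assumes g: "multilinear r V g"
  shows "\<exists>F. linear_on (tensor_space r V) F \<and> (\<forall>u \<in> Pi\<^sub>E {..<r} V. F (pure_tensor r V u) = g u)"
proof -
  let ?P = "Pi\<^sub>E {..<r} V" and ?p = "pure_tensor r V"
  interpret p: vector_space_pair
    "scaleC :: complex \<Rightarrow> (((nat \<Rightarrow> 'v) \<Rightarrow> complex) \<Rightarrow> complex) \<Rightarrow> _"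
    "scaleC :: complex \<Rightarrow> 'x \<Rightarrow> 'x" ..
  obtain B where B: "B \<subseteq> ?p ` ?P" "\<not> cvec.dependent B" "?p ` ?P \<subseteq> cvec.span B"
    using cvec.maximal_independent_subset[of "?p ` ?P"] by metis
  define pre where "pre b = (SOME u. u \<in> ?P \<and> ?p u = b)" for b
  have pre: "pre b \<in> ?P \<and> ?p (pre b) = b" if "b \<in> B" for b
  proof -
    from that B(1) have "\<exists>u. u \<in> ?P \<and> ?p u = b" by blast
    from someI_ex[OF this] show ?thesis by (simp only: pre_def)
  qed
  from p.linear_independent_extend[OF B(2), of "\<lambda>b. g (pre b)"]
  obtain F where F: "Vector_Spaces.linear scaleC scaleC F" and Fb: "\<And>b. b \<in> B \<Longrightarrow> F b = g (pre b)"
    by auto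
  have "F (?p u) = g u" if u: "u \<in> ?P" for u
  proof (rule ccontr)
    assume "F (?p u) \<noteq> g u"
    then obtain l where l: "linear_on UNIV l" "l (F (?p u) - g u) \<noteq> (0::complex)"
      by (metis linear_functional_nonzero right_minus_eq)
    have ladd: "l (x + y) = l x + l y" and lsc: "l (c *\<^sub>C x) = c *\<^sub>C l x" for x y c
      using l(1) by (auto simp: linear_on_def)
    have ldiff: "l (x - y) = l x - l y" for x y
      using ladd[of "x - y" y] by simp
    have lg: "multilinear r V (\<lambda>u. l (g u))"
      using g unfolding multilinear_def linear_on_def by (simp add: ladd lsc)
    have eq: "l (F t) = t (\<lambda>u. l (g u))" if "t \<in> cvec.span B" for t
      using that
    proof (induction rule: cvec.span_induct_alt)
      case base
      have "l 0 = 0" using lsc[of 0 0] by (simp add: scaleC_complex_def)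
      moreover have "F 0 = 0" by (rule p.linear_0[OF F])
      ultimately show ?case by (metis zero_fun_apply)
    next
      case (step c x y)
      have "l (F x) = x (\<lambda>u. l (g u))"
        using pre[OF step(1)] Fb[OF step(1)] lg by (metis pure_tensor_def)
      moreover have "l (F (c *\<^sub>C x + y)) = c *\<^sub>C l (F x) + l (F y)"
        by (simp only: p.linear_add[OF F] p.linear_scale[OF F] ladd lsc)
      moreover have "(c *\<^sub>C x + y) (\<lambda>u. l (g u)) =
          c *\<^sub>C x (\<lambda>u. l (g u)) + y (\<lambda>u. l (g u))"
        by (simp add: scaleC_fun_apply)
      ultimately show ?case
        using step(2) by (simp only:)
    qed
    have "l (F (?p u)) = l (g u)"
      using eq[of "?p u"] B(3) u lg by (auto simp: pure_tensor_def)
    with l(2) show False by (simp add: ldiff)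
  qed
  then show "\<exists>F. linear_on (tensor_space r V) F \<and> (\<forall>u \<in> ?P. F (?p u) = g u)"
    using F by (intro exI[of _ F]) (auto simp: linear_on_def p.linear_add p.linear_scale)
qed

lemma tensor_linear_unique:
  fixes F F' :: "(((nat \<Rightarrow> 'v::complex_vector) \<Rightarrow> complex) \<Rightarrow> complex) \<Rightarrow> 'x::complex_vector"
  assumes F: "linear_on (tensor_space r V) F" "linear_on (tensor_space r V) F'"
    and eq: "\<And>u. u \<in> Pi\<^sub>E {..<r} V \<Longrightarrow> F (pure_tensor r V u) = F' (pure_tensor r V u)"
    and t: "t \<in> tensor_space r V"
  shows "F t = F' t"
proof -
  have z: "G 0 = 0" if "linear_on (tensor_space r V) G"
    for G :: "(((nat \<Rightarrow> 'v) \<Rightarrow> complex) \<Rightarrow> complex) \<Rightarrow> 'x"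
  proof -
    have "0 \<in> tensor_space r V" by (simp add: tensor_space_def cvec.span_zero)
    then have "G (0 *\<^sub>C 0) = 0 *\<^sub>C G 0" using that unfolding linear_on_def by blast
    then show ?thesis by simp
  qed
  have "t \<in> tensor_space r V \<and> F t = F' t"
    using t unfolding tensor_space_def
  proof (induction rule: cvec.span_induct_alt)
    case base
    show ?case using z[OF F(1)] z[OF F(2)] cvec.span_zero by metis
  next
    case (step c x y)
    have x: "x \<in> tensor_space r V"
      using step(1) by (simp add: tensor_space_def cvec.span_base)
    have y: "y \<in> tensor_space r V" using step(2) by (simp only: tensor_space_def)
    have cx: "c *\<^sub>C x \<in> tensor_space r V"
      using x by (simp add: tensor_space_def cvec.span_scale)
    have "F (c *\<^sub>C x + y) = F' (c *\<^sub>C x + y)"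
      using F x y cx step eq unfolding linear_on_def by auto
    then show ?case
      using cx y cvec.span_add unfolding tensor_space_def by metis
  qed
  then show "F t = F' t" ..
qed

text \<open>The action of \<open>x\<close> is the transpose of \<open>f \<mapsto> (\<lambda>u. \<Sum>i<r. f (u 0, \<dots>, x u i, \<dots>, u (r - 1)))\<close>;
  lemma \<open>tensor_act_pure\<close> below gives it on pure tensors.\<close>

definition tensor_module ::
    "nat \<Rightarrow> (nat \<Rightarrow> ('l, 'v::complex_vector) lie_mod) \<Rightarrow>
     ('l, ((nat \<Rightarrow> 'v) \<Rightarrow> complex) \<Rightarrow> complex) lie_mod"
  where "tensor_module r M =
    \<lparr>mod_space = tensor_space r (\<lambda>i. mod_space (M i)),
     mod_act = (\<lambda>x t f.
       if multilinear r (\<lambda>i. mod_space (M i)) f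
       then t (\<lambda>u. \<Sum>i<r. f (u(i := mod_act (M i) x (u i)))) else 0)\<rparr>"

lemma tensor_act_pure:
  assumes M: "\<And>i. i < r \<Longrightarrow> linear_on (mod_space (M i)) (mod_act (M i) x)"
      "\<And>i v. i < r \<Longrightarrow> v \<in> mod_space (M i) \<Longrightarrow> mod_act (M i) x v \<in> mod_space (M i)"
    and u: "u \<in> Pi\<^sub>E {..<r} (\<lambda>i. mod_space (M i))"
  shows "mod_act (tensor_module r M) x (pure_tensor r (\<lambda>i. mod_space (M i)) u) =
    (\<Sum>i<r. pure_tensor r (\<lambda>i. mod_space (M i)) (u(i := mod_act (M i) x (u i))))"
proof
  fix f :: "_ \<Rightarrow> complex"
  let ?V = "\<lambda>i. mod_space (M i)"
  let ?f = "\<lambda>u. \<Sum>i<r. f (u(i := mod_act (M i) x (u i)))"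
  have sum_ap: "(\<Sum>i\<in>A. h i) f = (\<Sum>i\<in>A. h i f)" for h :: "nat \<Rightarrow> _ \<Rightarrow> complex" and A
    by (induction A rule: infinite_finite_induct) auto
  show "mod_act (tensor_module r M) x (pure_tensor r ?V u) f =
    (\<Sum>i<r. pure_tensor r ?V (u(i := mod_act (M i) x (u i)))) f"
  proof (cases "multilinear r ?V f")
    case f: True
    have "linear_on (?V i) (\<lambda>v. f ((w(i := v))(j := mod_act (M j) x ((w(i := v)) j))))"
      if w: "w \<in> Pi\<^sub>E {..<r} ?V" and i: "i < r" and j: "j < r" for w i j
    proof (cases "i = j")
      case True
      have "linear_on (?V i) (\<lambda>v. f (w(i := v)))" using f w i by (auto simp: multilinear_def)
      then show ?thesis using True M[OF i] by (simp add: linear_on_def)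
    next
      case False
      have "w(j := mod_act (M j) x (w j)) \<in> Pi\<^sub>E {..<r} ?V"
        using w j M(2) by (auto simp: PiE_iff extensional_def)
      then have "linear_on (?V i) (\<lambda>v. f ((w(j := mod_act (M j) x (w j)))(i := v)))"
        using f i by (auto simp: multilinear_def)
      then show ?thesis using False by (simp add: fun_upd_twist)
    qed
    then have "multilinear r ?V ?f"
      unfolding multilinear_def linear_on_def
      by (simp add: sum.distrib cvec.scale_sum_right)
    with f show ?thesis
      by (simp add: tensor_module_def pure_tensor_def sum_ap)
  next
    case False
    then show ?thesis
      by (simp add: tensor_module_def pure_tensor_def sum_ap)
  qed
qed


section \<open>Cartan subalgebras, roots and the normalized form\<close>

definition ad_diagonalizable :: "('g::complex_vector \<Rightarrow> 'g \<Rightarrow> 'g) \<Rightarrow> 'g \<Rightarrow> bool"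
  where "ad_diagonalizable br h \<longleftrightarrow>
    (\<exists>B. \<not> cvec.dependent B \<and> cvec.span B = UNIV \<and> (\<forall>b\<in>B. \<exists>c. br h b = c *\<^sub>C b))"

definition toral :: "('g::complex_vector \<Rightarrow> 'g \<Rightarrow> 'g) \<Rightarrow> 'g set \<Rightarrow> bool"
  where "toral br H \<longleftrightarrow>
    cvec.subspace H \<and> (\<forall>h\<in>H. \<forall>k\<in>H. br h k = 0) \<and> (\<forall>h\<in>H. ad_diagonalizable br h)"

text \<open>The usual definition for semisimple complex Lie algebras: an abelian subalgebra consisting of
  semisimple elements, maximal with these properties.\<close>

definition cartan_subalgebra :: "('g::complex_vector \<Rightarrow> 'g \<Rightarrow> 'g) \<Rightarrow> 'g set \<Rightarrow> bool"
  where "cartan_subalgebra br H \<longleftrightarrow>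
    toral br H \<and> (\<forall>H'. toral br H' \<and> H \<subseteq> H' \<longrightarrow> H' = H)"

definition root_space ::
    "('g::complex_vector \<Rightarrow> 'g \<Rightarrow> 'g) \<Rightarrow> 'g set \<Rightarrow> ('g \<Rightarrow> complex) \<Rightarrow> 'g set"
  where "root_space br H \<alpha> = {x. \<forall>h\<in>H. br h x = \<alpha> h *\<^sub>C x}"

text \<open>Roots are linear functionals on \<open>H\<close>; they are represented as functions that are \<open>undefined\<close>
  outside \<open>H\<close>.\<close>

definition roots :: "('g::complex_vector \<Rightarrow> 'g \<Rightarrow> 'g) \<Rightarrow> 'g set \<Rightarrow> ('g \<Rightarrow> complex) set"
  where "roots br H =
    {\<alpha> \<in> extensional H. linear_on H \<alpha> \<and> (\<exists>h\<in>H. \<alpha> h \<noteq> 0) \<and> root_space br H \<alpha> \<noteq> {0}}"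

definition killing_form :: "('g::complex_vector \<Rightarrow> 'g \<Rightarrow> 'g) \<Rightarrow> 'g \<Rightarrow> 'g \<Rightarrow> complex"
  where "killing_form br x y = endo_trace (\<lambda>z. br x (br y z))"

text \<open>The element of \<open>H\<close> corresponding to \<open>\<alpha> \<in> H\<^sup>*\<close> under a form that is nondegenerate on \<open>H\<close>, and the
  squared length of \<open>\<alpha>\<close> for the form transported to \<open>H\<^sup>*\<close>.\<close>

definition dual_element ::
    "('g::complex_vector \<Rightarrow> 'g \<Rightarrow> complex) \<Rightarrow> 'g set \<Rightarrow> ('g \<Rightarrow> complex) \<Rightarrow> 'g"
  where "dual_element form H \<alpha> = (THE t. t \<in> H \<and> (\<forall>h\<in>H. form t h = \<alpha> h))"

definition squared_length ::
    "('g::complex_vector \<Rightarrow> 'g \<Rightarrow> complex) \<Rightarrow> 'g set \<Rightarrow> ('g \<Rightarrow> complex) \<Rightarrow> complex"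
  where "squared_length form H \<alpha> = form (dual_element form H \<alpha>) (dual_element form H \<alpha>)"

text \<open>The multiple of the Killing form for which the largest squared length of a root, i.e. that of
  the long roots, is 2. All squared lengths are then real.\<close>

definition normalized_form ::
    "('g::complex_vector \<Rightarrow> 'g \<Rightarrow> 'g) \<Rightarrow> 'g set \<Rightarrow> ('g \<Rightarrow> 'g \<Rightarrow> complex) \<Rightarrow> bool"
  where "normalized_form br H form \<longleftrightarrow>
    (\<exists>c. \<forall>x y. form x y = c * killing_form br x y) \<and>
    (\<exists>\<alpha>\<in>roots br H. squared_length form H \<alpha> = 2) \<and>
    (\<forall>\<beta>\<in>roots br H. squared_length form H \<beta> \<in> \<real> \<and> Re (squared_length form H \<beta>) \<le> 2)"


section \<open>The affine Lie algebra\<close>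

text \<open>The pair \<open>(f, c)\<close> stands for \<open>(\<Sum>n. f n \<otimes> t\<^sup>n) + c \<^bold>k\<close>, where \<open>f\<close> has finite support.\<close>

type_synonym 'g affine = "(int \<Rightarrow>\<^sub>0 'g) \<times> complex"

definition loop_elem :: "'g::complex_vector \<Rightarrow> int \<Rightarrow> 'g affine"
  where "loop_elem a n = (Poly_Mapping.single n a, 0)"

definition affine_bracket ::
    "('g::complex_vector \<Rightarrow> 'g \<Rightarrow> 'g) \<Rightarrow> ('g \<Rightarrow> 'g \<Rightarrow> complex) \<Rightarrow> 'g affine \<Rightarrow> 'g affine \<Rightarrow> 'g affine"
  where "affine_bracket br form X Y =
    (\<Sum>m\<in>Poly_Mapping.keys (fst X). \<Sum>n\<in>Poly_Mapping.keys (fst Y).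
      let a = Poly_Mapping.lookup (fst X) m; b = Poly_Mapping.lookup (fst Y) n
      in (Poly_Mapping.single (m + n) (br a b), if m + n = 0 then of_int m * form a b else 0))"

lemma affine_bracket_loop_elem:
  assumes "lie_algebra br" and "\<And>x. form 0 x = 0" and "\<And>x. form x 0 = 0"
  shows "affine_bracket br form (loop_elem a m) (loop_elem b n) =
    (Poly_Mapping.single (m + n) (br a b), if m + n = 0 then of_int m * form a b else 0)"
proof -
  interpret lie_algebra br by fact
  have "br (0 *\<^sub>C x) y = 0 *\<^sub>C br x y" "br x (0 *\<^sub>C y) = 0 *\<^sub>C br x y" for x y
    using br_linear_left br_linear_right unfolding linear_on_def by blast+
  then have "br 0 y = 0" "br x 0 = 0" for x y by simp_all
  then show ?thesis
    using assms(2,3) by (auto simp: affine_bracket_def loop_elem_def zero_prod_def)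
qed

text \<open>The operator \<open>a(n)\<close>, and the coefficients of the formal series \<open>a(x) w\<close>: the coefficient of
  \<open>x\<^sup>k\<close> is \<open>a(- k - 1) w\<close>.\<close>

definition mode ::
    "('g::complex_vector affine, 'w) lie_mod \<Rightarrow> 'g \<Rightarrow> int \<Rightarrow> 'w \<Rightarrow> 'w"
  where "mode W a n = mod_act W (loop_elem a n)"

definition field_series ::
    "('g::complex_vector affine, 'w) lie_mod \<Rightarrow> 'g \<Rightarrow> 'w \<Rightarrow> int \<Rightarrow> 'w"
  where "field_series W a w = (\<lambda>k. mode W a (- k - 1) w)"

definition poly_times_series ::
    "complex poly \<Rightarrow> (int \<Rightarrow> 'w::complex_vector) \<Rightarrow> int \<Rightarrow> 'w"
  where "poly_times_series p F = (\<lambda>k. \<Sum>i\<le>degree p. coeff p i *\<^sub>C F (k - int i))"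

definition in_category_E :: "('g::complex_vector affine, 'w::complex_vector) lie_mod \<Rightarrow> bool"
  where "in_category_E W \<longleftrightarrow>
    (\<exists>p. p \<noteq> 0 \<and>
      (\<forall>a. \<forall>w\<in>mod_space W. poly_times_series p (field_series W a w) = (\<lambda>k. 0)))"

definition integrable_module ::
    "('g::complex_vector \<Rightarrow> 'g \<Rightarrow> 'g) \<Rightarrow> 'g set \<Rightarrow> ('g affine, 'w::complex_vector) lie_mod \<Rightarrow> bool"
  where "integrable_module br H W \<longleftrightarrow>
    (\<forall>\<alpha>\<in>roots br H. \<forall>a\<in>root_space br H \<alpha>. \<forall>n. \<forall>w\<in>mod_space W. \<exists>N. (mode W a n ^^ N) w = 0)"

definition evaluation_module ::
    "('g::complex_vector, 'u::complex_vector) lie_mod \<Rightarrow> complex \<Rightarrow> ('g affine, 'u) lie_mod"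
  where "evaluation_module U z =
    \<lparr>mod_space = mod_space U,
     mod_act = (\<lambda>X u. \<Sum>n\<in>Poly_Mapping.keys (fst X).
       (z powi n) *\<^sub>C mod_act U (Poly_Mapping.lookup (fst X) n) u)\<rparr>"

end

theory Submission
  imports Defs "HOL-Computational_Algebra.Fundamental_Theorem_Algebra"
begin

text \<open>
  Let \<open>W\<close> be irreducible, integrable and in the category, with \<open>p(x) a(x) = 0\<close> on \<open>W\<close>. The
  commutator of this relation with a mode \<open>b(n)\<close> contains \<open>\<langle>a, b\<rangle> \<^bold>k\<close> as an isolated coefficient, so
  \<open>\<^bold>k\<close> acts as zero (\<open>level_zero\<close>). Powers of \<open>x\<close> can be removed from \<open>p\<close>; then the relation,
  read as a recurrence, determines the negative modes from the nonnegative ones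
  (\<open>recurrence_mem\<close>), and \<open>W\<close> is an irreducible module over \<open>\<gg>[t] / \<gg> \<otimes> (p)\<close>.

  Integrability is a statement about root vectors. The structure theory of \<open>\<gg>\<close> enters through
  \<open>root_vectors_span\<close>: the root vectors together with the brackets of opposite ones span a nonzero
  ideal, hence all of \<open>\<gg>\<close>. Conjugating by \<open>exp e\<close> then turns integrability into the statement
  that \<open>\<gg>\<close> is spanned by elements \<open>a\<close> for which every \<open>a \<otimes> f(t)\<close> is locally nilpotent
  (\<open>integrable_elements_span\<close>). This is used twice.

  First, if \<open>\<gg> \<otimes> J\<^sup>2\<close> kills \<open>W\<close> for an ideal \<open>J\<close> of \<open>\<complex>[t]\<close>, then \<open>\<gg> \<otimes> J\<close> acts by commuting locally
  nilpotent operators; their common kernel is a nonzero submodule, so \<open>\<gg> \<otimes> J\<close> kills \<open>W\<close>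
  (\<open>square_zero_ideal_kills\<close>). Hence \<open>p\<close> can be replaced by its radical (\<open>eval_at_node_poly\<close>), and
  \<open>\<gg>[t]\<close> acts through its values at the roots of \<open>p\<close>, that is, through commuting copies of \<open>\<gg>\<close>.
  Second, the operators by which \<open>\<gg>[t]\<close> acts form a finite-dimensional Lie algebra spanned by locally
  nilpotent ones. \<open>W\<close> is spanned by the ordered monomials in these, applied to one vector, and only
  finitely many of them do not kill that vector, so \<open>W\<close> is finite-dimensional (\<open>finite_dim_module\<close>).

  It remains to split a finite-dimensional irreducible module over commuting copies of \<open>\<gg>\<close>. There
  is a vector \<open>w\<close> whose orbit \<open>U\<^sub>i\<close> under each copy is irreducible
  (\<open>vector_with_irreducible_orbits\<close>), and \<open>T\<^sub>0 w \<otimes> T\<^sub>1 w \<otimes> \<dots> \<mapsto> \<dots> T\<^sub>1 T\<^sub>0 w\<close> is a nonzero homomorphism from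
  the tensor product of the \<open>U\<^sub>i\<close> to \<open>W\<close> (\<open>tensor_of_orbits\<close>). Both sides are irreducible, so it is
  an isomorphism.

  The irreducibility of the tensor product is the main point of the converse as well. As the
  points \<open>z\<^sub>i\<close> are distinct, interpolation recovers the action of \<open>\<gg>\<close> on each single factor
  (\<open>slot_interpolate\<close>), and by the density theorem a subspace stable under these actions is stable
  under all operators on single factors (\<open>irreducible_tensor_space\<close>). Integrability of the tensor
  product holds because root vectors act nilpotently on finite-dimensional irreducible modules.
\<close>


section \<open>Endomorphisms of a subspace\<close>

definition endo :: "'v::complex_vector set \<Rightarrow> ('v \<Rightarrow> 'v) \<Rightarrow> bool"
  where "endo V f \<longleftrightarrow> linear_on V f \<and> (\<forall>v\<in>V. f v \<in> V)"

lemma linear_onI: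
  assumes "\<And>x y. x \<in> V \<Longrightarrow> y \<in> V \<Longrightarrow> f (x + y) = f x + f y"
    and "\<And>c x. x \<in> V \<Longrightarrow> f (c *\<^sub>C x) = c *\<^sub>C f x"
  shows "linear_on V f"
  using assms by (auto simp: linear_on_def)

lemma linear_on_add: "linear_on V f \<Longrightarrow> x \<in> V \<Longrightarrow> y \<in> V \<Longrightarrow> f (x + y) = f x + f y"
  and linear_on_scale: "linear_on V f \<Longrightarrow> x \<in> V \<Longrightarrow> f (c *\<^sub>C x) = c *\<^sub>C f x"
  by (auto simp: linear_on_def)

lemma linear_on_zero: "linear_on V f \<Longrightarrow> cvec.subspace V \<Longrightarrow> f 0 = 0"
  using linear_on_scale[of V f 0 0] cvec.subspace_0 by auto

lemma linear_on_uminus: "linear_on V f \<Longrightarrow> x \<in> V \<Longrightarrow> f (- x) = - f x"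
  using linear_on_scale[of V f x "-1"] by simp

lemma linear_on_diff:
  "linear_on V f \<Longrightarrow> cvec.subspace V \<Longrightarrow> x \<in> V \<Longrightarrow> y \<in> V \<Longrightarrow> f (x - y) = f x - f y"
  using linear_on_add[of V f x "-y"] linear_on_uminus[of V f y] cvec.subspace_neg by fastforce

lemma linear_on_sum:
  assumes "linear_on V f" "cvec.subspace V" "\<And>i. i \<in> A \<Longrightarrow> x i \<in> V"
  shows "f (\<Sum>i\<in>A. x i) = (\<Sum>i\<in>A. f (x i))"
  using assms(3)
proof (induction A rule: infinite_finite_induct)
  case (insert i A)
  then show ?case
    using linear_on_add[OF assms(1), of "x i" "sum x A"] cvec.subspace_sum[OF assms(2), of A x]
    by simp
qed (simp_all add: linear_on_zero[OF assms(1,2)])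

lemma linear_on_subset: "linear_on V f \<Longrightarrow> U \<subseteq> V \<Longrightarrow> linear_on U f"
  unfolding linear_on_def by blast

lemma linear_on_compose:
  "linear_on V f \<Longrightarrow> (\<And>v. v \<in> V \<Longrightarrow> f v \<in> U) \<Longrightarrow> linear_on U g \<Longrightarrow> linear_on V (\<lambda>v. g (f v))"
  by (simp add: linear_on_def)

lemma linear_on_plus: "linear_on V f \<Longrightarrow> linear_on V g \<Longrightarrow> linear_on V (\<lambda>v. f v + g v)"
  by (simp add: linear_on_def scaleC_add_right)

lemma linear_on_scaled: "linear_on V f \<Longrightarrow> linear_on V (\<lambda>v. c *\<^sub>C f v)"
  by (simp add: linear_on_def scaleC_add_right scaleC_scaleC mult.commute)

lemma linear_on_sum_fun:
  "(\<And>i. i \<in> A \<Longrightarrow> linear_on V (f i)) \<Longrightarrow> linear_on V (\<lambda>v. \<Sum>i\<in>A. f i v)"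
  by (simp add: linear_on_def sum.distrib cvec.scale_sum_right)

lemma endoI: "linear_on V f \<Longrightarrow> (\<And>v. v \<in> V \<Longrightarrow> f v \<in> V) \<Longrightarrow> endo V f"
  and endo_linear: "endo V f \<Longrightarrow> linear_on V f"
  and endo_mem: "endo V f \<Longrightarrow> v \<in> V \<Longrightarrow> f v \<in> V"
  by (simp_all add: endo_def)

lemmas endo_add = linear_on_add[OF endo_linear]
  and endo_scale = linear_on_scale[OF endo_linear]
  and endo_zero = linear_on_zero[OF endo_linear]
  and endo_diff = linear_on_diff[OF endo_linear]
  and endo_sum = linear_on_sum[OF endo_linear]

lemma endo_ident: "endo V (\<lambda>v. v)"
  by (simp add: endo_def linear_on_def)

lemma endo_plus: "cvec.subspace V \<Longrightarrow> endo V f \<Longrightarrow> endo V g \<Longrightarrow> endo V (\<lambda>v. f v + g v)"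
  by (simp add: endo_def linear_on_plus cvec.subspace_add)

lemma endo_scaled: "cvec.subspace V \<Longrightarrow> endo V f \<Longrightarrow> endo V (\<lambda>v. c *\<^sub>C f v)"
  by (simp add: endo_def linear_on_scaled cvec.subspace_scale)

lemma endo_compose: "endo V f \<Longrightarrow> endo V g \<Longrightarrow> endo V (\<lambda>v. f (g v))"
  by (simp add: endo_def linear_on_compose[of V g V f])

lemma endo_sum_fun:
  "cvec.subspace V \<Longrightarrow> (\<And>i. i \<in> A \<Longrightarrow> endo V (f i)) \<Longrightarrow> endo V (\<lambda>v. \<Sum>i\<in>A. f i v)"
  by (simp add: endo_def linear_on_sum_fun cvec.subspace_sum)

lemma endo_funpow: "endo V f \<Longrightarrow> endo V (f ^^ n)"
  by (induction n) (simp_all add: endo_def linear_on_def)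

lemma endo_subset: "endo V f \<Longrightarrow> U \<subseteq> V \<Longrightarrow> (\<And>v. v \<in> U \<Longrightarrow> f v \<in> U) \<Longrightarrow> endo U f"
  unfolding endo_def using linear_on_subset by blast

lemma subspace_kernel_on:
  "cvec.subspace V \<Longrightarrow> linear_on V f \<Longrightarrow> cvec.subspace {v \<in> V. f v = 0}"
  by (auto simp: cvec.subspace_def linear_on_add linear_on_scale linear_on_zero)

lemma subspace_image_on:
  assumes "cvec.subspace V" "linear_on V f"
  shows "cvec.subspace (f ` V)"
proof (rule cvec.subspaceI)
  show "0 \<in> f ` V"
    using assms linear_on_zero[OF assms(2,1)] cvec.subspace_0 by (metis imageI)
next
  fix x y assume "x \<in> f ` V" "y \<in> f ` V"
  then obtain a b where ab: "a \<in> V" "b \<in> V" "x = f a" "y = f b" by blast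
  then have "x + y = f (a + b)" by (simp add: linear_on_add[OF assms(2)])
  then show "x + y \<in> f ` V" using ab assms(1) cvec.subspace_add by blast
next
  fix c x assume "x \<in> f ` V"
  then obtain a where a: "a \<in> V" "x = f a" by blast
  then have "c *\<^sub>C x = f (c *\<^sub>C a)" by (simp add: linear_on_scale[OF assms(2)])
  then show "c *\<^sub>C x \<in> f ` V" using a assms(1) cvec.subspace_scale by blast
qed

lemma linear_on_span_eqI:
  assumes "linear_on (cvec.span A) f" "linear_on (cvec.span A) g"
    and "\<And>x. x \<in> A \<Longrightarrow> f x = g x" and "x \<in> cvec.span A"
  shows "f x = g x"
proof -
  have "x \<in> cvec.span A \<and> f x = g x"
    using assms(4)
  proof (induction rule: cvec.span_induct_alt)
    case base
    then show ?case
      using assms(1,2) by (simp add: linear_on_zero cvec.span_zero)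
  next
    case (step c x y)
    then have "x \<in> cvec.span A" "c *\<^sub>C x \<in> cvec.span A"
      by (simp_all add: cvec.span_base cvec.span_scale)
    with step assms show ?case
      by (simp add: linear_on_add linear_on_scale cvec.span_add)
  qed
  then show ?thesis ..
qed

lemma span_closed_under:
  assumes "linear_on (cvec.span A) f" "x \<in> cvec.span A"
    and "\<And>x. x \<in> A \<Longrightarrow> f x \<in> S" "cvec.subspace S"
  shows "f x \<in> S"
proof -
  have "x \<in> cvec.span A \<and> f x \<in> S"
    using assms(2)
  proof (induction rule: cvec.span_induct_alt)
    case base
    then show ?case
      using assms by (simp add: linear_on_zero cvec.span_zero cvec.subspace_0)
  next
    case (step c x y)
    then have "x \<in> cvec.span A" "c *\<^sub>C x \<in> cvec.span A"
      by (simp_all add: cvec.span_base cvec.span_scale)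
    with step assms show ?case
      by (simp add: linear_on_add linear_on_scale cvec.span_add cvec.subspace_add cvec.subspace_scale)
  qed
  then show ?thesis ..
qed

section \<open>Locally nilpotent operators\<close>

definition locally_nilpotent :: "'v::zero set \<Rightarrow> ('v \<Rightarrow> 'v) \<Rightarrow> bool"
  where "locally_nilpotent V f \<longleftrightarrow> (\<forall>v\<in>V. \<exists>N. (f ^^ N) v = 0)"

lemma funpow_zero_ge:
  assumes "cvec.subspace V" "endo V f" "(f ^^ M) v = 0" "M \<le> N"
  shows "(f ^^ N) v = 0"
proof -
  have "(f ^^ N) v = (f ^^ (N - M)) ((f ^^ M) v)"
    using assms(4) by (metis comp_apply funpow_add le_add_diff_inverse2)
  then show ?thesis
    using assms endo_zero[OF endo_funpow] by metis
qed

lemma funpow_eq_on: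
  assumes "\<And>v. v \<in> V \<Longrightarrow> f v = g v" "\<And>v. v \<in> V \<Longrightarrow> f v \<in> V" "v \<in> V"
  shows "(f ^^ n) v = (g ^^ n) v \<and> (f ^^ n) v \<in> V"
  by (induction n) (use assms in auto)

lemma locally_nilpotent_cong:
  assumes "\<And>v. v \<in> V \<Longrightarrow> f v = g v" "\<And>v. v \<in> V \<Longrightarrow> f v \<in> V"
  shows "locally_nilpotent V f \<longleftrightarrow> locally_nilpotent V g"
  using funpow_eq_on[OF assms] by (simp add: locally_nilpotent_def)

lemma funpow_commute_on:
  assumes "endo V f" "\<And>v. v \<in> V \<Longrightarrow> f v \<in> V \<Longrightarrow> f (g v) = g (f v)" "v \<in> V"
  shows "(f ^^ n) (g v) = g ((f ^^ n) v)"
  using assms endo_mem[OF endo_funpow[OF assms(1)]] by (induction n) (auto simp: endo_mem)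

lemma locally_nilpotent_scaled:
  assumes V: "cvec.subspace V" and f: "endo V f" "locally_nilpotent V f"
  shows "locally_nilpotent V (\<lambda>v. c *\<^sub>C f v)"
proof -
  have "((\<lambda>v. c *\<^sub>C f v) ^^ n) v = c ^ n *\<^sub>C (f ^^ n) v" if "v \<in> V" for n v
    by (induction n)
      (use that endo_mem[OF endo_funpow[OF f(1)]] f in \<open>auto simp: scaleC_one endo_scale scaleC_scaleC\<close>)
  then show ?thesis using f(2) unfolding locally_nilpotent_def by fastforce
qed

text \<open>Since the two operators commute, both \<open>f v\<close> and \<open>g v\<close> die sooner than \<open>v\<close> under one of them and
  no later under the other, which makes an induction on the sum of the two exponents work.\<close>

lemma locally_nilpotent_plus:
  assumes V: "cvec.subspace V" and f: "endo V f" "locally_nilpotent V f"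
    and g: "endo V g" "locally_nilpotent V g"
    and comm: "\<And>v. v \<in> V \<Longrightarrow> f (g v) = g (f v)"
  shows "locally_nilpotent V (\<lambda>v. f v + g v)"
proof -
  let ?s = "\<lambda>v. f v + g v"
  have s: "endo V ?s" by (rule endo_plus[OF V f(1) g(1)])
  have key: "\<exists>K. (?s ^^ K) v = 0"
    if "N + M = k" "v \<in> V" "(f ^^ N) v = 0" "(g ^^ M) v = 0" for k N M v
    using that
  proof (induction k arbitrary: N M v rule: less_induct)
    case (less k)
    show ?case
    proof (cases "N = 0 \<or> M = 0")
      case True
      then have "(?s ^^ 0) v = 0" using less.prems by auto
      then show ?thesis ..
    next
      case False
      then obtain N' M' where NM: "N = Suc N'" "M = Suc M'" by (metis not0_implies_Suc)
      have "f v \<in> V" "g v \<in> V" using less.prems f g by (auto simp: endo_mem)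
      have "(f ^^ N') (f v) = 0" using less.prems(3) NM by (simp add: funpow_swap1)
      moreover have "(g ^^ M) (f v) = 0"
        using funpow_commute_on[OF g(1), of f v M] comm less.prems f(1) V endo_zero by fastforce
      moreover have "N' + M < k" using less.prems NM by simp
      ultimately obtain K1 where K1: "(?s ^^ K1) (f v) = 0"
        using less.IH[of "N' + M" N' M "f v"] \<open>f v \<in> V\<close> by auto
      have "(g ^^ M') (g v) = 0" using less.prems(4) NM by (simp add: funpow_swap1)
      moreover have "(f ^^ N) (g v) = 0"
        using funpow_commute_on[OF f(1), of g v N] comm less.prems g(1) V endo_zero by fastforce
      moreover have "N + M' < k" using less.prems NM by simp
      ultimately obtain K2 where K2: "(?s ^^ K2) (g v) = 0"
        using less.IH[of "N + M'" N M' "g v"] \<open>g v \<in> V\<close> by auto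
      let ?K = "max K1 K2"
      have "(?s ^^ Suc ?K) v = (?s ^^ ?K) (f v + g v)"
        by (simp only: funpow_Suc_right o_apply)
      also have "\<dots> = (?s ^^ ?K) (f v) + (?s ^^ ?K) (g v)"
        by (rule endo_add[OF endo_funpow[OF s]]) fact+
      also have "\<dots> = 0"
        using funpow_zero_ge[OF V s K1, of ?K] funpow_zero_ge[OF V s K2, of ?K] by simp
      finally show ?thesis ..
    qed
  qed
  show ?thesis
    unfolding locally_nilpotent_def
    using key f(2) g(2) unfolding locally_nilpotent_def by blast
qed

lemma locally_nilpotent_sum:
  fixes f :: "'i \<Rightarrow> 'v::complex_vector \<Rightarrow> 'v"
  assumes V: "cvec.subspace V"
    and f: "\<And>i. i \<in> A \<Longrightarrow> endo V (f i)" "\<And>i. i \<in> A \<Longrightarrow> locally_nilpotent V (f i)"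
    and comm: "\<And>i j v. i \<in> A \<Longrightarrow> j \<in> A \<Longrightarrow> v \<in> V \<Longrightarrow> f i (f j v) = f j (f i v)"
  shows "locally_nilpotent V (\<lambda>v. \<Sum>i\<in>A. f i v)"
  using f comm
proof (induction A rule: infinite_finite_induct)
  case (insert i A)
  have "locally_nilpotent V (\<lambda>v. f i v + (\<Sum>j\<in>A. f j v))"
  proof (rule locally_nilpotent_plus[OF V])
    show "locally_nilpotent V (\<lambda>v. \<Sum>i\<in>A. f i v)" using insert by simp
    show "endo V (\<lambda>v. \<Sum>i\<in>A. f i v)" using insert.prems(1) by (intro endo_sum_fun[OF V]) simp
    fix v assume v: "v \<in> V"
    have "f i (\<Sum>j\<in>A. f j v) = (\<Sum>j\<in>A. f i (f j v))"
      using insert.prems(1) v by (intro endo_sum[OF _ V]) (auto simp: endo_mem)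
    then show "f i (\<Sum>j\<in>A. f j v) = (\<Sum>j\<in>A. f j (f i v))"
      using insert.prems(3) v by simp
  qed (use insert.prems in auto)
  then show ?case using insert.hyps by simp
next
  case empty
  have "((\<lambda>v::'v. 0 :: 'v) ^^ 1) v = 0" for v by simp
  then show ?case unfolding locally_nilpotent_def sum.empty by blast
next
  case (infinite A)
  have "((\<lambda>v::'v. 0 :: 'v) ^^ 1) v = 0" for v by simp
  then show ?case unfolding locally_nilpotent_def sum.infinite[OF infinite.hyps] by blast
qed

text \<open>By commutativity the next operator preserves the common kernel of the previous ones, and the
  last nonzero vector among its powers applied to an element of that kernel lies in its own kernel.\<close>

lemma locally_nilpotent_common_kernel:
  assumes V: "cvec.subspace V" "V \<noteq> {0}" and "finite A"
    and f: "\<And>i. i \<in> A \<Longrightarrow> endo V (f i)" "\<And>i. i \<in> A \<Longrightarrow> locally_nilpotent V (f i)"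
    and comm: "\<And>i j v. i \<in> A \<Longrightarrow> j \<in> A \<Longrightarrow> v \<in> V \<Longrightarrow> f i (f j v) = f j (f i v)"
  shows "\<exists>v\<in>V. v \<noteq> 0 \<and> (\<forall>i\<in>A. f i v = 0)"
  using assms(3) f comm
proof (induction A rule: finite_induct)
  case empty
  then show ?case using V cvec.subspace_0[OF V(1)] by blast
next
  case (insert i A)
  then obtain v where v: "v \<in> V" "v \<noteq> 0" "\<forall>j\<in>A. f j v = 0" by auto
  obtain N0 where "(f i ^^ N0) v = 0"
    using insert.prems(2)[of i] v by (auto simp: locally_nilpotent_def)
  define N where "N = (LEAST N. (f i ^^ N) v = 0)"
  have N: "(f i ^^ N) v = 0" unfolding N_def by (rule LeastI) fact
  then have "N \<noteq> 0" using v by (intro notI) simp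
  then obtain M where M: "N = Suc M" by (metis not0_implies_Suc)
  let ?u = "(f i ^^ M) v"
  have fi: "endo V (f i)" using insert.prems by simp
  have "?u \<noteq> 0"
    using not_less_Least[of M "\<lambda>N. (f i ^^ N) v = 0"] M unfolding N_def by simp
  moreover have "?u \<in> V" using fi v by (simp add: endo_mem endo_funpow)
  moreover have "f i ?u = 0" using N M by simp
  moreover have "f j ?u = 0" if "j \<in> A" for j
  proof -
    have "f i (f j x) = f j (f i x)" if "x \<in> V" for x
      using insert.prems(3)[of i j x] \<open>j \<in> A\<close> that by simp
    then have "f j ?u = (f i ^^ M) (f j v)"
      using funpow_commute_on[OF fi, of "f j" v M] v(1) by simp
    also have "\<dots> = 0" using v(3) that endo_zero[OF endo_funpow[OF fi] V(1)] by simp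
    finally show ?thesis .
  qed
  ultimately show ?case by auto
qed

section \<open>Conjugation by the exponential of a locally nilpotent operator\<close>

text \<open>The formula \<open>e\<^sup>n g\<^sub>0 = \<Sum>\<^sub>k (n choose k) (ad e)\<^sup>k(g\<^sub>0) e\<^sup>n\<^sup>-\<^sup>k\<close>, with \<open>g\<^sub>k = (ad e)\<^sup>k(g\<^sub>0)\<close>,
    written in divided
  powers so that summing over \<open>n\<close> gives a product of exponentials.\<close>

lemma funpow_mult_binomial:
  assumes V: "cvec.subspace V" and e: "endo V e" and g: "\<And>k. endo V (g k)"
    and ad: "\<And>k v. v \<in> V \<Longrightarrow> g (Suc k) v = e (g k v) - g k (e v)"
    and w: "w \<in> V"
  shows "(1 / fact n) *\<^sub>C (e ^^ n) (g 0 w) =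
    (\<Sum>k\<le>n. (1 / fact k) *\<^sub>C (1 / fact (n - k)) *\<^sub>C g k ((e ^^ (n - k)) w))"
proof -
  define G where "G k m = (1 / fact k) *\<^sub>C (1 / fact m) *\<^sub>C g k ((e ^^ m) w)" for k m :: nat
  have em: "(e ^^ m) w \<in> V" for m using endo_mem[OF endo_funpow[OF e] w] .
  have GV: "G k m \<in> V" for k m
    unfolding G_def using em endo_mem[OF g] cvec.subspace_scale[OF V] by blast
  have eG: "e (G k m) = of_nat (Suc k) *\<^sub>C G (Suc k) m + of_nat (Suc m) *\<^sub>C G k (Suc m)" for k m
  proof -
    have "e (G k m) = (1 / fact k) *\<^sub>C (1 / fact m) *\<^sub>C e (g k ((e ^^ m) w))"
      unfolding G_def using em endo_mem[OF g] cvec.subspace_scale[OF V] endo_scale[OF e] by simp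
    also have "e (g k ((e ^^ m) w)) = g (Suc k) ((e ^^ m) w) + g k ((e ^^ Suc m) w)"
      using ad[OF em] by simp
    finally show ?thesis
      by (simp add: G_def scaleC_add_right scaleC_scaleC field_simps del: of_nat_Suc)
  qed
  have "(1 / fact n) *\<^sub>C (e ^^ n) (g 0 w) = (\<Sum>k\<le>n. G k (n - k))"
  proof (induction n)
    case 0
    then show ?case by (simp add: G_def scaleC_one)
  next
    case (Suc n)
    have g0: "(e ^^ n) (g 0 w) \<in> V" using endo_mem[OF endo_funpow[OF e]] endo_mem[OF g w] by blast
    have "of_nat (Suc n) *\<^sub>C ((1 / fact (Suc n)) *\<^sub>C (e ^^ Suc n) (g 0 w)) =
        e ((1 / fact n) *\<^sub>C (e ^^ n) (g 0 w))"
      using g0 by (simp add: endo_scale[OF e] scaleC_scaleC field_simps del: of_nat_Suc)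
    also have "\<dots> = (\<Sum>k\<le>n. e (G k (n - k)))"
      unfolding Suc using GV by (intro endo_sum[OF e V])
    also have "\<dots> = (\<Sum>k\<le>n. of_nat (Suc k) *\<^sub>C G (Suc k) (n - k)) +
        (\<Sum>k\<le>n. of_nat (Suc (n - k)) *\<^sub>C G k (Suc (n - k)))"
      by (simp only: eG sum.distrib)
    also have "(\<Sum>k\<le>n. of_nat (Suc k) *\<^sub>C G (Suc k) (n - k)) =
        (\<Sum>k\<le>Suc n. of_nat k *\<^sub>C G k (Suc n - k))"
      by (simp add: sum.atMost_Suc_shift[of "\<lambda>k. of_nat k *\<^sub>C G k (Suc n - k)"] del: of_nat_Suc sum.atMost_Suc)
    also have "(\<Sum>k\<le>n. of_nat (Suc (n - k)) *\<^sub>C G k (Suc (n - k))) =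
        (\<Sum>k\<le>Suc n. of_nat (Suc n - k) *\<^sub>C G k (Suc n - k))"
      by (simp add: Suc_diff_le del: of_nat_Suc of_nat_diff)
    also have "(\<Sum>k\<le>Suc n. of_nat k *\<^sub>C G k (Suc n - k)) +
        (\<Sum>k\<le>Suc n. of_nat (Suc n - k) *\<^sub>C G k (Suc n - k)) =
        (\<Sum>k\<le>Suc n. of_nat (Suc n) *\<^sub>C G k (Suc n - k))"
      unfolding sum.distrib[symmetric] scaleC_add_left[symmetric] of_nat_add[symmetric]
      by (intro sum.cong refl) simp
    also have "\<dots> = of_nat (Suc n) *\<^sub>C (\<Sum>k\<le>Suc n. G k (Suc n - k))"
      by (simp only: cvec.scale_sum_right)
    finally show ?case
      unfolding cvec.scale_cancel_left by (simp only: of_nat_eq_0_iff nat.simps simp_thms)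
  qed
  then show ?thesis by (simp add: G_def)
qed

text \<open>The sum is \<open>exp (ad e) g\<^sub>0\<close>. With \<open>E = exp e\<close> it satisfies \<open>E g\<^sub>0 = (exp (ad e) g\<^sub>0) E\<close>, and
    \<open>E\<close> is onto, so
  the powers of \<open>exp (ad e) g\<^sub>0\<close> kill a vector \<open>E w\<close> as soon as those of \<open>g\<^sub>0\<close> kill \<open>w\<close>.\<close>

lemma locally_nilpotent_exp_conj:
  assumes V: "cvec.subspace V" and e: "endo V e" "locally_nilpotent V e" and g: "\<And>k. endo V (g k)"
    and ad: "\<And>k v. v \<in> V \<Longrightarrow> g (Suc k) v = e (g k v) - g k (e v)"
    and zero: "\<And>k v. K < k \<Longrightarrow> v \<in> V \<Longrightarrow> g k v = 0"
    and g0: "locally_nilpotent V (g 0)"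
  shows "locally_nilpotent V (\<lambda>v. \<Sum>k\<le>K. (1 / fact k) *\<^sub>C g k v)"
proof -
  \<comment> \<open>The exponential series of \<open>e\<close> at \<open>w\<close>, cut off where its terms vanish; any later cut-off
    gives the same value.\<close>
  define ex where "ex N w = (\<Sum>m<N. (1 / fact m) *\<^sub>C (e ^^ m) w)" for N :: nat and w
  define E where "E w = ex (LEAST N. (e ^^ N) w = 0) w" for w
  let ?f = "\<lambda>v. \<Sum>k\<le>K. (1 / fact k) *\<^sub>C g k v"
  have E_eq: "E w = ex N w" if "(e ^^ N) w = 0" "w \<in> V" for N w
  proof -
    let ?M = "LEAST N. (e ^^ N) w = 0"
    have "(e ^^ ?M) w = 0" by (rule LeastI) fact
    then have "(e ^^ m) w = 0" if "?M \<le> m" for m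
      using funpow_zero_ge[OF V e(1)] that by blast
    then show ?thesis
      unfolding E_def ex_def using Least_le[of "\<lambda>N. (e ^^ N) w = 0" N] that(1)
      by (intro sum.mono_neutral_left) auto
  qed
  have nil: "\<exists>N. (e ^^ N) w = 0" if "w \<in> V" for w
    using e(2) that by (simp add: locally_nilpotent_def)
  have eV: "(e ^^ m) w \<in> V" if "w \<in> V" for m w using endo_mem[OF endo_funpow[OF e(1)] that] .
  have f: "endo V ?f" using endo_sum_fun[OF V, of "{..K}"] endo_scaled[OF V g] by simp
  have ex_endo: "endo V (ex N)" for N
    unfolding ex_def using endo_sum_fun[OF V, of "{..<N}"] endo_scaled[OF V endo_funpow[OF e(1)]] by simp
  \<comment> \<open>\<open>E\<close> is unipotent: \<open>E w - w\<close> is killed by a smaller power of \<open>e\<close> than \<open>w\<close> is.\<close>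
  have surj: "\<exists>w'\<in>V. E w' = w" if "w \<in> V" "(e ^^ N) w = 0" for N w
    using that
  proof (induction N arbitrary: w)
    case 0
    have "E 0 = ex 0 0" using cvec.subspace_0[OF V] by (intro E_eq) auto
    then show ?case using 0 by (auto simp: ex_def intro!: bexI[of _ w])
  next
    case (Suc N)
    have Ew: "E w = ex (Suc N) w" by (rule E_eq) (use Suc in auto)
    define d where "d = E w - w"
    have d: "d = (\<Sum>m<N. (1 / fact (Suc m)) *\<^sub>C (e ^^ Suc m) w)"
      unfolding d_def Ew ex_def sum.lessThan_Suc_shift by (simp add: scaleC_one del: funpow.simps(2))
    have EwV: "E w \<in> V" unfolding Ew by (rule endo_mem[OF ex_endo Suc.prems(1)])
    have dV: "d \<in> V" unfolding d_def using EwV Suc.prems(1) by (rule cvec.subspace_diff[OF V])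
    have "(e ^^ N) d = (\<Sum>m<N. (1 / fact (Suc m)) *\<^sub>C (e ^^ N) ((e ^^ Suc m) w))"
      unfolding d using eV Suc.prems(1)
      by (subst endo_sum[OF endo_funpow[OF e(1)] V])
        (auto simp: endo_scale[OF endo_funpow[OF e(1)]] intro!: cvec.subspace_scale[OF V] simp del:
            funpow.simps)
    also have "\<dots> = 0"
    proof (rule sum.neutral, rule ballI)
      fix m
      have "(e ^^ N) ((e ^^ Suc m) w) = (e ^^ (N + Suc m)) w" by (simp only: funpow_add o_apply)
      also have "\<dots> = 0" by (rule funpow_zero_ge[OF V e(1) Suc.prems(2)]) simp
      finally show "(1 / fact (Suc m)) *\<^sub>C (e ^^ N) ((e ^^ Suc m) w) = 0" by simp
    qed
    finally obtain d' where d': "d' \<in> V" "E d' = d" using Suc.IH[OF dV] by blast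
    obtain M where M: "(e ^^ M) d' = 0" using nil[OF d'(1)] by blast
    let ?L = "max M (Suc N)"
    have L: "(e ^^ ?L) d' = 0" "(e ^^ ?L) w = 0"
      using funpow_zero_ge[OF V e(1) M, of ?L] funpow_zero_ge[OF V e(1) Suc.prems(2), of ?L] by simp_all
    have wd: "w - d' \<in> V" using Suc.prems(1) d'(1) by (rule cvec.subspace_diff[OF V])
    have "E (w - d') = ex ?L (w - d')"
      using endo_diff[OF endo_funpow[OF e(1)] V Suc.prems(1) d'(1)] L by (intro E_eq[OF _ wd]) simp
    also have "\<dots> = ex ?L w - ex ?L d'" by (rule endo_diff[OF ex_endo V Suc.prems(1) d'(1)])
    also have "\<dots> = E w - d" using E_eq[OF L(1) d'(1)] E_eq[OF L(2) Suc.prems(1)] d'(2) by simp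
    finally have "E (w - d') = w" by (simp add: d_def)
    then show ?case using wd by blast
  qed
  have inter: "E (g 0 w) = ?f (E w)" and EV: "E w \<in> V" if w: "w \<in> V" for w
  proof -
    obtain M1 where M1: "(e ^^ M1) w = 0" using nil[OF w] by blast
    have gw: "g 0 w \<in> V" using endo_mem[OF g w] .
    obtain M2 where M2: "(e ^^ M2) (g 0 w) = 0" using nil[OF gw] by blast
    define N where "N = Suc K + M1 + M2"
    have "E w = ex M1 w" by (rule E_eq[OF M1 w])
    then show "E w \<in> V" using endo_mem[OF ex_endo w] by simp
    define H where "H k m = (1 / fact k) *\<^sub>C (1 / fact m) *\<^sub>C g k ((e ^^ m) w)" for k m :: nat
    have H0: "H k m = 0" if "K < k \<or> M1 \<le> m" for k m
    proof (cases "K < k")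
      case True
      then show ?thesis using zero[OF True eV[OF w]] by (simp add: H_def)
    next
      case False
      then have "(e ^^ m) w = 0" using that funpow_zero_ge[OF V e(1) M1] by blast
      then show ?thesis using endo_zero[OF g V] by (simp add: H_def)
    qed
    have "E (g 0 w) = ex N (g 0 w)"
      by (rule E_eq[OF funpow_zero_ge[OF V e(1) M2] gw]) (simp add: N_def)
    also have "\<dots> = (\<Sum>n<N. \<Sum>k\<le>n. H k (n - k))"
      unfolding ex_def H_def using funpow_mult_binomial[where g = g, OF V e(1) g ad w] by simp
    also have "\<dots> = (\<Sum>n<N. \<Sum>k | k \<le> n. H k (n - k))" by (simp add: atMost_def)
    also have "\<dots> = (\<Sum>(k, m) | k + m < N. H k m)"
      by (simp add: sum.triangle_reindex[of "\<lambda>k m. H k m"] atMost_def)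
    also have "\<dots> = (\<Sum>(k, m) \<in> {..K} \<times> {..<M1}. H k m)"
    proof (rule sum.mono_neutral_right)
      have "{(k, m). k + m < N} \<subseteq> {..N} \<times> {..N}" by auto
      then show "finite {(k, m). k + m < N}" by (rule finite_subset) simp
      show "{..K} \<times> {..<M1} \<subseteq> {(k, m). k + m < N}" by (auto simp: N_def)
      show "\<forall>x\<in>{(k, m). k + m < N} - {..K} \<times> {..<M1}. (case x of (k, m) \<Rightarrow> H k m) = 0"
        by (auto intro!: H0)
    qed
    also have "\<dots> = (\<Sum>k\<le>K. \<Sum>m<M1. H k m)" by (simp add: sum.cartesian_product)
    also have "\<dots> = (\<Sum>k\<le>K. (1 / fact k) *\<^sub>C g k (ex M1 w))"
    proof (rule sum.cong[OF refl])
      fix k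
      have "g k (ex M1 w) = (\<Sum>m<M1. (1 / fact m) *\<^sub>C g k ((e ^^ m) w))"
        unfolding ex_def using eV[OF w]
        by (subst endo_sum[OF g V]) (auto simp: endo_scale[OF g] intro!: cvec.subspace_scale[OF V])
      then show "(\<Sum>m<M1. H k m) = (1 / fact k) *\<^sub>C g k (ex M1 w)"
        by (simp add: H_def cvec.scale_sum_right)
    qed
    also have "\<dots> = ?f (E w)" using E_eq[OF M1 w] by simp
    finally show "E (g 0 w) = ?f (E w)" .
  qed
  have pow: "(?f ^^ n) (E w) = E ((g 0 ^^ n) w)" if "w \<in> V" for n w
  proof (induction n)
    case (Suc n)
    have "(g 0 ^^ n) w \<in> V" using endo_mem[OF endo_funpow[OF g] that] .
    then show ?case using Suc inter by simp
  qed simp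
  have E0: "E 0 = 0"
    using E_eq[of 0 0] cvec.subspace_0[OF V] by (simp add: ex_def)
  show ?thesis
    unfolding locally_nilpotent_def
  proof
    fix v assume v: "v \<in> V"
    obtain N where "(e ^^ N) v = 0" using nil[OF v] by blast
    then obtain w where w: "w \<in> V" "v = E w" using surj[OF v] by blast
    obtain n where "(g 0 ^^ n) w = 0" using g0 w(1) by (auto simp: locally_nilpotent_def)
    then have "(?f ^^ n) v = 0" using pow[OF w(1)] w(2) E0 by simp
    then show "\<exists>N. (?f ^^ N) v = 0" ..
  qed
qed

section \<open>Polynomial combinations of a sequence of vectors\<close>

text \<open>For \<open>X i = f\<^sup>i v\<close> this is \<open>p(f) v\<close>; for \<open>X i = a(i) v\<close> it is the action of \<open>a \<otimes> p(t)\<close> on \<open>v\<close>; and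
  \<open>\<forall>m. poly_comb p (\<lambda>i. X (m + i)) = 0\<close> is the linear recurrence with coefficients \<open>p\<close>.\<close>

definition poly_comb :: "complex poly \<Rightarrow> (nat \<Rightarrow> 'v::complex_vector) \<Rightarrow> 'v"
  where "poly_comb p X = (\<Sum>i\<le>degree p. coeff p i *\<^sub>C X i)"

lemma poly_comb_bound: "degree p \<le> N \<Longrightarrow> poly_comb p X = (\<Sum>i\<le>N. coeff p i *\<^sub>C X i)"
  unfolding poly_comb_def
  by (rule sum.mono_neutral_left) (auto simp: coeff_eq_0)

lemma poly_comb_add: "poly_comb (p + q) X = poly_comb p X + poly_comb q X"
proof -
  let ?N = "max (degree p) (degree q)"
  have "poly_comb (p + q) X = (\<Sum>i\<le>?N. coeff (p + q) i *\<^sub>C X i)"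
    by (rule poly_comb_bound) (rule degree_add_le_max)
  then show ?thesis
    by (simp add: scaleC_add_left sum.distrib poly_comb_bound[of p ?N] poly_comb_bound[of q ?N])
qed

lemma poly_comb_smult: "poly_comb (smult c p) X = c *\<^sub>C poly_comb p X"
  using poly_comb_bound[OF degree_smult_le[of c p]]
  by (simp add: poly_comb_def cvec.scale_sum_right scaleC_scaleC)

lemma poly_comb_diff: "poly_comb (p - q) X = poly_comb p X - poly_comb q X"
  using poly_comb_add[of p "smult (-1) q" X] poly_comb_smult[of "-1" q X] by simp

lemma poly_comb_0 [simp]: "poly_comb 0 X = 0"
  by (simp add: poly_comb_def)

lemma poly_comb_pCons: "poly_comb (pCons a p) X = a *\<^sub>C X 0 + poly_comb p (\<lambda>i. X (Suc i))"
proof -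
  have "poly_comb (pCons a p) X = (\<Sum>i\<le>Suc (degree p). coeff (pCons a p) i *\<^sub>C X i)"
    by (rule poly_comb_bound) (rule degree_pCons_le)
  then show ?thesis
    unfolding sum.atMost_Suc_shift by (simp add: poly_comb_def)
qed

lemma poly_comb_monom: "poly_comb (monom c n) X = c *\<^sub>C X n"
  by (induction n arbitrary: X) (simp_all add: monom_0 monom_Suc poly_comb_pCons)

lemma poly_comb_mult:
  "poly_comb (p * q) X = poly_comb p (\<lambda>i. poly_comb q (\<lambda>j. X (i + j)))"
proof (induction p arbitrary: X)
  case (pCons a p)
  then show ?case
    by (simp add: poly_comb_add poly_comb_smult poly_comb_pCons)
qed simp

lemma poly_comb_plus: "poly_comb p (\<lambda>i. X i + Y i) = poly_comb p X + poly_comb p Y"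
  by (simp add: poly_comb_def scaleC_add_right sum.distrib)

lemma poly_comb_minus: "poly_comb p (\<lambda>i. X i - Y i) = poly_comb p X - poly_comb p Y"
  by (simp add: poly_comb_def cvec.scale_right_diff_distrib sum_subtractf)

lemma poly_comb_swap:
  "poly_comb p (\<lambda>i. poly_comb q (\<lambda>j. X i j)) = poly_comb q (\<lambda>j. poly_comb p (\<lambda>i. X i j))"
  unfolding poly_comb_def cvec.scale_sum_right
  by (subst sum.swap) (simp add: scaleC_scaleC mult.commute)

lemma poly_comb_geometric: "poly_comb p (\<lambda>i. z ^ i *\<^sub>C v) = poly p z *\<^sub>C v"
  by (simp add: poly_comb_def poly_altdef cvec.scale_sum_left scaleC_scaleC)

lemma poly_comb_mem: "cvec.subspace V \<Longrightarrow> (\<And>i. X i \<in> V) \<Longrightarrow> poly_comb p X \<in> V"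
  unfolding poly_comb_def by (intro cvec.subspace_sum cvec.subspace_scale)

lemma linear_on_poly_comb:
  assumes "linear_on V f" "cvec.subspace V" "\<And>i. X i \<in> V"
  shows "f (poly_comb p X) = poly_comb p (\<lambda>i. f (X i))"
  unfolding poly_comb_def using assms
  by (subst linear_on_sum[OF assms(1,2)]) (auto simp: linear_on_scale cvec.subspace_scale)

section \<open>Finite-dimensional spaces\<close>

lemma finite_dim_subspace:
  assumes "finite_dim V" "cvec.subspace S" "S \<subseteq> V"
  shows "finite_dim S"
proof -
  obtain B where B: "finite B" "V = cvec.span B" using assms(1) by (auto simp: finite_dim_def)
  obtain C where C: "C \<subseteq> S" "\<not> cvec.dependent C" "S \<subseteq> cvec.span C"
    using cvec.maximal_independent_subset[of S] by metis
  have "finite C" using cvec.independent_span_bound[OF B(1) C(2)] C(1) assms(3) B(2) by auto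
  moreover have "S = cvec.span C" using C assms(2) cvec.span_subspace by metis
  ultimately show ?thesis by (auto simp: finite_dim_def)
qed

lemma finite_dim_span: "finite A \<Longrightarrow> finite_dim (cvec.span A)"
  by (auto simp: finite_dim_def)

definition irreducible_under :: "('v::complex_vector \<Rightarrow> 'v) set \<Rightarrow> 'v set \<Rightarrow> bool"
  where "irreducible_under F U \<longleftrightarrow> U \<noteq> {0} \<and>
    (\<forall>S. cvec.subspace S \<and> S \<subseteq> U \<and> (\<forall>f\<in>F. \<forall>v\<in>S. f v \<in> S) \<longrightarrow> S = {0} \<or> S = U)"

text \<open>Dimension is strictly monotone, so a nonzero invariant subspace spanned by as few vectors as
  possible is irreducible.\<close>

lemma minimal_invariant_subspace:
  assumes fd: "finite_dim V" and V: "cvec.subspace V" "V \<noteq> {0}"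
    and inv: "\<And>f v. f \<in> F \<Longrightarrow> v \<in> V \<Longrightarrow> f v \<in> V"
  obtains U where "cvec.subspace U" "U \<subseteq> V" "\<And>f v. f \<in> F \<Longrightarrow> v \<in> U \<Longrightarrow> f v \<in> U"
    "irreducible_under F U"
proof -
  define P where "P U n \<longleftrightarrow> cvec.subspace U \<and> U \<subseteq> V \<and> U \<noteq> {0} \<and> (\<forall>f\<in>F. \<forall>v\<in>U. f v \<in> U) \<and>
    (\<exists>B. finite B \<and> card B = n \<and> U = cvec.span B)" for U n
  obtain B where "finite B" "V = cvec.span B" using fd by (auto simp: finite_dim_def)
  then have "P V (card B)" using V inv by (auto simp: P_def)
  then have ex: "\<exists>n U. P U n" by blast
  define n where "n = (LEAST n. \<exists>U. P U n)"
  have "\<exists>U. P U n" unfolding n_def using LeastI_ex[OF ex] .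
  then obtain U B where U: "P U n" "finite B" "card B = n" "U = cvec.span B" by (auto simp: P_def)
  have least: "n \<le> m" if "P S m" for S m
    unfolding n_def using that by (intro Least_le) blast
  have min: "S = {0} \<or> S = U"
    if S: "cvec.subspace S" "S \<subseteq> U" "\<forall>f\<in>F. \<forall>v\<in>S. f v \<in> S" for S
  proof -
    obtain C where C: "C \<subseteq> S" "\<not> cvec.dependent C" "S \<subseteq> cvec.span C"
      using cvec.maximal_independent_subset[of S] by metis
    have Ceq: "S = cvec.span C" using C S(1) cvec.span_subspace by metis
    have Cn: "finite C" "card C \<le> n"
      using cvec.independent_span_bound[OF U(2) C(2)] C(1) S(2) U(3,4) by auto
    show ?thesis
    proof (rule ccontr)
      assume neg: "\<not> (S = {0} \<or> S = U)"
      then have "P S (card C)" using S U(1) Ceq Cn by (auto simp: P_def)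
      then have "card C = n" using least Cn by (simp add: le_antisym)
      obtain u where u: "u \<in> U" "u \<notin> cvec.span C" using neg S(2) Ceq by blast
      have "\<not> cvec.dependent (insert u C)" using u C(2) by (simp add: cvec.independent_insertI)
      moreover have "insert u C \<subseteq> cvec.span B" using u C(1) S(2) U(4) by auto
      ultimately have "card (insert u C) \<le> n"
        using cvec.independent_span_bound[OF U(2)] U(3) by blast
      moreover have "u \<notin> C" using u(2) cvec.span_base by blast
      ultimately show False using \<open>card C = n\<close> Cn(1) by simp
    qed
  qed
  have "irreducible_under F U" unfolding irreducible_under_def using U(1) min by (auto simp: P_def)
  then show thesis using that[of U] U(1) by (auto simp: P_def)
qed

lemma finite_dim_dependent_sequence:
  assumes "finite_dim V" "\<And>i. X i \<in> V"
  obtains p where "p \<noteq> 0" "poly_comb p X = 0"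
proof -
  obtain B where B: "finite B" "V = cvec.span B" using assms(1) by (auto simp: finite_dim_def)
  let ?n = "card B"
  show thesis
  proof (cases "inj_on X {..?n}")
    case False
    then obtain i j where ij: "i \<noteq> j" "X i = X j" by (auto simp: inj_on_def)
    let ?p = "monom 1 i + monom (-1) j :: complex poly"
    have "coeff ?p i = 1" using ij by simp
    then have "?p \<noteq> 0" by (metis coeff_0 zero_neq_one)
    moreover have "poly_comb ?p X = 0" using ij by (simp add: poly_comb_add poly_comb_monom)
    ultimately show thesis by (rule that)
  next
    case True
    let ?S = "X ` {..?n}"
    have "card ?S = Suc ?n" using True by (simp add: card_image)
    moreover have "?S \<subseteq> cvec.span B" using assms(2) B by auto
    ultimately have "cvec.dependent ?S"
      using cvec.independent_span_bound[OF B(1), of ?S] by auto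
    then obtain c v where c: "v \<in> ?S" "c v \<noteq> 0" "(\<Sum>v\<in>?S. c v *\<^sub>C v) = 0"
      using cvec.dependent_finite[of ?S] by auto
    define p where "p = (\<Sum>i\<le>?n. monom (c (X i)) i)"
    have coeff: "coeff p i = (if i \<le> ?n then c (X i) else 0)" for i
      by (simp add: p_def coeff_sum)
    obtain k where "k \<le> ?n" "v = X k" using c(1) by auto
    then have "coeff p k \<noteq> 0" using c(2) coeff by simp
    then have "p \<noteq> 0" by auto
    have "degree p \<le> ?n" by (rule degree_le) (simp add: coeff)
    then have "poly_comb p X = (\<Sum>i\<le>?n. c (X i) *\<^sub>C X i)"
      using coeff by (simp add: poly_comb_bound)
    also have "\<dots> = (\<Sum>v\<in>?S. c v *\<^sub>C v)" using True by (simp add: sum.reindex)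
    finally have "poly_comb p X = 0" using c(3) by simp
    with \<open>p \<noteq> 0\<close> show thesis by (rule that)
  qed
qed

text \<open>A polynomial of least degree with \<open>p(f) v = 0\<close> has a root; the complementary factor, applied
  to \<open>v\<close>, is an eigenvector.\<close>

lemma eigenvector_exists:
  assumes fd: "finite_dim V" and V: "cvec.subspace V" "V \<noteq> {0}" and f: "endo V f"
  obtains c v where "v \<in> V" "v \<noteq> 0" "f v = c *\<^sub>C v"
proof -
  obtain v where v: "v \<in> V" "v \<noteq> 0" using V cvec.subspace_0 by blast
  have fV: "(f ^^ i) v \<in> V" for i using endo_mem[OF endo_funpow[OF f] v(1)] .
  define Q where "Q n \<longleftrightarrow> (\<exists>p. p \<noteq> 0 \<and> degree p = n \<and> poly_comb p (\<lambda>i. (f ^^ i) v) = 0)" for n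
  have "\<exists>n. Q n"
    by (rule finite_dim_dependent_sequence[where X = "\<lambda>i. (f ^^ i) v", OF fd fV]) (auto simp: Q_def)
  then have "Q (LEAST n. Q n)" by (rule LeastI_ex[of Q])
  then obtain p where p: "p \<noteq> 0" "degree p = (LEAST n. Q n)" "poly_comb p (\<lambda>i. (f ^^ i) v) = 0"
    by (auto simp: Q_def)
  have "degree p \<noteq> 0"
  proof
    assume "degree p = 0"
    then obtain a where "p = [:a:]" by (rule degree_eq_zeroE)
    then show False using p v by (simp add: poly_comb_pCons)
  qed
  then obtain z where "poly p z = 0"
    using fundamental_theorem_of_algebra[of p] constant_degree by metis
  then obtain q where q: "p = [:- z, 1:] * q" by (auto simp: poly_eq_0_iff_dvd)
  with p(1) have "q \<noteq> 0" by auto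
  then have "degree p = Suc (degree q)" unfolding q by (subst degree_mult_eq) auto
  then have "\<not> Q (degree q)" using p(2) not_less_Least[of "degree q" Q] by simp
  define u where "u = poly_comb q (\<lambda>i. (f ^^ i) v)"
  have "u \<noteq> 0" using \<open>\<not> Q (degree q)\<close> \<open>q \<noteq> 0\<close> by (auto simp: Q_def u_def)
  have "u \<in> V" unfolding u_def by (rule poly_comb_mem[OF V(1) fV])
  have "f u = poly_comb q (\<lambda>i. (f ^^ Suc i) v)"
    unfolding u_def by (simp add: linear_on_poly_comb[OF endo_linear[OF f] V(1) fV])
  moreover have "poly_comb p (\<lambda>i. (f ^^ i) v) = poly_comb q (\<lambda>i. (f ^^ Suc i) v) - z *\<^sub>C u"
    unfolding q u_def
    by (simp add: poly_comb_diff poly_comb_smult poly_comb_pCons)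
  ultimately have "f u = z *\<^sub>C u" using p(3) by simp
  with \<open>u \<in> V\<close> \<open>u \<noteq> 0\<close> show thesis by (rule that)
qed

text \<open>Applying \<open>f - c j\<close> removes the \<open>j\<close>-th summand and rescales the others by nonzero factors.\<close>

lemma eigenvectors_sum_zero:
  assumes "cvec.subspace V" "endo V f" "finite K" "inj_on c K"
    and "\<And>k. k \<in> K \<Longrightarrow> x k \<in> V" "\<And>k. k \<in> K \<Longrightarrow> f (x k) = c k *\<^sub>C x k"
    and "(\<Sum>k\<in>K. x k) = 0" "k \<in> K"
  shows "x k = 0"
  using assms(3-8)
proof (induction K arbitrary: x k rule: finite_induct)
  case (insert j K)
  note V = assms(1) and f = assms(2)
  have "0 = f (\<Sum>k\<in>insert j K. x k) - c j *\<^sub>C (\<Sum>k\<in>insert j K. x k)"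
    using insert.prems(4) endo_zero[OF f V] by simp
  also have "f (\<Sum>k\<in>insert j K. x k) = (\<Sum>k\<in>insert j K. c k *\<^sub>C x k)"
    using insert.prems(2,3) by (subst endo_sum[OF f V]) (auto intro!: sum.cong)
  also have "\<dots> - c j *\<^sub>C (\<Sum>k\<in>insert j K. x k) = (\<Sum>k\<in>K. (c k - c j) *\<^sub>C x k)"
    using insert.hyps
    by (simp add: cvec.scale_sum_right scaleC_add_right cvec.scale_left_diff_distrib sum_subtractf)
  finally have s: "(\<Sum>k\<in>K. (c k - c j) *\<^sub>C x k) = 0" by simp
  have "(c i - c j) *\<^sub>C x i = 0" if "i \<in> K" for i
  proof (rule insert.IH[of "\<lambda>k. (c k - c j) *\<^sub>C x k", OF _ _ _ s that])
    show "inj_on c K" using insert.prems by (simp add: inj_on_def)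
    fix k assume "k \<in> K"
    then show "(c k - c j) *\<^sub>C x k \<in> V" "f ((c k - c j) *\<^sub>C x k) = c k *\<^sub>C (c k - c j) *\<^sub>C x k"
      using insert.prems(2,3)
      by (auto simp: cvec.subspace_scale[OF V] endo_scale[OF f] scaleC_scaleC mult.commute)
  qed
  then have z: "x i = 0" if "i \<in> K" for i
    using that insert.prems(1) insert.hyps by (auto simp: inj_on_def)
  then have "x j = 0" using insert.prems(4) insert.hyps by simp
  then show ?case using z insert.prems(5) by auto
qed simp

text \<open>This is how weights that move along an arithmetic progression force nilpotency.\<close>

lemma eigenvector_sequence_vanishes:
  assumes fd: "finite_dim V" and V: "cvec.subspace V" and f: "endo V f" and c: "inj c"
    and x: "\<And>k. x k \<in> V" "\<And>k. f (x k) = c k *\<^sub>C x k"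
  shows "\<exists>k::nat. x k = 0"
proof -
  obtain p where p: "p \<noteq> 0" "poly_comb p x = 0"
    by (rule finite_dim_dependent_sequence[where X = x, OF fd x(1)])
  have "coeff p (degree p) *\<^sub>C x (degree p) = 0"
  proof (rule eigenvectors_sum_zero[OF V f, of "{..degree p}" c "\<lambda>k. coeff p k *\<^sub>C x k"])
    show "inj_on c {..degree p}" using c by (rule inj_on_subset) simp
    show "(\<Sum>k\<le>degree p. coeff p k *\<^sub>C x k) = 0" using p(2) by (simp add: poly_comb_def)
  qed (use x in \<open>auto simp: cvec.subspace_scale[OF V] endo_scale[OF f] scaleC_scaleC mult.commute\<close>)
  then show ?thesis using p(1) by auto
qed

section \<open>Finite-dimensionality from locally nilpotent generators\<close>

lemma word_mem:
  assumes "\<And>i. i < d \<Longrightarrow> endo V (x i)" "v \<in> V" "set is \<subseteq> {..<d}"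
  shows "foldr x is v \<in> V"
  using assms(3) by (induction "is") (auto simp: assms(2) intro!: endo_mem[OF assms(1)])

text \<open>Exchanging two neighbouring letters of a word changes it by shorter words, so words can be
  sorted at the cost of shorter words. This is the spanning half of the
  Poincare--Birkhoff--Witt theorem.\<close>

lemma sorted_words_span:
  fixes x :: "nat \<Rightarrow> 'v::complex_vector \<Rightarrow> 'v"
  assumes V: "cvec.subspace V" and x: "\<And>i. i < d \<Longrightarrow> endo V (x i)" and v: "v \<in> V"
    and br: "\<And>i j. i < d \<Longrightarrow> j < d \<Longrightarrow>
      \<exists>c. \<forall>v\<in>V. x i (x j v) - x j (x i v) = (\<Sum>k<d. c k *\<^sub>C x k v)"
    and "set is \<subseteq> {..<d}"
  shows "foldr x is v \<in> cvec.span {foldr x js v | js. sorted js \<and> set js \<subseteq> {..<d}}"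
proof -
  \<comment> \<open>The filtration by word length, for all words and for sorted words.\<close>
  define W where "W n = cvec.span {foldr x is v | is. set is \<subseteq> {..<d} \<and> length is \<le> n}" for n
  define S where "S n = cvec.span {foldr x is v | is. sorted is \<and> set is \<subseteq> {..<d} \<and> length is \<le> n}" for n
  have Wmono: "W m \<subseteq> W n" if "m \<le> n" for m n
    unfolding W_def using that by (intro cvec.span_mono) auto
  have Smono: "S m \<subseteq> S n" if "m \<le> n" for m n
    unfolding S_def using that by (intro cvec.span_mono) auto
  have WV: "W n \<subseteq> V" for n
    unfolding W_def using word_mem[of d V x, OF x v] by (intro cvec.span_minimal V) auto
  have SV: "S n \<subseteq> V" for n
    unfolding S_def using word_mem[of d V x, OF x v] by (intro cvec.span_minimal V) auto
  have Wsub: "cvec.subspace (W n)" for n by (simp add: W_def)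
  have Ssub: "cvec.subspace (S n)" for n by (simp add: S_def)
  have Wword: "foldr x is v \<in> W n" if "set is \<subseteq> {..<d}" "length is \<le> n" for "is" n
    unfolding W_def using that by (intro cvec.span_base) auto
  have xW: "x i w \<in> W (Suc n)" if "i < d" "w \<in> W n" for i w n
  proof -
    have "linear_on (W n) (x i)" using endo_linear[OF x[OF that(1)]] WV by (rule linear_on_subset)
    then show ?thesis
      using that(2) unfolding W_def
    proof (rule span_closed_under)
      fix y assume "y \<in> {foldr x is v |is. set is \<subseteq> {..<d} \<and> length is \<le> n}"
      then obtain "is" where "y = foldr x is v" "set is \<subseteq> {..<d}" "length is \<le> n" by blast
      then show "x i y \<in> cvec.span {foldr x is v |is. set is \<subseteq> {..<d} \<and> length is \<le> Suc n}"
        using that(1) Wword[of "i # is" "Suc n"] by (simp add: W_def)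
    qed simp
  qed
  have insort: "x i (foldr x js v) - foldr x (insort i js) v \<in> W (length js)"
    if "i < d" "set js \<subseteq> {..<d}" "sorted js" for i js
    using that
  proof (induction js)
    case Nil
    then show ?case by (simp add: cvec.subspace_0 Wsub)
  next
    case (Cons j js)
    show ?case
    proof (cases "i \<le> j")
      case True
      then show ?thesis by (simp add: cvec.subspace_0 Wsub)
    next
      case False
      let ?y = "foldr x js v"
      have j: "j < d" and js: "set js \<subseteq> {..<d}" "sorted js" using Cons.prems by auto
      have y: "?y \<in> V" by (rule word_mem[of d V x, OF x v js(1)])
      obtain c where c: "\<forall>v\<in>V. x i (x j v) - x j (x i v) = (\<Sum>k<d. c k *\<^sub>C x k v)"
        using br[OF Cons.prems(1) j] by blast
      have IH: "x i ?y - foldr x (insort i js) v \<in> W (length js)"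
        by (rule Cons.IH[OF Cons.prems(1) js])
      have ins: "set (insort i js) \<subseteq> {..<d}" using js Cons.prems(1) by (auto simp: set_insort_key)
      have "x i (x j ?y) - x j (foldr x (insort i js) v) =
          (x i (x j ?y) - x j (x i ?y)) + x j (x i ?y - foldr x (insort i js) v)"
        using endo_diff[OF x[OF j] V endo_mem[OF x[OF Cons.prems(1)] y] word_mem[of d V x, OF x v ins]]
        by simp
      moreover have "x i (x j ?y) - x j (x i ?y) \<in> W (Suc (length js))"
      proof -
        have "x i (x j ?y) - x j (x i ?y) = (\<Sum>k<d. c k *\<^sub>C foldr x (k # js) v)" using c y by simp
        also have "\<dots> \<in> W (Suc (length js))"
          using js by (intro cvec.subspace_sum[OF Wsub] cvec.subspace_scale[OF Wsub] Wword) auto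
        finally show ?thesis .
      qed
      moreover have "x j (x i ?y - foldr x (insort i js) v) \<in> W (Suc (length js))"
        by (rule xW[OF j IH])
      ultimately have "x i (x j ?y) - x j (foldr x (insort i js) v) \<in> W (Suc (length js))"
        by (metis cvec.subspace_add Wsub)
      then show ?thesis using False by simp
    qed
  qed
  have WS: "W n \<subseteq> S n" for n
  proof (induction n)
    case 0
    have "{foldr x is v |is. set is \<subseteq> {..<d} \<and> length is \<le> 0} \<subseteq>
        {foldr x is v |is. sorted is \<and> set is \<subseteq> {..<d} \<and> length is \<le> 0}" by auto
    then show ?case unfolding W_def S_def by (rule cvec.span_mono)
  next
    case (Suc n)
    have xS: "x i w \<in> S (Suc n)" if "i < d" "w \<in> S n" for i w
    proof -
      have "linear_on (S n) (x i)" using endo_linear[OF x[OF that(1)]] SV by (rule linear_on_subset)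
      then show ?thesis
        using that(2) unfolding S_def[of n]
      proof (rule span_closed_under)
        fix y assume "y \<in> {foldr x is v |is. sorted is \<and> set is \<subseteq> {..<d} \<and> length is \<le> n}"
        then obtain js where js: "y = foldr x js v" "sorted js" "set js \<subseteq> {..<d}" "length js \<le> n"
          by blast
        have "x i y - foldr x (insort i js) v \<in> W n"
          using insort[OF that(1) js(3,2)] js(1) Wmono[OF js(4)] by blast
        then have "x i y - foldr x (insort i js) v \<in> S (Suc n)"
          using Suc.IH Smono[of n "Suc n"] by auto
        moreover have "foldr x (insort i js) v \<in> S (Suc n)"
          unfolding S_def using js that(1)
          by (intro cvec.span_base) (auto simp: sorted_insort set_insort_key intro!: exI[of _ "insort i js"])
        ultimately have "(x i y - foldr x (insort i js) v) + foldr x (insort i js) v \<in> S (Suc n)"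
          by (rule cvec.subspace_add[OF Ssub])
        then show "x i y \<in> S (Suc n)" by simp
      qed (rule Ssub)
    qed
    show ?case
      unfolding W_def
    proof (rule cvec.span_minimal[OF _ Ssub], rule subsetI)
      fix y assume "y \<in> {foldr x is v |is. set is \<subseteq> {..<d} \<and> length is \<le> Suc n}"
      then obtain "is" where w: "y = foldr x is v" "set is \<subseteq> {..<d}" "length is \<le> Suc n" by blast
      show "y \<in> S (Suc n)"
      proof (cases "is")
        case Nil
        then show ?thesis using w unfolding S_def by (intro cvec.span_base) (auto intro!: exI[of _ "[]"])
      next
        case (Cons i js)
        then have "foldr x js v \<in> S n" using Suc.IH Wword[of js n] w by auto
        then show ?thesis using xS[of i] Cons w by simp
      qed
    qed
  qed
  have "foldr x is v \<in> S (length is)" using WS Wword[OF assms(5) order_refl] by blast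
  moreover have "S (length is) \<subseteq> cvec.span {foldr x js v | js. sorted js \<and> set js \<subseteq> {..<d}}"
    unfolding S_def by (rule cvec.span_mono) auto
  ultimately show ?thesis by blast
qed

text \<open>A sorted word is a power of its smallest letter applied to a sorted word in the larger letters,
  and local nilpotency leaves finitely many of these powers.\<close>

lemma sorted_words_finite:
  fixes x :: "nat \<Rightarrow> 'v::complex_vector \<Rightarrow> 'v"
  assumes V: "cvec.subspace V" and x: "\<And>i. i < d \<Longrightarrow> endo V (x i)" and v: "v \<in> V"
    and nil: "\<And>i. i < d \<Longrightarrow> locally_nilpotent V (x i)" and "k \<le> d"
  shows "finite {foldr x js v | js. sorted js \<and> set js \<subseteq> {k..<d}}"
  using \<open>k \<le> d\<close>
proof (induction k rule: inc_induct)
  case base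
  have "{foldr x js v | js. sorted js \<and> set js \<subseteq> {d..<d}} \<subseteq> {v}" by auto
  then show ?case by (rule finite_subset) simp
next
  case (step k)
  let ?D = "{foldr x js v | js. sorted js \<and> set js \<subseteq> {Suc k..<d}}"
  have k: "k < d" using step by simp
  have split: "\<exists>n js'. js = replicate n k @ js' \<and> sorted js' \<and> set js' \<subseteq> {Suc k..<d}"
    if "sorted js" "set js \<subseteq> {k..<d}" for js
    using that
  proof (induction js)
    case Nil
    then show ?case by (intro exI[of _ 0] exI[of _ "[]"]) auto
  next
    case (Cons a js)
    show ?case
    proof (cases "a = k")
      case True
      obtain n js' where "js = replicate n k @ js'" "sorted js'" "set js' \<subseteq> {Suc k..<d}"
        using Cons by auto
      then show ?thesis using True by (intro exI[of _ "Suc n"] exI[of _ js']) auto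
    next
      case False
      then have "\<forall>y\<in>set (a # js). k < y \<and> y < d" using Cons.prems by fastforce
      then show ?thesis using Cons.prems
        by (intro exI[of _ 0] exI[of _ "a # js"]) (auto simp: Suc_le_eq)
    qed
  qed
  have rep: "foldr x (replicate n k) u = (x k ^^ n) u" for n u
    by (induction n) auto
  have "{foldr x js v | js. sorted js \<and> set js \<subseteq> {k..<d}} \<subseteq> (\<Union>u\<in>?D. range (\<lambda>n. (x k ^^ n) u))"
  proof clarify
    fix js :: "nat list" assume "sorted js" "set js \<subseteq> {k..<d}"
    then obtain n js' where "js = replicate n k @ js'" "sorted js'" "set js' \<subseteq> {Suc k..<d}"
      using split by blast
    then show "foldr x js v \<in> (\<Union>u\<in>?D. range (\<lambda>n. (x k ^^ n) u))" by (auto simp: rep)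
  qed
  moreover have "finite (range (\<lambda>n. (x k ^^ n) u))" if "u \<in> ?D" for u
  proof -
    have "u \<in> V" using that word_mem[of d V x, OF x v] by fastforce
    then obtain N where N: "(x k ^^ N) u = 0" using nil[OF k] by (auto simp: locally_nilpotent_def)
    have "range (\<lambda>n. (x k ^^ n) u) \<subseteq> insert 0 ((\<lambda>n. (x k ^^ n) u) ` {..N})"
    proof clarify
      fix n assume "(x k ^^ n) u \<notin> (\<lambda>n. (x k ^^ n) u) ` {..N}"
      then have "N \<le> n" by (metis atMost_iff imageI nat_le_linear)
      then show "(x k ^^ n) u = 0" by (rule funpow_zero_ge[OF V x[OF k] N])
    qed
    then show ?thesis by (rule finite_subset) simp
  qed
  moreover have "finite ?D" by (rule step.IH)
  ultimately show ?case by (meson finite_UN_I finite_subset)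
qed

text \<open>The subspace is the one generated by \<open>v\<close>; for an irreducible action it is everything.\<close>

lemma finite_dim_invariant_subspace:
  fixes x :: "nat \<Rightarrow> 'v::complex_vector \<Rightarrow> 'v"
  assumes V: "cvec.subspace V" and x: "\<And>i. i < d \<Longrightarrow> endo V (x i)" and v: "v \<in> V"
    and br: "\<And>i j. i < d \<Longrightarrow> j < d \<Longrightarrow>
      \<exists>c. \<forall>v\<in>V. x i (x j v) - x j (x i v) = (\<Sum>k<d. c k *\<^sub>C x k v)"
    and nil: "\<And>i. i < d \<Longrightarrow> locally_nilpotent V (x i)"
  obtains S where "cvec.subspace S" "S \<subseteq> V" "v \<in> S" "finite_dim S" "\<And>i s. i < d \<Longrightarrow> s \<in> S \<Longrightarrow> x i s \<in> S"
proof -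
  define A where "A = {foldr x is v | is. set is \<subseteq> {..<d}}"
  define B where "B = {foldr x js v | js. sorted js \<and> set js \<subseteq> {..<d}}"
  have "finite B" using sorted_words_finite[of V d x v 0, OF V x v nil] by (simp add: B_def atLeast0LessThan)
  have "A \<subseteq> cvec.span B" unfolding A_def B_def using sorted_words_span[of V d x v, OF V x v br] by blast
  moreover have "B \<subseteq> A" by (auto simp: A_def B_def)
  ultimately have "cvec.span A = cvec.span B" by (metis cvec.span_eq cvec.span_superset subset_trans)
  then have fd: "finite_dim (cvec.span A)" using finite_dim_span[OF \<open>finite B\<close>] by simp
  have AV: "cvec.span A \<subseteq> V"
    unfolding A_def using word_mem[of d V x, OF x v] by (intro cvec.span_minimal V) auto
  show thesis
  proof (rule that[of "cvec.span A", OF _ AV _ fd])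
    show "v \<in> cvec.span A" unfolding A_def by (rule cvec.span_base) (auto intro!: exI[of _ "[]"])
    fix i s assume i: "i < d" and s: "s \<in> cvec.span A"
    have "linear_on (cvec.span A) (x i)" using endo_linear[OF x[OF i]] AV by (rule linear_on_subset)
    then show "x i s \<in> cvec.span A"
      using s
    proof (rule span_closed_under)
      fix y assume "y \<in> A"
      then obtain "is" where "y = foldr x is v" "set is \<subseteq> {..<d}" by (auto simp: A_def)
      then have "x i y = foldr x (i # is) v" "set (i # is) \<subseteq> {..<d}" using i by auto
      then show "x i y \<in> cvec.span A" unfolding A_def by (intro cvec.span_base) blast
    qed simp
  qed simp
qed

section \<open>The density theorem\<close>

inductive_set generated_algebra :: "('v::complex_vector \<Rightarrow> 'v) set \<Rightarrow> ('v \<Rightarrow> 'v) set"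
  for F where
  ident: "(\<lambda>v. v) \<in> generated_algebra F"
| left_mult: "f \<in> F \<Longrightarrow> T \<in> generated_algebra F \<Longrightarrow> (\<lambda>v. f (T v)) \<in> generated_algebra F"
| plus: "T \<in> generated_algebra F \<Longrightarrow> R \<in> generated_algebra F \<Longrightarrow>
    (\<lambda>v. T v + R v) \<in> generated_algebra F"
| scaled: "T \<in> generated_algebra F \<Longrightarrow> (\<lambda>v. c *\<^sub>C T v) \<in> generated_algebra F"

lemma generated_algebra_base: "f \<in> F \<Longrightarrow> f \<in> generated_algebra F"
  using generated_algebra.left_mult[OF _ generated_algebra.ident, of f F] by simp

lemma generated_algebra_mult:
  assumes "T \<in> generated_algebra F" "R \<in> generated_algebra F"
  shows "(\<lambda>v. T (R v)) \<in> generated_algebra F"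
  using assms
proof induction
  case (left_mult f T)
  then show ?case using generated_algebra.left_mult[of f F "\<lambda>v. T (R v)"] by simp
next
  case ident
  then show ?case by simp
next
  case (plus T T')
  then show ?case using generated_algebra.plus[of "\<lambda>v. T (R v)" F "\<lambda>v. T' (R v)"] by simp
next
  case (scaled T c)
  then show ?case using generated_algebra.scaled[of "\<lambda>v. T (R v)" F c] by simp
qed

lemma generated_algebra_minus:
  assumes "T \<in> generated_algebra F" "R \<in> generated_algebra F"
  shows "(\<lambda>v. T v - R v) \<in> generated_algebra F"
  using generated_algebra.plus[OF assms(1) generated_algebra.scaled[OF assms(2), of "-1"]] by simp

lemma generated_algebra_closed:
  assumes "T \<in> generated_algebra F" "cvec.subspace S" "\<And>f v. f \<in> F \<Longrightarrow> v \<in> S \<Longrightarrow> f v \<in> S" "v \<in> S"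
  shows "T v \<in> S"
  using assms(1)
proof induction
  case (left_mult f T)
  show ?case by (rule assms(3)[OF left_mult(1) left_mult.IH])
next
  case (plus T R)
  show ?case by (rule cvec.subspace_add[OF assms(2) plus.IH])
next
  case (scaled T c)
  show ?case by (rule cvec.subspace_scale[OF assms(2) scaled.IH])
qed (rule assms(4))

lemma generated_algebra_endo:
  assumes "T \<in> generated_algebra F" "cvec.subspace V" "\<And>f. f \<in> F \<Longrightarrow> endo V f"
  shows "endo V T"
  using assms(1)
proof induction
  case (left_mult f T)
  show ?case by (rule endo_compose[OF assms(3)[OF left_mult(1)] left_mult.IH])
next
  case (plus T R)
  show ?case by (rule endo_plus[OF assms(2) plus.IH])
next
  case (scaled T c)
  show ?case by (rule endo_scaled[OF assms(2) scaled.IH])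
qed (rule endo_ident)

lemma generated_algebra_commute:
  assumes T: "T \<in> generated_algebra F" and R: "R \<in> generated_algebra G"
    and V: "cvec.subspace V" and F: "\<And>f. f \<in> F \<Longrightarrow> endo V f" and G: "\<And>g. g \<in> G \<Longrightarrow> endo V g"
    and comm: "\<And>f g v. f \<in> F \<Longrightarrow> g \<in> G \<Longrightarrow> v \<in> V \<Longrightarrow> f (g v) = g (f v)"
    and v: "v \<in> V"
  shows "T (R v) = R (T v)"
proof -
  have one: "f (R v) = R (f v)" if f: "f \<in> F" and "v \<in> V" for f v
    using R
  proof induction
    case (left_mult g R)
    have "R v \<in> V" using endo_mem[OF generated_algebra_endo[OF left_mult(2) V G]] that by blast
    then show ?case using left_mult comm[OF f, of g "R v"] by simp
  next
    case (plus R R')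
    have "R v \<in> V" "R' v \<in> V"
      using endo_mem[OF generated_algebra_endo[OF _ V G]] plus(1,2) that by blast+
    then show ?case using plus endo_add[OF F[OF f]] by simp
  next
    case (scaled R c)
    have "R v \<in> V"
      using endo_mem[OF generated_algebra_endo[OF _ V G]] scaled(1) that by blast
    then show ?case using scaled endo_scale[OF F[OF f]] by simp
  qed simp
  have RV: "endo V R" by (rule generated_algebra_endo[OF R V G])
  show ?thesis
    using T
  proof induction
    case (left_mult f T)
    have "T v \<in> V" using endo_mem[OF generated_algebra_endo[OF left_mult(2) V F]] v by blast
    then show ?case using left_mult one by simp
  next
    case (plus T T')
    have "T v \<in> V" "T' v \<in> V"
      using endo_mem[OF generated_algebra_endo[OF _ V F]] plus(1,2) v by blast+
    then show ?case using plus endo_add[OF RV] by simp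
  next
    case (scaled T c)
    have "T v \<in> V"
      using endo_mem[OF generated_algebra_endo[OF _ V F]] scaled(1) v by blast
    then show ?case using scaled endo_scale[OF RV] by simp
  qed simp
qed

definition orbit :: "('v::complex_vector \<Rightarrow> 'v) set \<Rightarrow> 'v \<Rightarrow> 'v set"
  where "orbit F v = (\<lambda>T. T v) ` generated_algebra F"

lemma orbit_self: "v \<in> orbit F v"
  unfolding orbit_def by (rule image_eqI[OF _ generated_algebra.ident]) simp

lemma orbit_closed: "f \<in> F \<Longrightarrow> u \<in> orbit F v \<Longrightarrow> f u \<in> orbit F v"
  unfolding orbit_def using generated_algebra.left_mult[of f F] by (auto intro!: image_eqI)

lemma subspace_orbit: "cvec.subspace (orbit F v)"
proof (rule cvec.subspaceI)
  have "(\<lambda>v. 0 *\<^sub>C v) \<in> generated_algebra F"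
    using generated_algebra.scaled[OF generated_algebra.ident] .
  then show "0 \<in> orbit F v" unfolding orbit_def by force
next
  fix x y assume "x \<in> orbit F v" "y \<in> orbit F v"
  then obtain T R where "T \<in> generated_algebra F" "R \<in> generated_algebra F" "x = T v" "y = R v"
    by (auto simp: orbit_def)
  then show "x + y \<in> orbit F v"
    unfolding orbit_def by (intro image_eqI[OF _ generated_algebra.plus[of T F R]]) auto
next
  fix c x assume "x \<in> orbit F v"
  then obtain T where "T \<in> generated_algebra F" "x = T v" by (auto simp: orbit_def)
  then show "c *\<^sub>C x \<in> orbit F v"
    unfolding orbit_def by (intro image_eqI[OF _ generated_algebra.scaled[of T F c]]) auto
qed

lemma orbit_subset:
  "cvec.subspace S \<Longrightarrow> (\<And>f v. f \<in> F \<Longrightarrow> v \<in> S \<Longrightarrow> f v \<in> S) \<Longrightarrow> v \<in> S \<Longrightarrow> orbit F v \<subseteq> S"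
  unfolding orbit_def using generated_algebra_closed by blast

lemma irreducible_underD:
  assumes "irreducible_under F U" "cvec.subspace S" "S \<subseteq> U" "\<forall>f\<in>F. \<forall>v\<in>S. f v \<in> S"
  shows "S = {0} \<or> S = U"
proof -
  have "\<forall>S. cvec.subspace S \<and> S \<subseteq> U \<and> (\<forall>f\<in>F. \<forall>v\<in>S. f v \<in> S) \<longrightarrow> S = {0} \<or> S = U"
    using assms(1) unfolding irreducible_under_def by (rule conjunct2)
  then have "cvec.subspace S \<and> S \<subseteq> U \<and> (\<forall>f\<in>F. \<forall>v\<in>S. f v \<in> S) \<longrightarrow> S = {0} \<or> S = U" by (rule spec)
  then show ?thesis by (rule mp) (intro conjI assms(2-4))
qed

lemma irreducible_under_eq:
  "irreducible_under F U \<Longrightarrow> cvec.subspace S \<Longrightarrow> S \<subseteq> U \<Longrightarrow> (\<And>f v. f \<in> F \<Longrightarrow> v \<in> S \<Longrightarrow> f v \<in> S) \<Longrightarrow>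
    s \<in> S \<Longrightarrow> s \<noteq> 0 \<Longrightarrow> S = U"
  unfolding irreducible_under_def by blast

lemma irreducible_under_orbit:
  assumes "irreducible_under F U" "cvec.subspace U" "\<And>f. f \<in> F \<Longrightarrow> endo U f" "u \<in> U" "u \<noteq> 0"
  shows "orbit F u = U"
proof (rule irreducible_under_eq[OF assms(1) subspace_orbit _ _ orbit_self assms(5)])
  show "orbit F u \<subseteq> U"
  proof (rule orbit_subset[OF assms(2)])
    show "f v \<in> U" if "f \<in> F" "v \<in> U" for f v using endo_mem[OF assms(3)] that .
  qed (rule assms(4))
qed (rule orbit_closed)

text \<open>The step adding \<open>c\<close> to \<open>B\<close>: the operators killing \<open>B\<close> form a left ideal, so they send \<open>c\<close>
  onto all of \<open>U\<close>. If all those that kill \<open>c\<close> also killed \<open>b\<close>, then \<open>T c \<mapsto> T b\<close> would be a well-defined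
  endomorphism of the irreducible space \<open>U\<close>, hence a scalar \<open>\<lambda>\<close> by Schur's lemma, and \<open>b - \<lambda> c\<close> would
  be killed by everything that kills \<open>B\<close>.\<close>

lemma density:
  assumes irr: "irreducible_under F U" and U: "cvec.subspace U" "finite_dim U"
    and F: "\<And>f. f \<in> F \<Longrightarrow> endo U f"
    and "finite B" "B \<subseteq> U" "b \<in> U" "b \<notin> cvec.span B"
  shows "\<exists>T\<in>generated_algebra F. (\<forall>c\<in>B. T c = 0) \<and> T b \<noteq> 0"
  using assms(5-)
proof (induction B arbitrary: b rule: finite_induct)
  case empty
  then have "b \<noteq> 0" by auto
  then show ?case by (intro bexI[OF _ generated_algebra.ident]) auto
next
  case (insert c B)
  have TU: "endo U T" if "T \<in> generated_algebra F" for T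
    by (rule generated_algebra_endo[OF that U(1) F])
  have c: "c \<in> U" and B: "B \<subseteq> U" using insert.prems by auto
  show ?case
  proof (cases "c \<in> cvec.span B")
    case True
    then have "b \<notin> cvec.span B" using insert.prems(3) cvec.span_redundant by blast
    then obtain T where T: "T \<in> generated_algebra F" "\<forall>c\<in>B. T c = 0" "T b \<noteq> 0"
      using insert.IH[OF B insert.prems(2)] by blast
    have "cvec.span B \<subseteq> U" using B U(1) by (rule cvec.span_minimal)
    then have lin: "linear_on (cvec.span B) T" by (rule linear_on_subset[OF endo_linear[OF TU[OF T(1)]]])
    have "T c = 0"
    proof (rule linear_on_span_eqI[OF lin, of "\<lambda>_. 0"])
      show "linear_on (cvec.span B) (\<lambda>_. 0)" by (simp add: linear_on_def)
    qed (use T(2) True in auto)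
    then show ?thesis using T by (intro bexI[OF _ T(1)]) simp
  next
    case False
    define L where "L = {T \<in> generated_algebra F. \<forall>c\<in>B. T c = 0}"
    have L0: "(\<lambda>v. 0 *\<^sub>C v) \<in> L"
      unfolding L_def using generated_algebra.scaled[OF generated_algebra.ident, of 0 F] by simp
    have Lp: "(\<lambda>v. T v + R v) \<in> L" if "T \<in> L" "R \<in> L" for T R
      using that generated_algebra.plus[of T F R] unfolding L_def by simp
    have Lm: "(\<lambda>v. T v - R v) \<in> L" if "T \<in> L" "R \<in> L" for T R
      using that generated_algebra_minus[of T F R] unfolding L_def by simp
    have Ls: "(\<lambda>v. a *\<^sub>C T v) \<in> L" if "T \<in> L" for T a
      using that generated_algebra.scaled[of T F a] unfolding L_def by simp
    have Lf: "(\<lambda>v. f (T v)) \<in> L" if "T \<in> L" "f \<in> F" for T f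
      using that endo_zero[OF F[OF that(2)] U(1)] generated_algebra.left_mult[OF that(2), of T]
      unfolding L_def by simp
    have LU: "endo U T" if "T \<in> L" for T using TU that by (simp add: L_def)
    have Lc: "(\<lambda>T. T c) ` L = U"
    proof -
      obtain T where T: "T \<in> L" "T c \<noteq> 0" using insert.IH[OF B c False] by (auto simp: L_def)
      show ?thesis
      proof (rule irreducible_under_eq[OF irr, where s = "T c"])
        show "cvec.subspace ((\<lambda>T. T c) ` L)"
        proof (rule cvec.subspaceI)
          show "0 \<in> (\<lambda>T. T c) ` L" using L0 by (intro image_eqI[of _ _ "\<lambda>v. 0 *\<^sub>C v"]) auto
        next
          fix x y assume "x \<in> (\<lambda>T. T c) ` L" "y \<in> (\<lambda>T. T c) ` L"
          then obtain T R where "T \<in> L" "R \<in> L" "x = T c" "y = R c" by auto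
          then show "x + y \<in> (\<lambda>T. T c) ` L" by (intro image_eqI[OF _ Lp[of T R]]) auto
        next
          fix a x assume "x \<in> (\<lambda>T. T c) ` L"
          then obtain T where "T \<in> L" "x = T c" by auto
          then show "a *\<^sub>C x \<in> (\<lambda>T. T c) ` L" by (intro image_eqI[OF _ Ls[of T a]]) auto
        qed
        show "(\<lambda>T. T c) ` L \<subseteq> U" using endo_mem[OF LU c] by auto
        fix f v assume "f \<in> F" "v \<in> (\<lambda>T. T c) ` L"
        then obtain T where "T \<in> L" "v = T c" by auto
        then show "f v \<in> (\<lambda>T. T c) ` L" using \<open>f \<in> F\<close> by (intro image_eqI[OF _ Lf[of T f]]) auto
      qed (use T in auto)
    qed
    show ?thesis
    proof (rule ccontr)
      assume "\<not> ?thesis"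
      then have contr: "T b = 0" if "T \<in> L" "T c = 0" for T using that by (auto simp: L_def)
      define \<phi> where "\<phi> u = (SOME T. T \<in> L \<and> T c = u) b" for u
      have \<phi>: "\<phi> (T c) = T b" if T: "T \<in> L" for T
      proof -
        let ?R = "SOME R. R \<in> L \<and> R c = T c"
        have R: "?R \<in> L \<and> ?R c = T c" using T by (intro someI[of "\<lambda>R. R \<in> L \<and> R c = T c" T]) simp
        have "(\<lambda>v. ?R v - T v) \<in> L" using R T by (intro Lm) auto
        from contr[OF this] R have "?R b - T b = 0" by simp
        then show ?thesis by (simp add: \<phi>_def)
      qed
      have rep: "\<exists>T\<in>L. u = T c" if "u \<in> U" for u using that Lc by auto
      have \<phi>U: "endo U \<phi>"
      proof (rule endoI[OF linear_onI])
        fix x y assume "x \<in> U" "y \<in> U"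
        then obtain T R where TR: "T \<in> L" "x = T c" "R \<in> L" "y = R c" using rep by blast
        then show "\<phi> (x + y) = \<phi> x + \<phi> y" using \<phi>[OF Lp[OF TR(1,3)]] \<phi> by simp
      next
        fix a x assume "x \<in> U"
        then obtain T where T: "T \<in> L" "x = T c" using rep by blast
        then show "\<phi> (a *\<^sub>C x) = a *\<^sub>C \<phi> x" using \<phi>[OF Ls[OF T(1)]] \<phi> by simp
      next
        fix u assume "u \<in> U"
        then obtain T where T: "T \<in> L" "u = T c" using rep by blast
        then show "\<phi> u \<in> U" using \<phi> endo_mem[OF LU insert.prems(2)] by simp
      qed
      have "U \<noteq> {0}" using irr by (simp add: irreducible_under_def)
      then obtain l u where u: "u \<in> U" "u \<noteq> 0" "\<phi> u = l *\<^sub>C u"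
        by (rule eigenvector_exists[OF U(2,1) _ \<phi>U])
      have "{u \<in> U. \<phi> u - l *\<^sub>C u = 0} = U"
      proof (rule irreducible_under_eq[OF irr, where s = u])
        show "cvec.subspace {u \<in> U. \<phi> u - l *\<^sub>C u = 0}"
        proof (rule subspace_kernel_on[OF U(1)])
          show "linear_on U (\<lambda>u. \<phi> u - l *\<^sub>C u)"
            using linear_on_plus[OF endo_linear[OF \<phi>U] linear_on_scaled[OF endo_linear[OF
                endo_ident], of _ "- l"]]
            by simp
        qed
        fix f v assume f: "f \<in> F" and "v \<in> {u \<in> U. \<phi> u - l *\<^sub>C u = 0}"
        then have v: "v \<in> U" "\<phi> v = l *\<^sub>C v" by auto
        obtain T where T: "T \<in> L" "v = T c" using rep[OF v(1)] by blast
        have "\<phi> (f v) = f (\<phi> v)" using \<phi>[OF Lf[OF T(1) f]] \<phi>[OF T(1)] T(2) by simp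
        then show "f v \<in> {u \<in> U. \<phi> u - l *\<^sub>C u = 0}"
          using v endo_mem[OF F[OF f] v(1)] endo_scale[OF F[OF f] v(1)] by simp
      qed (use u in auto)
      then have \<phi>l: "\<phi> u = l *\<^sub>C u" if "u \<in> U" for u using that by auto
      have T0: "T (b - l *\<^sub>C c) = 0" if "T \<in> L" for T
      proof -
        have "T (b - l *\<^sub>C c) = T b - l *\<^sub>C T c"
          using endo_diff[OF LU[OF that] U(1) insert.prems(2) cvec.subspace_scale[OF U(1) c]]
            endo_scale[OF LU[OF that] c] by simp
        also have "\<dots> = 0" using \<phi>l[OF endo_mem[OF LU[OF that] c]] \<phi>[OF that] by simp
        finally show ?thesis .
      qed
      have "b - l *\<^sub>C c \<notin> cvec.span B" using insert.prems(3) cvec.span_breakdown_eq by blast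
      moreover have "b - l *\<^sub>C c \<in> U"
        using insert.prems(2) c U(1) cvec.subspace_diff cvec.subspace_scale by blast
      ultimately obtain T where "T \<in> L" "T (b - l *\<^sub>C c) \<noteq> 0"
        using insert.IH[OF B] by (auto simp: L_def)
      then show False using T0 by blast
    qed
  qed
qed

text \<open>Together with linearity this says that the generated algebra contains all operators on \<open>U\<close>
  (Burnside).\<close>

lemma matrix_unit_in_generated_algebra:
  assumes irr: "irreducible_under F U" and F: "\<And>f. f \<in> F \<Longrightarrow> endo U f"
    and B: "finite B" "\<not> cvec.dependent B" "U = cvec.span B" and b: "b \<in> B" "v \<in> U"
  obtains T where "T \<in> generated_algebra F" "T b = v" "\<And>c. c \<in> B \<Longrightarrow> c \<noteq> b \<Longrightarrow> T c = 0"
proof -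
  have U: "cvec.subspace U" "finite_dim U" using B finite_dim_span by auto
  have "b \<notin> cvec.span (B - {b})" using B(2) b(1) by (auto simp: cvec.dependent_def)
  moreover have "B \<subseteq> U" using B(3) cvec.span_superset by blast
  ultimately have "\<exists>T\<in>generated_algebra F. (\<forall>c\<in>B - {b}. T c = 0) \<and> T b \<noteq> 0"
    using B(1) b(1) by (intro density[OF irr U F]) auto
  then obtain T where T: "T \<in> generated_algebra F" "\<forall>c\<in>B - {b}. T c = 0" "T b \<noteq> 0"
    by blast
  have "T b \<in> U" using endo_mem[OF generated_algebra_endo[OF T(1) U(1) F]] b(1) \<open>B \<subseteq> U\<close> by blast
  then have "v \<in> orbit F (T b)" using irreducible_under_orbit[OF irr U(1) F _ T(3)] b(2) by simp
  then obtain R where R: "R \<in> generated_algebra F" "v = R (T b)" by (auto simp: orbit_def)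
  show thesis
  proof (rule that[OF generated_algebra_mult[OF R(1) T(1)]])
    show "R (T c) = 0" if "c \<in> B" "c \<noteq> b" for c
      using T(2) that endo_zero[OF generated_algebra_endo[OF R(1) U(1) F] U(1)] by simp
  qed (use R in simp)
qed

section \<open>Root vectors\<close>

context lie_algebra
begin

lemma endo_br: "endo UNIV (br x)"
  using br_linear_right by (simp add: endo_def)

lemmas br_add_right = endo_add[OF endo_br UNIV_I UNIV_I]
  and br_scale_right = endo_scale[OF endo_br UNIV_I]
  and br_zero_right = endo_zero[OF endo_br cvec.subspace_UNIV]
  and br_diff_right = endo_diff[OF endo_br cvec.subspace_UNIV UNIV_I UNIV_I]
  and br_add_left = linear_on_add[OF br_linear_left UNIV_I UNIV_I]
  and br_scale_left = linear_on_scale[OF br_linear_left UNIV_I]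
  and br_zero_left = linear_on_zero[OF br_linear_left cvec.subspace_UNIV]

lemma br_swap: "br x y = - br y x"
proof -
  have "br (x + y) (x + y) = br x y + br y x"
    unfolding br_add_left br_add_right by (simp add: br_self)
  then show ?thesis using br_self[of "x + y"] by (simp add: eq_neg_iff_add_eq_0)
qed

lemma br_minus_right: "br x (- y) = - br x y"
  using linear_on_uminus[OF endo_linear[OF endo_br] UNIV_I] .

lemma br_derivation: "br x (br y z) = br (br x y) z + br y (br x z)"
proof -
  have "br y (br z x) = - br y (br x z)" unfolding br_swap[of z x] br_minus_right ..
  moreover have "br z (br x y) = - br (br x y) z" by (rule br_swap)
  ultimately have "br x (br y z) - br y (br x z) - br (br x y) z = 0"
    using jacobi[of x y z] by simp
  then show ?thesis by (simp add: algebra_simps)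
qed

lemma root_space_br:
  "x \<in> root_space br H l \<Longrightarrow> y \<in> root_space br H m \<Longrightarrow> br x y \<in> root_space br H (\<lambda>h. l h + m h)"
  by (simp add: root_space_def br_derivation[of _ x y] br_scale_left br_scale_right scaleC_add_left)

lemma subspace_root_space: "cvec.subspace (root_space br H l)"
  by (rule cvec.subspaceI)
    (simp_all add: root_space_def br_zero_right br_add_right br_scale_right scaleC_add_right
      scaleC_scaleC mult.commute)

end

lemma eigenvector_grouping:
  assumes "x \<in> cvec.span {y. \<exists>c. f y = c *\<^sub>C y}" and f: "endo UNIV f"
  shows "\<exists>M y. finite M \<and> x = (\<Sum>c\<in>M. y c) \<and> (\<forall>c. f (y c) = c *\<^sub>C y c) \<and> (\<forall>c. c \<notin> M \<longrightarrow> y c = 0)"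
  using assms(1)
proof (induction rule: cvec.span_induct_alt)
  case base
  then show ?case
    by (intro exI[of _ "{}"] exI[of _ "\<lambda>_. 0"]) (simp add: endo_zero[OF f])
next
  case (step a b x)
  then obtain c M y where c: "f b = c *\<^sub>C b"
    and y: "finite M" "x = (\<Sum>c\<in>M. y c)" "\<And>c. f (y c) = c *\<^sub>C y c" "\<And>c. c \<notin> M \<Longrightarrow> y c = 0"
    by blast
  let ?y = "\<lambda>k. y k + (if k = c then a *\<^sub>C b else 0)"
  have "(\<Sum>k\<in>insert c M. ?y k) = a *\<^sub>C b + x"
  proof -
    have "(\<Sum>k\<in>insert c M. y k) = x"
      unfolding y(2) using y(1,4) by (intro sum.mono_neutral_right) auto
    then show ?thesis using y(1) by (simp add: sum.distrib)
  qed
  moreover have "f (?y k) = k *\<^sub>C ?y k" for k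
    using endo_add[OF f, of "y k"] endo_scale[OF f, of b a] endo_zero[OF f] y(3)[of k] c
    by (auto simp: scaleC_add_right scaleC_scaleC mult.commute)
  ultimately show ?case
    using y(1,4) by (intro exI[of _ "insert c M"] exI[of _ ?y]) auto
qed

text \<open>Commuting diagonalizable operators are simultaneously diagonalizable: they are added one at a
  time, and the eigencomponents of a joint eigenvector for a further operator are again
  eigenvectors of the previous ones.\<close>

lemma (in lie_algebra) root_spaces_span:
  assumes tor: "toral br H" and fd: "finite_dim (UNIV :: 'l set)"
  shows "cvec.span (\<Union>l. root_space br H l) = UNIV"
proof -
  have H: "cvec.subspace H" and comm: "\<And>h k. h \<in> H \<Longrightarrow> k \<in> H \<Longrightarrow> br h k = 0"
    and diag: "\<And>h. h \<in> H \<Longrightarrow> ad_diagonalizable br h"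
    using tor by (auto simp: toral_def)
  have joint: "cvec.span {x. \<forall>h\<in>F. \<exists>c. br h x = c *\<^sub>C x} = UNIV" if "finite F" "F \<subseteq> H" for F
    using that
  proof (induction F rule: finite_induct)
    case empty
    then show ?case by simp
  next
    case (insert h F)
    let ?E = "{x. \<forall>k\<in>F. \<exists>c. br k x = c *\<^sub>C x}"
    let ?E' = "{x. \<forall>k\<in>insert h F. \<exists>c. br k x = c *\<^sub>C x}"
    have h: "h \<in> H" and FH: "F \<subseteq> H" using insert.prems by auto
    have "?E \<subseteq> cvec.span ?E'"
    proof
      fix x assume x: "x \<in> ?E"
      obtain B where B: "cvec.span B = UNIV" "\<forall>b\<in>B. \<exists>c. br h b = c *\<^sub>C b"
        using diag[OF h] by (auto simp: ad_diagonalizable_def)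
      have "B \<subseteq> {y. \<exists>c. br h y = c *\<^sub>C y}" using B(2) by blast
      from cvec.span_mono[OF this] have "x \<in> cvec.span {y. \<exists>c. br h y = c *\<^sub>C y}" using B(1) by auto
      from eigenvector_grouping[OF this endo_br] obtain M y
        where y: "finite M" "x = (\<Sum>c\<in>M. y c)" "\<And>c. br h (y c) = c *\<^sub>C y c" by blast
      have "y c \<in> ?E'" if c: "c \<in> M" for c
      proof -
        have "\<exists>d. br k (y c) = d *\<^sub>C y c" if k: "k \<in> F" for k
        proof -
          obtain d where d: "br k x = d *\<^sub>C x" using x k by blast
          have hk: "br h (br k z) = br k (br h z)" for z
            using br_derivation[of h k z] comm[of h k] h k FH by (auto simp: br_zero_left)
          have "br k (y c) - d *\<^sub>C y c = 0"
          proof (rule eigenvectors_sum_zero[OF cvec.subspace_UNIV endo_br y(1), of "\<lambda>c. c" "\<lambda>c. br k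
              (y c) - d *\<^sub>C y c"])
            have "(\<Sum>c\<in>M. br k (y c) - d *\<^sub>C y c) = br k x - d *\<^sub>C x"
              unfolding y(2) sum_subtractf cvec.scale_sum_right
              by (subst endo_sum[OF endo_br cvec.subspace_UNIV]) auto
            then show "(\<Sum>c\<in>M. br k (y c) - d *\<^sub>C y c) = 0" using d by simp
            fix c
            show "br h (br k (y c) - d *\<^sub>C y c) = c *\<^sub>C (br k (y c) - d *\<^sub>C y c)"
              by (simp add: br_diff_right br_scale_right hk y(3) cvec.scale_right_diff_distrib
                  scaleC_scaleC mult.commute)
          qed (use c in auto)
          then show ?thesis by auto
        qed
        then show ?thesis using y(3) by auto
      qed
      then show "x \<in> cvec.span ?E'" unfolding y(2) by (intro cvec.span_sum cvec.span_base)
    qed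
    then have "cvec.span ?E \<subseteq> cvec.span ?E'" by (rule cvec.span_minimal) simp
    then show ?case using insert.IH[OF FH] by auto
  qed
  obtain B where B: "finite B" "H = cvec.span B"
    using finite_dim_subspace[OF fd H] by (auto simp: finite_dim_def)
  have "{x. \<forall>h\<in>B. \<exists>c. br h x = c *\<^sub>C x} \<subseteq> (\<Union>l. root_space br H l)"
  proof clarify
    fix x assume x: "\<forall>h\<in>B. \<exists>c. br h x = c *\<^sub>C x"
    have "\<exists>c. br h x = c *\<^sub>C x" if "h \<in> H" for h
      using that unfolding B(2)
    proof (induction rule: cvec.span_induct_alt)
      case base
      show ?case by (rule exI[of _ 0]) (simp add: br_zero_left)
    next
      case (step a b h)
      then obtain c d where "br b x = c *\<^sub>C x" "br h x = d *\<^sub>C x" using x by blast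
      then have "br (a *\<^sub>C b + h) x = (a * c + d) *\<^sub>C x"
        by (simp add: br_add_left br_scale_left scaleC_add_left scaleC_scaleC)
      then show ?case ..
    qed
    then have "\<forall>h\<in>H. br h x = (SOME c. br h x = c *\<^sub>C x) *\<^sub>C x" by (auto intro: someI_ex)
    then have "x \<in> root_space br H (\<lambda>h. SOME c. br h x = c *\<^sub>C x)" by (simp add: root_space_def)
    then show "x \<in> (\<Union>l. root_space br H l)" by blast
  qed
  from cvec.span_mono[OF this] joint[OF B(1)] B(2) cvec.span_superset[of B] show ?thesis by auto
qed

text \<open>Root vectors are taken for arbitrary functions on \<open>H\<close> that do not vanish on \<open>H\<close>; a nonzero such
  vector forces the restriction of the function to \<open>H\<close> to be a root.\<close>

definition nonvanishing :: "'g set \<Rightarrow> ('g \<Rightarrow> complex) \<Rightarrow> bool"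
  where "nonvanishing H l \<longleftrightarrow> (\<exists>h\<in>H. l h \<noteq> 0)"

lemma (in lie_algebra) root_space_is_root:
  assumes H: "cvec.subspace H" and l: "nonvanishing H l" and x: "x \<in> root_space br H l" "x \<noteq> 0"
  shows "restrict l H \<in> roots br H" and "x \<in> root_space br H (restrict l H)"
proof -
  show xr: "x \<in> root_space br H (restrict l H)" using x by (simp add: root_space_def)
  have lx: "br h x = l h *\<^sub>C x" if "h \<in> H" for h using x(1) that by (simp add: root_space_def)
  have "linear_on H (restrict l H)"
  proof (rule linear_onI)
    fix h k assume hk: "h \<in> H" "k \<in> H"
    then have "l (h + k) *\<^sub>C x = (l h + l k) *\<^sub>C x"
      using lx[of h] lx[of k] lx[of "h + k"] cvec.subspace_add[OF H hk]
      by (simp add: br_add_left scaleC_add_left)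
    then show "restrict l H (h + k) = restrict l H h + restrict l H k"
      using x(2) hk cvec.subspace_add[OF H hk] by simp
  next
    fix c h assume h: "h \<in> H"
    then have "l (c *\<^sub>C h) *\<^sub>C x = (c * l h) *\<^sub>C x"
      using lx[of h] lx[of "c *\<^sub>C h"] cvec.subspace_scale[OF H h, of c]
      by (metis br_scale_left scaleC_scaleC)
    then have "l (c *\<^sub>C h) = c * l h" unfolding cvec.scale_cancel_right using x(2) by simp
    then show "restrict l H (c *\<^sub>C h) = c *\<^sub>C restrict l H h"
      using h cvec.subspace_scale[OF H h] by (auto simp: scaleC_complex_def)
  qed
  moreover have "\<exists>h\<in>H. restrict l H h \<noteq> 0" using l by (auto simp: nonvanishing_def)
  ultimately show "restrict l H \<in> roots br H" using xr x(2) by (auto simp: roots_def)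
qed

definition root_vectors :: "('g::complex_vector \<Rightarrow> 'g \<Rightarrow> 'g) \<Rightarrow> 'g set \<Rightarrow> 'g set"
  where "root_vectors br H = {x. \<exists>l. nonvanishing H l \<and> x \<in> root_space br H l}"

definition root_brackets :: "('g::complex_vector \<Rightarrow> 'g \<Rightarrow> 'g) \<Rightarrow> 'g set \<Rightarrow> 'g set"
  where "root_brackets br H = {br e f | e f l.
    nonvanishing H l \<and> e \<in> root_space br H l \<and> f \<in> root_space br H (\<lambda>h. - l h)}"

text \<open>The span is an ideal, as one checks on weight vectors: a bracket of two root vectors is again
  a root vector unless the weights are opposite, brackets of opposite root vectors have weight
  zero, and vectors of weight zero preserve each root space. It is nonzero because there is a root.\<close>

lemma root_vectors_span:
  assumes simple: "simple_lie_algebra br" and fd: "finite_dim (UNIV :: 'g::complex_vector set)"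
    and tor: "toral br H" and ne: "roots br H \<noteq> {}"
  shows "cvec.span (root_vectors br H \<union> root_brackets br H) = (UNIV :: 'g set)"
proof -
  interpret lie_algebra br using simple by (simp add: simple_lie_algebra_def)
  let ?G = "root_vectors br H \<union> root_brackets br H"
  have cong: "root_space br H l = root_space br H m" if "\<And>h. h \<in> H \<Longrightarrow> l h = m h" for l m
    using that by (simp add: root_space_def)
  have neg: "- x \<in> cvec.span ?G" if "x \<in> ?G" for x using that by (simp add: cvec.span_base cvec.span_neg)
  have gen: "br x y \<in> cvec.span ?G" if x: "x \<in> root_space br H m" and y: "y \<in> ?G" for x y m
    using y
  proof
    assume "y \<in> root_vectors br H"
    then obtain l where l: "nonvanishing H l" "y \<in> root_space br H l" by (auto simp: root_vectors_def)
    show ?thesis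
    proof (cases "nonvanishing H (\<lambda>h. m h + l h)")
      case True
      then have "br x y \<in> root_vectors br H"
        using root_space_br[OF x l(2)] by (auto simp: root_vectors_def)
      then show ?thesis by (simp add: cvec.span_base)
    next
      case False
      then have "m h = - l h" if "h \<in> H" for h
        using that by (auto simp: nonvanishing_def eq_neg_iff_add_eq_0)
      then have "root_space br H m = root_space br H (\<lambda>h. - l h)" by (rule cong)
      then have "br y x \<in> root_brackets br H" using l x by (auto simp: root_brackets_def)
      then show ?thesis unfolding br_swap[of x y] by (intro neg) simp
    qed
  next
    assume "y \<in> root_brackets br H"
    then obtain e f l where l: "y = br e f" "nonvanishing H l" "e \<in> root_space br H l"
      "f \<in> root_space br H (\<lambda>h. - l h)" by (auto simp: root_brackets_def)
    show ?thesis
    proof (cases "nonvanishing H m")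
      case True
      have "br x y \<in> root_space br H (\<lambda>h. m h + (l h + - l h))"
        unfolding l(1) by (rule root_space_br[OF x root_space_br[OF l(3,4)]])
      then have "br x y \<in> root_vectors br H" using True by (auto simp: root_vectors_def)
      then show ?thesis by (simp add: cvec.span_base)
    next
      case False
      then have m: "m h = 0" if "h \<in> H" for h using that by (auto simp: nonvanishing_def)
      have "br x e \<in> root_space br H (\<lambda>h. m h + l h)" by (rule root_space_br[OF x l(3)])
      also have "\<dots> = root_space br H l" using m by (intro cong) simp
      finally have "br (br x e) f \<in> root_brackets br H" using l by (auto simp: root_brackets_def)
      moreover have "br x f \<in> root_space br H (\<lambda>h. m h + - l h)" by (rule root_space_br[OF x l(4)])
      then have "br x f \<in> root_space br H (\<lambda>h. - l h)" using cong[of "\<lambda>h. m h + - l h" "\<lambda>h. - l h"] m by simp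
      then have "br e (br x f) \<in> root_brackets br H" using l by (auto simp: root_brackets_def)
      ultimately show ?thesis
        unfolding l(1) br_derivation[of x e f] by (simp add: cvec.span_base cvec.span_add)
    qed
  qed
  have "lie_ideal br (cvec.span ?G)"
    unfolding lie_ideal_def
  proof (intro conjI allI ballI)
    fix x y assume y: "y \<in> cvec.span ?G"
    have "x \<in> cvec.span (\<Union>l. root_space br H l)" using root_spaces_span[OF tor fd] by simp
    then show "br x y \<in> cvec.span ?G"
    proof (induction rule: cvec.span_induct_alt)
      case base
      then show ?case by (simp add: br_zero_left cvec.span_zero)
    next
      case (step c x z)
      then obtain m where x: "x \<in> root_space br H m" by blast
      have "br x y \<in> cvec.span ?G"
        by (rule span_closed_under[OF linear_on_subset[OF endo_linear[OF endo_br]] y])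
          (auto intro!: gen[OF x])
      then show ?case using step by (simp add: br_add_left br_scale_left cvec.span_add cvec.span_scale)
    qed
  qed simp
  moreover have "cvec.span ?G \<noteq> {0}"
  proof -
    obtain a where a: "a \<in> roots br H" using ne by blast
    then have "nonvanishing H a" "root_space br H a \<noteq> {0}" by (auto simp: roots_def nonvanishing_def)
    moreover have "0 \<in> root_space br H a" using cvec.subspace_0[OF subspace_root_space] .
    ultimately obtain x where "x \<in> root_space br H a" "x \<noteq> 0" by blast
    with \<open>nonvanishing H a\<close> have "x \<in> root_vectors br H" by (auto simp: root_vectors_def)
    then have "x \<in> cvec.span ?G" by (simp add: cvec.span_base)
    with \<open>x \<noteq> 0\<close> show ?thesis by auto
  qed
  ultimately show ?thesis using simple by (auto simp: simple_lie_algebra_def)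
qed

text \<open>The vectors \<open>(ad e)\<^sup>k f\<close> have the weights \<open>(k - 1) l\<close>, which are pairwise distinct.\<close>

lemma (in lie_algebra) ad_chain:
  assumes "nonvanishing H l" "e \<in> root_space br H l" "f \<in> root_space br H (\<lambda>h. - l h)"
  shows "(br e ^^ k) f \<in> root_space br H (\<lambda>h. (of_nat k - 1) * l h)"
    and "finite_dim (UNIV :: 'l set) \<Longrightarrow> \<exists>k. (br e ^^ k) f = 0"
proof -
  show ch: "(br e ^^ k) f \<in> root_space br H (\<lambda>h. (of_nat k - 1) * l h)" for k
  proof (induction k)
    case (Suc k)
    have "br e ((br e ^^ k) f) \<in> root_space br H (\<lambda>h. l h + (of_nat k - 1) * l h)"
      by (rule root_space_br[OF assms(2) Suc])
    then show ?case by (simp add: algebra_simps)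
  qed (use assms(3) in simp)
  obtain h where h: "h \<in> H" "l h \<noteq> 0" using assms(1) by (auto simp: nonvanishing_def)
  assume fd: "finite_dim (UNIV :: 'l set)"
  show "\<exists>k. (br e ^^ k) f = 0"
  proof (rule eigenvector_sequence_vanishes[OF fd cvec.subspace_UNIV endo_br[of h],
        of "\<lambda>k. (of_nat k - 1) * l h" "\<lambda>k. (br e ^^ k) f"])
    show "inj (\<lambda>k. (of_nat k - 1) * l h)" using h(2) by (auto simp: inj_def)
    show "br h ((br e ^^ k) f) = ((of_nat k - 1) * l h) *\<^sub>C (br e ^^ k) f" for k
      using ch[of k] h(1) by (simp add: root_space_def)
  qed simp
qed

section \<open>Interpolation polynomials\<close>

definition node_poly :: "complex set \<Rightarrow> complex poly"
  where "node_poly Z = (\<Prod>z\<in>Z. [:- z, 1:])"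

definition lagrange_poly :: "complex set \<Rightarrow> complex \<Rightarrow> complex poly"
  where "lagrange_poly Z z = (\<Prod>w\<in>Z - {z}. smult (1 / (z - w)) [:- w, 1:])"

lemma poly_lagrange_poly:
  assumes "finite Z" "z \<in> Z" "w \<in> Z"
  shows "poly (lagrange_poly Z z) w = (if w = z then 1 else 0)"
proof (cases "w = z")
  case True
  then have "poly (lagrange_poly Z z) w = (\<Prod>u\<in>Z - {z}. 1)"
    unfolding lagrange_poly_def poly_prod by (intro prod.cong) (auto simp: field_simps)
  then show ?thesis using True by simp
next
  case False
  then show ?thesis
    unfolding lagrange_poly_def poly_prod using assms by (auto intro!: prod_zero bexI[of _ w])
qed

text \<open>The polynomial \<open>\<Prod>(x - z)\<close> generates the ideal of all polynomials vanishing at the nodes.\<close>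

lemma node_poly_dvd:
  assumes "finite Z" "\<And>z. z \<in> Z \<Longrightarrow> poly f z = 0"
  shows "node_poly Z dvd f"
  using assms
proof (induction Z rule: finite_induct)
  case (insert z Z)
  then obtain g where g: "f = node_poly Z * g" by auto
  have "poly (node_poly Z) z \<noteq> 0"
    using insert.hyps by (auto simp: node_poly_def poly_prod prod_zero_iff)
  then have "poly g z = 0" using insert.prems[of z] g by simp
  then have "[:- z, 1:] dvd g" by (simp add: poly_eq_0_iff_dvd)
  then have "[:- z, 1:] * node_poly Z dvd g * node_poly Z" by (intro mult_dvd_mono) simp_all
  moreover have "node_poly (insert z Z) = [:- z, 1:] * node_poly Z"
    using insert.hyps by (simp only: node_poly_def prod.insert not_False_eq_True)
  ultimately show ?case unfolding g by (simp only: mult.commute)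
qed (simp add: node_poly_def)

lemma dvd_node_poly_power:
  assumes "finite Z" "p \<noteq> 0" "\<And>z. poly p z = 0 \<Longrightarrow> z \<in> Z"
  shows "p dvd node_poly Z ^ degree p"
  using assms(2,3)
proof (induction "degree p" arbitrary: p)
  case 0
  then show ?case by (simp add: is_unit_iff_degree)
next
  case (Suc n)
  then have "\<not> constant (poly p)" by (simp add: constant_degree)
  then obtain z where z: "poly p z = 0" using fundamental_theorem_of_algebra by blast
  then obtain g where g: "p = [:- z, 1:] * g" by (auto simp: poly_eq_0_iff_dvd)
  have "g \<noteq> 0" using g Suc.prems by auto
  then have "degree p = Suc (degree g)" unfolding g by (subst degree_mult_eq) auto
  then have deg: "n = degree g" using Suc.hyps by simp
  have "g dvd node_poly Z ^ degree g"
    by (rule Suc.hyps(1)[OF deg \<open>g \<noteq> 0\<close>]) (use Suc.prems(2) g in simp)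
  moreover have "[:- z, 1:] dvd node_poly Z"
    unfolding node_poly_def using Suc.prems(2)[OF z] assms(1) by (intro dvd_prodI)
  ultimately have "[:- z, 1:] * g dvd node_poly Z * node_poly Z ^ degree g" by (intro mult_dvd_mono)
  then show ?case using g \<open>degree p = Suc (degree g)\<close> by simp
qed

section \<open>Modules over the current algebra killed by a polynomial\<close>

text \<open>The nonnegative modes of an irreducible integrable module killed by \<open>p\<close>, that is, an
  irreducible module over \<open>\<gg>[t] / \<gg> \<otimes> (p)\<close>. The operator \<open>act a n\<close> is \<open>a(n)\<close>, and \<open>eval_at a f\<close> is
  the action of \<open>a \<otimes> f(t)\<close>.\<close>

locale current_module =
  fixes br :: "'g::complex_vector \<Rightarrow> 'g \<Rightarrow> 'g" and H :: "'g set"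
    and V :: "'w::complex_vector set" and act :: "'g \<Rightarrow> nat \<Rightarrow> 'w \<Rightarrow> 'w" and p :: "complex poly"
  assumes simple: "simple_lie_algebra br" and fd: "finite_dim (UNIV :: 'g set)"
    and tor: "toral br H" and ne: "roots br H \<noteq> {}"
    and V: "cvec.subspace V"
    and act_endo: "endo V (act a n)"
    and act_linear: "v \<in> V \<Longrightarrow> linear_on UNIV (\<lambda>a. act a n v)"
    and act_br: "v \<in> V \<Longrightarrow> act (br a b) (m + n) v = act a m (act b n v) - act b n (act a m v)"
    and act_nil: "a \<in> root_vectors br H \<Longrightarrow> locally_nilpotent V (act a n)"
    and irr: "irreducible_under {act a n | a n. True} V"
    and p0: "p \<noteq> 0"
    and act_p: "v \<in> V \<Longrightarrow> poly_comb p (\<lambda>i. act a (n + i) v) = 0"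
begin

sublocale lie_algebra br using simple by (simp add: simple_lie_algebra_def)

definition eval_at :: "'g \<Rightarrow> complex poly \<Rightarrow> 'w \<Rightarrow> 'w"
  where "eval_at a f v = poly_comb f (\<lambda>i. act a i v)"

lemma act_mem: "v \<in> V \<Longrightarrow> act a n v \<in> V"
  using endo_mem[OF act_endo] .

lemma eval_at_endo: "endo V (eval_at a f)"
  unfolding eval_at_def poly_comb_def by (intro endo_sum_fun[OF V] endo_scaled[OF V] act_endo)

lemma eval_at_mem: "v \<in> V \<Longrightarrow> eval_at a f v \<in> V"
  using endo_mem[OF eval_at_endo] .

lemma eval_at_plus: "eval_at a (f + g) v = eval_at a f v + eval_at a g v"
  and eval_at_diff: "eval_at a (f - g) v = eval_at a f v - eval_at a g v"
  and eval_at_smult: "eval_at a (smult c f) v = c *\<^sub>C eval_at a f v"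
  and eval_at_0: "eval_at a 0 v = 0"
  and eval_at_monom: "eval_at a (monom c n) v = c *\<^sub>C act a n v"
  by (simp_all add: eval_at_def poly_comb_add poly_comb_diff poly_comb_smult poly_comb_monom)

lemma eval_at_sum: "eval_at a (\<Sum>i\<in>A. f i) v = (\<Sum>i\<in>A. eval_at a (f i) v)"
  by (induction A rule: infinite_finite_induct) (simp_all add: eval_at_plus eval_at_0)

lemma eval_at_linear: "v \<in> V \<Longrightarrow> linear_on UNIV (\<lambda>a. eval_at a f v)"
  unfolding eval_at_def poly_comb_def by (intro linear_on_sum_fun linear_on_scaled act_linear)

lemma eval_at_br:
  assumes v: "v \<in> V"
  shows "eval_at (br a b) (f * g) v = eval_at a f (eval_at b g v) - eval_at b g (eval_at a f v)"
proof -
  have 1: "eval_at a f (eval_at b g v) = poly_comb f (\<lambda>i. poly_comb g (\<lambda>j. act a i (act b j v)))" for a b f g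
    unfolding eval_at_def
    by (simp add: linear_on_poly_comb[OF endo_linear[OF act_endo] V act_mem[OF v]])
  have "eval_at (br a b) (f * g) v =
      poly_comb f (\<lambda>i. poly_comb g (\<lambda>j. act a i (act b j v) - act b j (act a i v)))"
    unfolding eval_at_def poly_comb_mult act_br[OF v] ..
  then show ?thesis
    unfolding 1 poly_comb_minus poly_comb_swap[of g f] .
qed

lemma eval_at_dvd:
  assumes "v \<in> V" "p dvd f"
  shows "eval_at a f v = 0"
proof -
  obtain g where "f = g * p" using assms(2) by (auto simp: dvd_def mult.commute)
  then have "eval_at a f v = poly_comb g (\<lambda>_. 0)"
    unfolding eval_at_def by (simp only: poly_comb_mult act_p[OF assms(1)])
  then show ?thesis by (simp add: poly_comb_def)
qed

lemma eval_at_nilpotent: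
  assumes "a \<in> root_vectors br H"
  shows "locally_nilpotent V (eval_at a f)"
  unfolding eval_at_def poly_comb_def
proof (rule locally_nilpotent_sum[OF V])
  fix i j v assume v: "v \<in> V"
  have "act a i (act a j v) - act a j (act a i v) = 0"
    using act_br[OF v, of a a i j] linear_on_zero[OF act_linear[OF v] cvec.subspace_UNIV]
    by (simp add: br_self)
  then show "coeff f i *\<^sub>C act a i (coeff f j *\<^sub>C act a j v) =
      coeff f j *\<^sub>C act a j (coeff f i *\<^sub>C act a i v)"
    using v by (simp add: endo_scale[OF act_endo] act_mem scaleC_scaleC mult.commute)
next
  fix i
  show "endo V (\<lambda>v. coeff f i *\<^sub>C act a i v)" by (rule endo_scaled[OF V act_endo])
  show "locally_nilpotent V (\<lambda>v. coeff f i *\<^sub>C act a i v)"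
    by (rule locally_nilpotent_scaled[OF V act_endo act_nil[OF assms]])
qed

text \<open>A bracket \<open>[e, f]\<close> of opposite root vectors need not act nilpotently, but it is the difference of
  \<open>exp (ad e) f\<close>, whose action is conjugate to that of \<open>f\<close>, and a sum of root vectors.\<close>

definition integrable_elements :: "'g set"
  where "integrable_elements = {a. \<forall>f. locally_nilpotent V (eval_at a f)}"

lemma exp_ad_integrable:
  assumes e: "e \<in> root_vectors br H" and f: "f \<in> root_vectors br H"
    and K: "\<And>k. K < k \<Longrightarrow> (br e ^^ k) f = 0"
  shows "(\<Sum>k\<le>K. (1 / fact k) *\<^sub>C (br e ^^ k) f) \<in> integrable_elements"
  unfolding integrable_elements_def
proof (rule CollectI, rule allI)
  fix q
  let ?g = "\<lambda>k. eval_at ((br e ^^ k) f) q"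
  have nilp: "locally_nilpotent V (\<lambda>v. \<Sum>k\<le>K. (1 / fact k) *\<^sub>C ?g k v)"
  proof (rule locally_nilpotent_exp_conj[where e = "eval_at e 1" and g = ?g, OF V])
    fix k v assume v: "v \<in> V"
    show "?g (Suc k) v = eval_at e 1 (?g k v) - ?g k (eval_at e 1 v)"
      using eval_at_br[OF v, of e "(br e ^^ k) f" 1 q] by simp
    assume "K < k"
    then show "?g k v = 0"
      using K linear_on_zero[OF eval_at_linear[OF v] cvec.subspace_UNIV] by simp
  qed (use e f in \<open>simp_all add: eval_at_endo eval_at_nilpotent\<close>)
  have eq: "eval_at (\<Sum>k\<le>K. (1 / fact k) *\<^sub>C (br e ^^ k) f) q v = (\<Sum>k\<le>K. (1 / fact k) *\<^sub>C ?g k v)"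
    if "v \<in> V" for v
    by (simp add: linear_on_sum[OF eval_at_linear[OF that] cvec.subspace_UNIV]
        linear_on_scale[OF eval_at_linear[OF that]])
  have "locally_nilpotent V (eval_at (\<Sum>k\<le>K. (1 / fact k) *\<^sub>C (br e ^^ k) f) q) \<longleftrightarrow>
      locally_nilpotent V (\<lambda>v. \<Sum>k\<le>K. (1 / fact k) *\<^sub>C ?g k v)"
    by (rule locally_nilpotent_cong) (erule eq, erule eval_at_mem)
  with nilp show "locally_nilpotent V (eval_at (\<Sum>k\<le>K. (1 / fact k) *\<^sub>C (br e ^^ k) f) q)"
    by (simp only:)
qed

lemma integrable_elements_span: "cvec.span integrable_elements = UNIV"
proof -
  have root: "root_vectors br H \<subseteq> integrable_elements"
    by (auto simp: integrable_elements_def eval_at_nilpotent)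
  have "root_brackets br H \<subseteq> cvec.span integrable_elements"
  proof
    fix x assume "x \<in> root_brackets br H"
    then obtain e f l where x: "x = br e f" and l: "nonvanishing H l"
      and e: "e \<in> root_space br H l" and f: "f \<in> root_space br H (\<lambda>h. - l h)"
      by (auto simp: root_brackets_def)
    have er: "e \<in> root_vectors br H" using l e by (auto simp: root_vectors_def)
    have "nonvanishing H (\<lambda>h. - l h)" using l by (simp add: nonvanishing_def)
    then have fr: "f \<in> root_vectors br H" using f by (auto simp: root_vectors_def)
    obtain k0 where k0: "(br e ^^ k0) f = 0" using ad_chain(2)[OF l e f fd] by blast
    define K where "K = Suc k0"
    have K: "(br e ^^ k) f = 0" if "K < k" for k
      using funpow_zero_ge[OF cvec.subspace_UNIV endo_br k0] that by (simp add: K_def)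
    let ?t = "\<lambda>k. (1 / fact k) *\<^sub>C (br e ^^ k) f"
    have "(\<Sum>k\<le>K. ?t k) = f + (br e f + (\<Sum>k\<in>{2..K}. ?t k))"
    proof -
      have "{..K} = insert 0 (insert 1 {2..K})" by (auto simp: K_def)
      then show ?thesis by (simp add: scaleC_one)
    qed
    then have "x = (\<Sum>k\<le>K. ?t k) - f - (\<Sum>k\<in>{2..K}. ?t k)" unfolding x by simp
    moreover have "(\<Sum>k\<le>K. ?t k) \<in> integrable_elements" by (rule exp_ad_integrable[OF er fr K])
    moreover have "(br e ^^ k) f \<in> root_vectors br H" if "k \<in> {2..K}" for k
    proof -
      have "(of_nat k :: complex) \<noteq> of_nat 1" using that unfolding of_nat_eq_iff by simp
      then have "nonvanishing H (\<lambda>h. (of_nat k - 1) * l h)" using l by (auto simp: nonvanishing_def)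
      then show ?thesis using ad_chain(1)[OF l e f, of k] by (auto simp: root_vectors_def)
    qed
    then have "(\<Sum>k\<in>{2..K}. ?t k) \<in> cvec.span integrable_elements"
      using root by (intro cvec.span_sum cvec.span_scale cvec.span_base) blast
    moreover have "f \<in> cvec.span integrable_elements" using root fr by (blast intro: cvec.span_base)
    ultimately show "x \<in> cvec.span integrable_elements"
      by (simp only: cvec.span_diff cvec.span_base)
  qed
  moreover have "root_vectors br H \<subseteq> cvec.span integrable_elements"
    using root cvec.span_superset by blast
  ultimately have "cvec.span (root_vectors br H \<union> root_brackets br H) \<subseteq> cvec.span integrable_elements"
    by (intro cvec.span_minimal) auto
  then show ?thesis using root_vectors_span[OF simple fd tor ne] by auto
qed

lemma integrable_spanning_set:
  obtains B where "finite B" "B \<subseteq> integrable_elements" "cvec.span B = UNIV"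
proof -
  obtain B where B: "B \<subseteq> integrable_elements" "\<not> cvec.dependent B" "integrable_elements \<subseteq> cvec.span B"
    using cvec.maximal_independent_subset[of integrable_elements] by metis
  have sp: "cvec.span B = UNIV"
    using cvec.span_minimal[OF B(3)] integrable_elements_span by auto
  obtain C where C: "finite C \<and> (UNIV :: 'g set) = cvec.span C" using fd unfolding finite_dim_def ..
  then have "B \<subseteq> cvec.span C" by (metis subset_UNIV)
  then have "finite B" using cvec.independent_span_bound[of C B] B(2) C by blast
  then show thesis by (rule that[OF _ B(1) sp])
qed

lemma irreducible_eq:
  assumes "cvec.subspace S" "S \<subseteq> V" "\<And>a n v. v \<in> S \<Longrightarrow> act a n v \<in> S" "s \<in> S" "s \<noteq> 0"
  shows "S = V"
  by (rule irreducible_under_eq[OF irr assms(1,2) _ assms(4,5)]) (use assms(3) in auto)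

text \<open>If \<open>J\<close> is an ideal of \<open>\<complex>[t]\<close> such that \<open>\<gg> \<otimes> J\<^sup>2\<close> acts trivially, then \<open>\<gg> \<otimes> J\<close> acts by commuting
  operators, and it is spanned by locally nilpotent ones. Their common kernel is nonzero and
  invariant, so \<open>\<gg> \<otimes> J\<close> acts trivially as well. This brings the power of the radical of \<open>p\<close> that kills
  the module down to the first.\<close>

lemma square_zero_ideal_kills:
  assumes "\<And>a f v. v \<in> V \<Longrightarrow> eval_at a (s * s * f) v = 0" and v: "v \<in> V"
  shows "eval_at a (s * f) v = 0"
proof -
  obtain B where B: "finite B" "B \<subseteq> integrable_elements" "cvec.span B = UNIV"
    by (rule integrable_spanning_set)
  define S where "S = {v \<in> V. \<forall>a f. eval_at a (s * f) v = 0}"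
  have "V \<noteq> {0}" using irr by (simp add: irreducible_under_def)
  \<comment> \<open>Modulo \<open>p\<close> the operators \<open>x \<otimes> s t\<^sup>i\<close> with \<open>i < degree p\<close> span the action of \<open>\<gg> \<otimes> (s)\<close>.\<close>
  have "\<exists>v\<in>V. v \<noteq> 0 \<and> (\<forall>x\<in>B \<times> {..<degree p}. eval_at (fst x) (s * monom 1 (snd x)) v = 0)"
  proof (rule locally_nilpotent_common_kernel[OF V \<open>V \<noteq> {0}\<close>])
    show "finite (B \<times> {..<degree p})" using B(1) by simp
    fix x assume "x \<in> B \<times> {..<degree p}"
    then show "locally_nilpotent V (eval_at (fst x) (s * monom 1 (snd x)))"
      using B(2) by (auto simp: integrable_elements_def)
    fix y :: "'g \<times> nat" and v assume v: "v \<in> V"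
    have "s * monom 1 (snd x) * (s * monom 1 (snd y)) = s * s * (monom 1 (snd x) * monom 1 (snd y))"
      by (simp only: mult_ac)
    then have "eval_at (br (fst x) (fst y)) (s * monom 1 (snd x) * (s * monom 1 (snd y))) v = 0"
      by (simp only: assms(1)[OF v])
    then show "eval_at (fst x) (s * monom 1 (snd x)) (eval_at (fst y) (s * monom 1 (snd y)) v) =
        eval_at (fst y) (s * monom 1 (snd y)) (eval_at (fst x) (s * monom 1 (snd x)) v)"
      using eval_at_br[OF v, of "fst x" "fst y" "s * monom 1 (snd x)" "s * monom 1 (snd y)"]
      by simp
  qed (rule eval_at_endo)
  then obtain u where u: "u \<in> V" "u \<noteq> 0"
    and uk: "\<And>x i. x \<in> B \<Longrightarrow> i < degree p \<Longrightarrow> eval_at x (s * monom 1 i) u = 0" by fastforce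
  have "eval_at a (s * f) u = 0" for a f
  proof -
    have basis: "eval_at x (s * f) u = 0" if x: "x \<in> B" for x
    proof -
      let ?r = "f mod p"
      have "s * f = s * (f div p * p + ?r)" by simp
      also have "\<dots> = p * (f div p * s) + s * ?r" by (simp only: distrib_left mult_ac)
      finally have sf: "s * f = p * (f div p * s) + s * ?r" .
      have sr: "s * ?r = (\<Sum>i<degree p. smult (coeff ?r i) (s * monom 1 i))"
      proof (cases "degree p = 0")
        case True
        then have "?r = 0" using p0 degree_mod_less[of p f] by auto
        then show ?thesis by simp
      next
        case False
        then have "degree ?r < degree p" using degree_mod_less[OF p0, of f] by auto
        then have "?r = (\<Sum>i<degree p. monom (coeff ?r i) i)"
          by (intro poly_eqI) (auto simp: coeff_sum coeff_eq_0)
        then have "s * ?r = s * (\<Sum>i<degree p. monom (coeff ?r i) i)" by simp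
        then show ?thesis by (simp add: sum_distrib_left smult_monom flip: mult_smult_right)
      qed
      have "eval_at x (s * f) u = eval_at x (p * (f div p * s)) u +
          (\<Sum>i<degree p. coeff ?r i *\<^sub>C eval_at x (s * monom 1 i) u)"
        by (simp only: sf sr eval_at_plus eval_at_sum eval_at_smult)
      then show ?thesis using uk[OF x] eval_at_dvd[OF u(1), of "p * (f div p * s)" x] by simp
    qed
    have "a \<in> cvec.span B" using B(3) by simp
    have lin: "linear_on (cvec.span B) (\<lambda>a. eval_at a (s * f) u)"
      by (rule linear_on_subset[OF eval_at_linear[OF u(1)]]) simp
    show ?thesis
      by (rule linear_on_span_eqI[where g = "\<lambda>_. 0", OF lin _ basis \<open>a \<in> cvec.span B\<close>])
        (simp_all add: linear_on_def)
  qed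
  then have uS: "u \<in> S" using u by (simp add: S_def)
  have "S = V"
  proof (rule irreducible_eq[OF _ _ _ uS u(2)])
    show "cvec.subspace S"
      unfolding S_def using V
      by (auto simp: cvec.subspace_def endo_add[OF eval_at_endo] endo_scale[OF eval_at_endo]
          endo_zero[OF eval_at_endo V])
    fix b n v assume v: "v \<in> S"
    then have vV: "v \<in> V" and vk: "\<And>a f. eval_at a (s * f) v = 0" by (auto simp: S_def)
    have "eval_at a (s * f) (act b n v) = 0" for a f
    proof -
      have "eval_at (br a b) (s * f * monom 1 n) v =
          eval_at a (s * f) (eval_at b (monom 1 n) v) - eval_at b (monom 1 n) (eval_at a (s * f) v)"
        by (rule eval_at_br[OF vV])
      then show ?thesis
        using vk[of "br a b" "f * monom 1 n"] vk[of a f] endo_zero[OF eval_at_endo V]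
        by (simp add: eval_at_monom scaleC_one mult.assoc)
    qed
    then show "act b n v \<in> S" using act_mem[OF vV] by (simp add: S_def)
  qed (auto simp: S_def)
  then show ?thesis using v by (auto simp: S_def)
qed

definition nodes :: "complex set"
  where "nodes = {z. poly p z = 0}"

lemma finite_nodes: "finite nodes"
  unfolding nodes_def by (rule poly_roots_finite[OF p0])

text \<open>For the least \<open>n\<close> such that the \<open>n\<close>-th power of the radical kills the module, \<open>n \<ge> 2\<close> would give
  \<open>2 (n - 1) \<ge> n\<close>, so the square of the \<open>(n - 1)\<close>-st power would kill it too, and by
  \<open>square_zero_ideal_kills\<close> already the \<open>(n - 1)\<close>-st power would.\<close>

lemma eval_at_node_poly:
  assumes v: "v \<in> V"
  shows "eval_at a (node_poly nodes * f) v = 0"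
proof -
  let ?q = "node_poly nodes"
  define P where "P n \<longleftrightarrow> (\<forall>a f. \<forall>v\<in>V. eval_at a (?q ^ n * f) v = 0)" for n
  have "p dvd ?q ^ degree p"
    by (rule dvd_node_poly_power[OF finite_nodes p0]) (simp add: nodes_def)
  then have "P (degree p)" by (auto simp: P_def intro: eval_at_dvd)
  define n where "n = (LEAST n. P n)"
  have Pn: "P n" unfolding n_def by (rule LeastI[of P]) fact
  have "n \<le> 1"
  proof (rule ccontr)
    assume "\<not> n \<le> 1"
    then have n: "n - 1 + (n - 1) = n + (n - 2)" "n - 1 < n" by auto
    have "eval_at a (?q ^ (n - 1) * ?q ^ (n - 1) * f) v = 0" if "v \<in> V" for a f v
    proof -
      have "?q ^ (n - 1) * ?q ^ (n - 1) * f = ?q ^ n * (?q ^ (n - 2) * f)"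
        unfolding power_add[symmetric] n(1) by (simp only: power_add mult.assoc)
      then show ?thesis using Pn that by (simp only: P_def)
    qed
    from square_zero_ideal_kills[OF this] have "P (n - 1)" by (simp add: P_def)
    then show False using n(2) not_less_Least[of "n - 1" P] by (simp add: n_def)
  qed
  then consider "n = 0" | "n = 1" by linarith
  then show ?thesis
  proof cases
    case 1
    then show ?thesis using Pn v by (simp add: P_def)
  next
    case 2
    then show ?thesis using Pn v by (simp add: P_def)
  qed
qed

text \<open>Thus \<open>\<gg>[t]\<close> acts through the values at the nodes, and \<open>node_act z\<close> is the action of the copy of
  \<open>\<gg>\<close> sitting at the node \<open>z\<close>.\<close>

definition node_act :: "complex \<Rightarrow> 'g \<Rightarrow> 'w \<Rightarrow> 'w"
  where "node_act z a = eval_at a (lagrange_poly nodes z)"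

lemma node_act_endo: "endo V (node_act z a)"
  and node_act_mem: "v \<in> V \<Longrightarrow> node_act z a v \<in> V"
  and node_act_linear: "v \<in> V \<Longrightarrow> linear_on UNIV (\<lambda>a. node_act z a v)"
  by (simp_all add: node_act_def eval_at_endo eval_at_mem eval_at_linear)

lemma eval_at_nodes:
  assumes v: "v \<in> V"
  shows "eval_at a f v = (\<Sum>z\<in>nodes. poly f z *\<^sub>C node_act z a v)"
proof -
  let ?g = "\<Sum>z\<in>nodes. smult (poly f z) (lagrange_poly nodes z)"
  have "poly (f - ?g) w = 0" if w: "w \<in> nodes" for w
  proof -
    have "poly ?g w = (\<Sum>z\<in>nodes. if z = w then poly f z else 0)"
      unfolding poly_sum using w
      by (intro sum.cong) (auto simp: poly_lagrange_poly[OF finite_nodes])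
    then show ?thesis using w finite_nodes by simp
  qed
  then have "node_poly nodes dvd f - ?g" by (rule node_poly_dvd[OF finite_nodes])
  then obtain h where "f - ?g = node_poly nodes * h" by (rule dvdE)
  then have "eval_at a (f - ?g) v = 0" using eval_at_node_poly[OF v] by simp
  then show ?thesis by (simp add: eval_at_diff eval_at_sum eval_at_smult node_act_def)
qed

lemma act_nodes: "v \<in> V \<Longrightarrow> act a n v = (\<Sum>z\<in>nodes. z ^ n *\<^sub>C node_act z a v)"
  using eval_at_nodes[of v a "monom 1 n"] by (simp add: eval_at_monom scaleC_one poly_monom)

lemma node_act_br:
  assumes v: "v \<in> V" and z: "z \<in> nodes" "w \<in> nodes"
  shows "node_act z a (node_act w b v) - node_act w b (node_act z a v) =
    (if z = w then node_act z (br a b) v else 0)"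
proof -
  have "node_act z a (node_act w b v) - node_act w b (node_act z a v) =
      eval_at (br a b) (lagrange_poly nodes z * lagrange_poly nodes w) v"
    unfolding node_act_def by (rule eval_at_br[OF v, symmetric])
  also have "\<dots> = (\<Sum>u\<in>nodes. (if u = z \<and> z = w then 1 else 0) *\<^sub>C node_act u (br a b) v)"
    unfolding eval_at_nodes[OF v] using z
    by (intro sum.cong) (auto simp: poly_lagrange_poly[OF finite_nodes])
  also have "\<dots> = (\<Sum>u\<in>nodes. if u = z then (if z = w then node_act z (br a b) v else 0) else 0)"
    by (intro sum.cong) (auto simp: scaleC_one)
  finally show ?thesis using z finite_nodes by simp
qed

lemma act_closed:
  assumes "cvec.subspace S" "S \<subseteq> V" "\<And>z a v. z \<in> nodes \<Longrightarrow> v \<in> S \<Longrightarrow> node_act z a v \<in> S" "v \<in> S"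
  shows "act a n v \<in> S"
proof -
  have "act a n v = (\<Sum>z\<in>nodes. z ^ n *\<^sub>C node_act z a v)" 
    by (rule act_nodes) (use assms(2,4) in blast)
  then show ?thesis using assms by (simp add: cvec.subspace_sum cvec.subspace_scale)
qed

text \<open>The operators \<open>node_act z b\<close>, where \<open>b\<close> runs through a finite spanning set of \<open>integrable_elements\<close> and
  \<open>z\<close> through the nodes, are locally nilpotent, and their span is closed under commutators.\<close>

lemma finite_dim_module: "finite_dim V"
proof -
  obtain B where B: "finite B" "B \<subseteq> integrable_elements" "cvec.span B = UNIV"
    by (rule integrable_spanning_set)
  have "V \<noteq> {0}" using irr by (simp add: irreducible_under_def)
  then obtain v where v: "v \<in> V" "v \<noteq> 0" using cvec.subspace_0[OF V] by blast
  obtain e where e: "bij_betw e {0..<card (B \<times> nodes)} (B \<times> nodes)"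
    using ex_bij_betw_nat_finite[of "B \<times> nodes"] B(1) finite_nodes by auto
  define d where "d = card (B \<times> nodes)"
  have ed: "bij_betw e {..<d} (B \<times> nodes)" using e by (simp add: d_def atLeast0LessThan)
  have eB: "fst (e i) \<in> B" "snd (e i) \<in> nodes" if "i < d" for i
    using bij_betwE[OF ed] that by (auto simp: mem_Times_iff)
  define x where "x i = node_act (snd (e i)) (fst (e i))" for i
  have x: "endo V (x i)" for i by (simp add: x_def node_act_endo)
  have span: "\<exists>c. \<forall>v\<in>V. node_act z a v = (\<Sum>k<d. c k *\<^sub>C x k v)" if z: "z \<in> nodes" for z a
  proof -
    have "a \<in> cvec.span B" using B(3) by simp
    then obtain c where c: "a = (\<Sum>b\<in>B. c b *\<^sub>C b)" using cvec.span_finite[OF B(1)] by auto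
    define c' where "c' u = (if snd u = z then c (fst u) else 0)" for u
    have "node_act z a v = (\<Sum>k<d. c' (e k) *\<^sub>C x k v)" if v: "v \<in> V" for v
    proof -
      have "node_act z a v = (\<Sum>b\<in>B. c b *\<^sub>C node_act z b v)"
        unfolding c by (simp add: linear_on_sum[OF node_act_linear[OF v] cvec.subspace_UNIV]
            linear_on_scale[OF node_act_linear[OF v]])
      also have "\<dots> = (\<Sum>b\<in>B. \<Sum>w\<in>nodes. if w = z then c b *\<^sub>C node_act w b v else 0)"
        using z finite_nodes by simp
      also have "\<dots> = (\<Sum>b\<in>B. \<Sum>w\<in>nodes. c' (b, w) *\<^sub>C node_act w b v)"
        by (intro sum.cong) (auto simp: c'_def)
      also have "\<dots> = (\<Sum>u\<in>B \<times> nodes. c' u *\<^sub>C node_act (snd u) (fst u) v)"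
        by (simp add: sum.cartesian_product case_prod_beta)
      also have "\<dots> = (\<Sum>k<d. c' (e k) *\<^sub>C node_act (snd (e k)) (fst (e k)) v)"
        by (rule sum.reindex_bij_betw[OF ed, symmetric])
      finally show ?thesis by (simp add: x_def)
    qed
    then show ?thesis by (intro exI[of _ "\<lambda>k. c' (e k)"]) blast
  qed
  have br: "\<exists>c. \<forall>v\<in>V. x i (x j v) - x j (x i v) = (\<Sum>k<d. c k *\<^sub>C x k v)" if ij: "i < d" "j < d" for i j
  proof (cases "snd (e i) = snd (e j)")
    case True
    obtain c where "\<forall>v\<in>V. node_act (snd (e i)) (br (fst (e i)) (fst (e j))) v = (\<Sum>k<d. c k *\<^sub>C x k v)"
      using span[OF eB(2)[OF ij(1)]] by blast
    then show ?thesis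
      using True node_act_br[OF _ eB(2)[OF ij(1)] eB(2)[OF ij(2)]] by (intro exI[of _ c]) (simp add: x_def)
  next
    case False
    then show ?thesis
      using node_act_br[OF _ eB(2)[OF ij(1)] eB(2)[OF ij(2)]] by (intro exI[of _ "\<lambda>_. 0"]) (simp add: x_def)
  qed
  have nil: "locally_nilpotent V (x i)" if "i < d" for i
    using eB(1)[OF that] B(2) by (auto simp: x_def node_act_def integrable_elements_def)
  obtain S where S: "cvec.subspace S" "S \<subseteq> V" "v \<in> S" "finite_dim S"
    "\<And>i s. i < d \<Longrightarrow> s \<in> S \<Longrightarrow> x i s \<in> S"
    using finite_dim_invariant_subspace[of V d x v, OF V x v(1) br nil] by metis
  have "node_act z a s \<in> S" if z: "z \<in> nodes" and s: "s \<in> S" for z a s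
  proof -
    obtain c where "\<forall>v\<in>V. node_act z a v = (\<Sum>k<d. c k *\<^sub>C x k v)" using span[OF z] by blast
    then have "node_act z a s = (\<Sum>k<d. c k *\<^sub>C x k s)" using S(2) s by blast
    also have "\<dots> \<in> S"
      by (rule cvec.subspace_sum[OF S(1)], rule cvec.subspace_scale[OF S(1)], rule S(5)[OF _ s]) simp
    finally show ?thesis .
  qed
  then have "S = V" using act_closed[OF S(1,2)] by (intro irreducible_eq[OF S(1,2) _ S(3) v(2)]) blast
  then show ?thesis using S(4) by simp
qed

end

section \<open>Commuting families of operators\<close>

text \<open>Moving \<open>w\<close> inside its orbit under one of the families so that this orbit becomes irreducible
  replaces the orbit under any other family by a homomorphic image, which stays irreducible.\<close>

lemma vector_with_irreducible_orbits:
  assumes V: "cvec.subspace V" "finite_dim V" "V \<noteq> {0}"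
    and F: "\<And>z f. z \<in> Z \<Longrightarrow> f \<in> F z \<Longrightarrow> endo V f"
    and comm: "\<And>z w f g v. z \<in> Z \<Longrightarrow> w \<in> Z \<Longrightarrow> z \<noteq> w \<Longrightarrow> f \<in> F z \<Longrightarrow> g \<in> F w \<Longrightarrow> v \<in> V \<Longrightarrow>
      f (g v) = g (f v)"
    and "finite Z"
  obtains w where "w \<in> V" "w \<noteq> 0" "\<And>z. z \<in> Z \<Longrightarrow> irreducible_under (F z) (orbit (F z) w)"
proof -
  have "\<exists>w\<in>V. w \<noteq> 0 \<and> (\<forall>z\<in>Y. irreducible_under (F z) (orbit (F z) w))" if "Y \<subseteq> Z" for Y
    using finite_subset[OF that \<open>finite Z\<close>] that
  proof (induction Y rule: finite_induct)
    case empty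
    then show ?case using V(3) cvec.subspace_0[OF V(1)] by auto
  next
    case (insert y Y)
    then obtain w where w: "w \<in> V" "w \<noteq> 0" "\<forall>z\<in>Y. irreducible_under (F z) (orbit (F z) w)" by auto
    have y: "y \<in> Z" and YZ: "Y \<subseteq> Z" using insert.prems by auto
    let ?O = "orbit (F y) w"
    have orb: "orbit (F z) v \<subseteq> V" if "z \<in> Z" "v \<in> V" for z v
    proof (rule orbit_subset[OF V(1)])
      show "f u \<in> V" if "f \<in> F z" "u \<in> V" for f u using endo_mem[OF F[OF \<open>z \<in> Z\<close> that(1)] that(2)] .
    qed (rule that(2))
    have fdO: "finite_dim ?O" by (rule finite_dim_subspace[OF V(2) subspace_orbit orb[OF y w(1)]])
    have "?O \<noteq> {0}" using orbit_self[of w "F y"] w(2) by auto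
    obtain U where U: "cvec.subspace U" "U \<subseteq> ?O" "\<And>f v. f \<in> F y \<Longrightarrow> v \<in> U \<Longrightarrow> f v \<in> U"
      and irrU: "irreducible_under (F y) U"
      by (rule minimal_invariant_subspace[OF fdO subspace_orbit \<open>?O \<noteq> {0}\<close>, of "F y"])
        (auto intro: orbit_closed)
    obtain u where u: "u \<in> U" "u \<noteq> 0"
      using irrU cvec.subspace_0[OF U(1)] by (auto simp: irreducible_under_def)
    then obtain T where T: "T \<in> generated_algebra (F y)" "u = T w" using U(2) by (auto simp: orbit_def)
    have TV: "endo V T" by (rule generated_algebra_endo[OF T(1) V(1) F[OF y]])
    have uV: "u \<in> V" using T endo_mem[OF TV w(1)] by simp
    have "endo U f" if "f \<in> F y" for f
      by (rule endo_subset[OF F[OF y that]]) (use U(2,3) orb[OF y w(1)] that in auto)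
    from irreducible_under_orbit[OF irrU U(1) this u] have "orbit (F y) u = U" .
    then have new: "irreducible_under (F y) (orbit (F y) u)" using irrU by simp
    have "irreducible_under (F z) (orbit (F z) u)" if z: "z \<in> Y" for z
    proof -
      have zZ: "z \<in> Z" and zy: "z \<noteq> y" using z YZ insert.hyps by auto
      have TR: "T (R v) = R (T v)" if "R \<in> generated_algebra (F z)" "v \<in> V" for R v
        by (rule generated_algebra_commute[OF T(1) that(1) V(1) F[OF y] F[OF zZ] _ that(2)])
          (assumption, assumption, rule comm[OF y zZ zy[symmetric]])
      have img: "orbit (F z) u = T ` orbit (F z) w"
        unfolding orbit_def T(2) image_image using TR w(1) by (intro image_cong) auto
      let ?O = "orbit (F z) w"
      have OV: "?O \<subseteq> V" by (rule orb[OF zZ w(1)])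
      have Tlin: "linear_on ?O T" by (rule linear_on_subset[OF endo_linear[OF TV] OV])
      have irrO: "irreducible_under (F z) ?O" using w(3) z by blast
      show ?thesis
        unfolding irreducible_under_def
      proof (intro conjI allI impI)
        show "orbit (F z) u \<noteq> {0}" using orbit_self[of u "F z"] u(2) by auto
        fix S assume S: "cvec.subspace S \<and> S \<subseteq> orbit (F z) u \<and> (\<forall>f\<in>F z. \<forall>v\<in>S. f v \<in> S)"
        let ?P = "{v \<in> ?O. T v \<in> S}"
        have "?P = {0} \<or> ?P = ?O"
        proof -
          have "cvec.subspace ?P"
            using S subspace_orbit[of "F z" w] linear_on_zero[OF Tlin subspace_orbit]
            by (auto simp: cvec.subspace_def linear_on_add[OF Tlin] linear_on_scale[OF Tlin])
          moreover have "\<forall>f\<in>F z. \<forall>v\<in>?P. f v \<in> ?P"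
          proof (intro ballI)
            fix f v assume f: "f \<in> F z" and v: "v \<in> ?P"
            then have "v \<in> V" using OV by blast
            then have "T (f v) = f (T v)" using TR[OF generated_algebra_base[OF f]] by blast
            then show "f v \<in> ?P" using S f v orbit_closed[OF f] by auto
          qed
          ultimately show ?thesis using irrO unfolding irreducible_under_def by blast
        qed
        then show "S = {0} \<or> S = orbit (F z) u"
        proof
          assume "?P = {0}"
          have "s = 0" if s: "s \<in> S" for s
          proof -
            obtain v where v: "v \<in> ?O" "s = T v" using s S img by auto
            then have "v \<in> ?P" using s by simp
            then have "v = 0" using \<open>?P = {0}\<close> by blast
            then show ?thesis using v linear_on_zero[OF Tlin subspace_orbit] by simp
          qed
          then show ?thesis using S cvec.subspace_0 by blast
        next
          assume "?P = ?O"
          then have "T v \<in> S" if "v \<in> ?O" for v using that by auto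
          then have "orbit (F z) u \<subseteq> S" unfolding img by (rule image_subsetI)
          then show ?thesis using S by blast
        qed
      qed
    qed
    then show ?case using new uV u(2) by blast
  qed
  from this[OF order_refl] show thesis using that by blast
qed

section \<open>Operators on one tensor factor\<close>

text \<open>The operator \<open>1 \<otimes> \<dots> \<otimes> T \<otimes> \<dots> \<otimes> 1\<close> with \<open>T\<close> in position \<open>i\<close>, as the transpose of the corresponding
  operation on multilinear forms.\<close>

definition slot :: "nat \<Rightarrow> (nat \<Rightarrow> 'v::complex_vector set) \<Rightarrow> nat \<Rightarrow> ('v \<Rightarrow> 'v) \<Rightarrow>
    (((nat \<Rightarrow> 'v) \<Rightarrow> complex) \<Rightarrow> complex) \<Rightarrow> ((nat \<Rightarrow> 'v) \<Rightarrow> complex) \<Rightarrow> complex"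
  where "slot r V i T t = (\<lambda>f. if multilinear r V f then t (\<lambda>u. f (u(i := T (u i)))) else 0)"

lemma PiE_lessThan_upd: "u \<in> Pi\<^sub>E {..<r} V \<Longrightarrow> i < r \<Longrightarrow> x \<in> V i \<Longrightarrow> u(i := x) \<in> Pi\<^sub>E {..<r} V"
  by (auto simp: PiE_iff extensional_def)

lemma pure_tensor_mem: "u \<in> Pi\<^sub>E {..<r} V \<Longrightarrow> pure_tensor r V u \<in> tensor_space r V"
  by (simp add: tensor_space_def cvec.span_base)

lemma subspace_tensor_space: "cvec.subspace (tensor_space r V)"
  by (simp add: tensor_space_def)

lemma linear_on_pure_tensor:
  "u \<in> Pi\<^sub>E {..<r} V \<Longrightarrow> i < r \<Longrightarrow> linear_on (V i) (\<lambda>v. pure_tensor r V (u(i := v)))"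
  using multilinear_pure_tensor[of r V] by (auto simp: multilinear_def)

lemma linear_on_slot: "linear_on S (slot r V i T)"
  by (auto simp: linear_on_def slot_def fun_eq_iff scaleC_fun_apply)

lemma multilinear_upd:
  assumes f: "multilinear r V f" and j: "j < r" and T: "endo (V j) T"
  shows "multilinear r V (\<lambda>u. f (u(j := T (u j))))"
  unfolding multilinear_def
proof (intro ballI allI impI)
  fix u i assume u: "u \<in> Pi\<^sub>E {..<r} V" and i: "i < r"
  show "linear_on (V i) (\<lambda>v. f ((u(i := v))(j := T ((u(i := v)) j))))"
  proof (cases "i = j")
    case True
    have "linear_on (V j) (\<lambda>v. f (u(j := v)))" using f u j by (auto simp: multilinear_def)
    from linear_on_compose[OF endo_linear[OF T] endo_mem[OF T] this] show ?thesis
      using True by simp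
  next
    case False
    have "u j \<in> V j" using u j by auto
    then have "u(j := T (u j)) \<in> Pi\<^sub>E {..<r} V" by (intro PiE_lessThan_upd u j endo_mem[OF T])
    then have "linear_on (V i) (\<lambda>v. f ((u(j := T (u j)))(i := v)))"
      using f i by (auto simp: multilinear_def)
    then show ?thesis using False by (simp add: fun_upd_twist)
  qed
qed

lemma slot_pure:
  assumes "i < r" "endo (V i) T" "u \<in> Pi\<^sub>E {..<r} V"
  shows "slot r V i T (pure_tensor r V u) = pure_tensor r V (u(i := T (u i)))"
proof
  fix f
  show "slot r V i T (pure_tensor r V u) f = pure_tensor r V (u(i := T (u i))) f"
  proof (cases "multilinear r V f")
    case True
    from multilinear_upd[where V = V and j = i and T = T, OF this assms(1,2)] True show ?thesis
      unfolding slot_def pure_tensor_def by (simp only: if_True)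
  next
    case False
    then show ?thesis unfolding slot_def pure_tensor_def by (simp only: if_False)
  qed
qed

lemma slot_pure_mem:
  assumes "i < r" "endo (V i) T" "u \<in> Pi\<^sub>E {..<r} V"
  shows "u(i := T (u i)) \<in> Pi\<^sub>E {..<r} V"
  using assms by (intro PiE_lessThan_upd endo_mem[OF assms(2)]) auto

lemma slot_endo:
  assumes "i < r" "endo (V i) T"
  shows "endo (tensor_space r V) (slot r V i T)"
proof (rule endoI[OF linear_on_slot])
  fix t assume "t \<in> tensor_space r V"
  then show "slot r V i T t \<in> tensor_space r V"
    unfolding tensor_space_def
  proof (rule span_closed_under[OF linear_on_slot])
    fix x assume "x \<in> pure_tensor r V ` Pi\<^sub>E {..<r} V"
    then obtain u where u: "u \<in> Pi\<^sub>E {..<r} V" "x = pure_tensor r V u" by blast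
    then show "slot r V i T x \<in> cvec.span (pure_tensor r V ` Pi\<^sub>E {..<r} V)"
      using slot_pure[of i r V T u] slot_pure_mem[of i r V T u] assms by (simp add: cvec.span_base)
  qed simp
qed

lemma slot_plus:
  assumes i: "i < r" and T: "endo (V i) T" and R: "endo (V i) R" and Q: "endo (V i) Q"
    and eq: "\<And>v. v \<in> V i \<Longrightarrow> Q v = T v + R v" and t: "t \<in> tensor_space r V"
  shows "slot r V i Q t = slot r V i T t + slot r V i R t"
proof (rule tensor_linear_unique[OF linear_on_slot linear_on_plus[OF linear_on_slot linear_on_slot] _ t])
  fix u assume u: "u \<in> Pi\<^sub>E {..<r} V"
  then have ui: "u i \<in> V i" using i by auto
  then show "slot r V i Q (pure_tensor r V u) =
      slot r V i T (pure_tensor r V u) + slot r V i R (pure_tensor r V u)"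
    using linear_on_add[OF linear_on_pure_tensor[OF u i] endo_mem[OF T ui] endo_mem[OF R ui]]
    by (simp add: slot_pure[where V = V, OF i _ u] T R Q eq)
qed

lemma slot_scaled:
  assumes i: "i < r" and T: "endo (V i) T" and Q: "endo (V i) Q"
    and eq: "\<And>v. v \<in> V i \<Longrightarrow> Q v = c *\<^sub>C T v" and t: "t \<in> tensor_space r V"
  shows "slot r V i Q t = c *\<^sub>C slot r V i T t"
proof (rule tensor_linear_unique[OF linear_on_slot linear_on_scaled[OF linear_on_slot] _ t])
  fix u assume u: "u \<in> Pi\<^sub>E {..<r} V"
  then have ui: "u i \<in> V i" using i by auto
  then show "slot r V i Q (pure_tensor r V u) = c *\<^sub>C slot r V i T (pure_tensor r V u)"
    using linear_on_scale[OF linear_on_pure_tensor[OF u i] endo_mem[OF T ui]]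
    by (simp add: slot_pure[where V = V, OF i _ u] T Q eq)
qed

lemma slot_compose:
  assumes i: "i < r" and T: "endo (V i) T" and R: "endo (V i) R" and t: "t \<in> tensor_space r V"
  shows "slot r V i (\<lambda>v. T (R v)) t = slot r V i T (slot r V i R t)"
proof (rule tensor_linear_unique[OF linear_on_slot _ _ t])
  show "linear_on (tensor_space r V) (\<lambda>t. slot r V i T (slot r V i R t))"
    by (rule endo_linear[OF endo_compose[OF slot_endo[where V = V and T = T, OF i T] slot_endo[where
        V = V and T = R, OF i R]]])
  fix u assume u: "u \<in> Pi\<^sub>E {..<r} V"
  show "slot r V i (\<lambda>v. T (R v)) (pure_tensor r V u) = slot r V i T (slot r V i R (pure_tensor r V u))"
    using slot_pure[where V = V and T = "\<lambda>v. T (R v)", OF i endo_compose[OF T R] u] slot_pure[where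
        V = V and T = R, OF i R u]
      slot_pure[where V = V and T = T, OF i T slot_pure_mem[where V = V and T = R, OF i R u]]
    by simp
qed

lemma slot_commute:
  assumes ij: "i < r" "j < r" "i \<noteq> j" and T: "endo (V i) T" and R: "endo (V j) R"
    and t: "t \<in> tensor_space r V"
  shows "slot r V i T (slot r V j R t) = slot r V j R (slot r V i T t)"
proof (rule tensor_linear_unique[OF _ _ _ t])
  show "linear_on (tensor_space r V) (\<lambda>t. slot r V i T (slot r V j R t))"
    by (rule endo_linear[OF endo_compose[OF slot_endo[where V = V and T = T, OF ij(1) T]
        slot_endo[where V = V and T = R, OF ij(2) R]]])
  show "linear_on (tensor_space r V) (\<lambda>t. slot r V j R (slot r V i T t))"
    by (rule endo_linear[OF endo_compose[OF slot_endo[where V = V and T = R, OF ij(2) R]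
        slot_endo[where V = V and T = T, OF ij(1) T]]])
  fix u assume u: "u \<in> Pi\<^sub>E {..<r} V"
  show "slot r V i T (slot r V j R (pure_tensor r V u)) = slot r V j R (slot r V i T (pure_tensor r V u))"
    using slot_pure[where V = V and T = R, OF ij(2) R u] slot_pure[where V = V and T = T, OF ij(1) T u]
      slot_pure[where V = V and T = T, OF ij(1) T slot_pure_mem[where V = V and T = R, OF ij(2) R u]]
      slot_pure[where V = V and T = R, OF ij(2) R slot_pure_mem[where V = V and T = T, OF ij(1) T u]] ij(3)
    by (simp add: fun_upd_twist)
qed

lemma slot_ident: "i < r \<Longrightarrow> t \<in> tensor_space r V \<Longrightarrow> slot r V i (\<lambda>v. v) t = t"
  by (rule tensor_linear_unique[OF linear_on_slot endo_linear[OF endo_ident]])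
    (simp_all add: slot_pure[OF _ endo_ident])

lemma slot_minus:
  assumes i: "i < r" and V: "cvec.subspace (V i)" and T: "endo (V i) T" and R: "endo (V i) R" and Q:
      "endo (V i) Q"
    and eq: "\<And>v. v \<in> V i \<Longrightarrow> Q v = T v - R v" and t: "t \<in> tensor_space r V"
  shows "slot r V i Q t = slot r V i T t - slot r V i R t"
proof -
  have "slot r V i T t = slot r V i Q t + slot r V i R t"
    by (rule slot_plus[where V = V, OF i Q R T _ t]) (simp add: eq)
  then show ?thesis by simp
qed

lemma locally_nilpotent_span:
  assumes f: "endo (cvec.span A) f" and "\<And>a. a \<in> A \<Longrightarrow> \<exists>N. (f ^^ N) a = 0"
  shows "locally_nilpotent (cvec.span A) f"
  unfolding locally_nilpotent_def
proof
  fix v assume "v \<in> cvec.span A"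
  then have "v \<in> cvec.span A \<and> (\<exists>N. (f ^^ N) v = 0)"
  proof (induction rule: cvec.span_induct_alt)
    case base
    have "(f ^^ 0) 0 = 0" by simp
    then show ?case using cvec.span_zero by blast
  next
    case (step c a v)
    obtain N M where N: "(f ^^ N) a = 0" and M: "(f ^^ M) v = 0" using assms(2) step by blast
    have a: "a \<in> cvec.span A" and v: "v \<in> cvec.span A" using step by (auto intro: cvec.span_base)
    let ?K = "max N M"
    note lin = endo_funpow[OF f, of ?K]
    have "(f ^^ ?K) a = 0" "(f ^^ ?K) v = 0"
      using funpow_zero_ge[OF cvec.subspace_span f N, of ?K] funpow_zero_ge[OF cvec.subspace_span f M, of ?K]
      by simp_all
    then have "(f ^^ ?K) (c *\<^sub>C a + v) = 0"
      by (simp add: endo_add[OF lin] endo_scale[OF lin] a v cvec.span_scale)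
    then show ?case using a v cvec.span_add cvec.span_scale by blast
  qed
  then show "\<exists>N. (f ^^ N) v = 0" ..
qed

text \<open>On a pure tensor the powers of the operator act on the single vector in position \<open>i\<close>.\<close>

lemma locally_nilpotent_slot:
  assumes i: "i < r" and V: "cvec.subspace (V i)" and T: "endo (V i) T" "locally_nilpotent (V i) T"
  shows "locally_nilpotent (tensor_space r V) (slot r V i T)"
  unfolding tensor_space_def
proof (rule locally_nilpotent_span)
  show "endo (cvec.span (pure_tensor r V ` Pi\<^sub>E {..<r} V)) (slot r V i T)"
    using slot_endo[where V = V, OF i T(1)] by (simp add: tensor_space_def)
  fix a assume "a \<in> pure_tensor r V ` Pi\<^sub>E {..<r} V"
  then obtain u where u: "u \<in> Pi\<^sub>E {..<r} V" "a = pure_tensor r V u" by blast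
  have ui: "u i \<in> V i" using u i by auto
  have pow: "(slot r V i T ^^ N) a = pure_tensor r V (u(i := (T ^^ N) (u i)))" for N
  proof (induction N)
    case (Suc N)
    have "u(i := (T ^^ N) (u i)) \<in> Pi\<^sub>E {..<r} V"
      by (rule PiE_lessThan_upd[OF u(1) i endo_mem[OF endo_funpow[OF T(1)] ui]])
    from slot_pure[where V = V, OF i T(1) this] show ?case
      unfolding funpow.simps o_apply Suc by (simp only: fun_upd_same fun_upd_upd)
  qed (simp only: u(2) funpow.simps id_apply fun_upd_triv)
  obtain N where "(T ^^ N) (u i) = 0" using T(2) ui by (auto simp: locally_nilpotent_def)
  then have "(slot r V i T ^^ N) a = 0"
    unfolding pow by (simp only: linear_on_zero[OF linear_on_pure_tensor[OF u(1) i] V])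
  then show "\<exists>N. (slot r V i T ^^ N) a = 0" ..
qed

lemma pure_tensor_nonzero:
  assumes "\<And>i. i < r \<Longrightarrow> u i \<noteq> 0"
  shows "pure_tensor r V u \<noteq> 0"
proof -
  have "\<exists>l :: 'a \<Rightarrow> complex. linear_on UNIV l \<and> l (u i) \<noteq> 0" if "i < r" for i
    using linear_functional_nonzero[OF assms[OF that]] by blast
  then obtain l :: "nat \<Rightarrow> 'a \<Rightarrow> complex"
    where l: "\<And>i. i < r \<Longrightarrow> linear_on UNIV (l i)" "\<And>i. i < r \<Longrightarrow> l i (u i) \<noteq> 0" by metis
  define f where "f w = (\<Prod>i<r. l i (w i))" for w
  have "multilinear r V f"
    unfolding multilinear_def
  proof (intro ballI allI impI)
    fix w i assume i: "i < r"
    have "f (w(i := v)) = (\<Prod>j\<in>{..<r} - {i}. l j (w j)) *\<^sub>C l i v" for v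
    proof -
      have "f (w(i := v)) = l i v * (\<Prod>j\<in>{..<r} - {i}. l j ((w(i := v)) j))"
        unfolding f_def using i by (subst prod.remove[of _ i]) auto
      also have "(\<Prod>j\<in>{..<r} - {i}. l j ((w(i := v)) j)) = (\<Prod>j\<in>{..<r} - {i}. l j (w j))"
        by (rule prod.cong) auto
      finally show ?thesis by (simp only: scaleC_complex_def mult.commute)
    qed
    then show "linear_on (V i) (\<lambda>v. f (w(i := v)))"
      using linear_on_scaled[OF linear_on_subset[OF l(1)[OF i]], of "V i"] by simp
  qed
  then have "pure_tensor r V u f = f u" by (simp add: pure_tensor_def)
  also have "\<dots> \<noteq> 0" using l(2) by (simp add: f_def prod_zero_iff)
  finally show ?thesis by (auto simp: fun_eq_iff)
qed

section \<open>Irreducibility of tensor products\<close>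

text \<open>By density, an invariant subspace is stable under all operators on single factors. Projecting
  a nonzero element onto basis vectors, one factor after another, without killing it leads to a
  pure tensor of basis vectors, and each factor of it can then be moved to any prescribed vector.\<close>

lemma irreducible_tensor_space:
  assumes V: "\<And>i. i < r \<Longrightarrow> cvec.subspace (V i)" "\<And>i. i < r \<Longrightarrow> finite_dim (V i)"
    and F: "\<And>i f. i < r \<Longrightarrow> f \<in> F i \<Longrightarrow> endo (V i) f"
    and irr: "\<And>i. i < r \<Longrightarrow> irreducible_under (F i) (V i)"
  shows "irreducible_under {slot r V i f | i f. i < r \<and> f \<in> F i} (tensor_space r V)"
proof -
  let ?P = "Pi\<^sub>E {..<r} V" and ?p = "pure_tensor r V" and ?TS = "tensor_space r V"
  have alg: "endo (V i) T" if "i < r" "T \<in> generated_algebra (F i)" for i T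
    by (rule generated_algebra_endo[OF that(2) V(1)[OF that(1)] F[OF that(1)]])
  have "\<exists>B. finite B \<and> \<not> cvec.dependent B \<and> V i = cvec.span B" if i: "i < r" for i
  proof -
    obtain C where C: "finite C" "V i = cvec.span C" using V(2)[OF i] by (auto simp: finite_dim_def)
    obtain B where B: "B \<subseteq> V i" "\<not> cvec.dependent B" "V i \<subseteq> cvec.span B"
      using cvec.maximal_independent_subset[of "V i"] by metis
    have "finite B" using cvec.independent_span_bound[OF C(1) B(2)] B(1) C(2) by simp
    moreover have "V i = cvec.span B" using B cvec.span_subspace[OF B(1,3) V(1)[OF i]] by simp
    ultimately show ?thesis using B(2) by blast
  qed
  then obtain B where B: "\<And>i. i < r \<Longrightarrow> finite (B i)" "\<And>i. i < r \<Longrightarrow> \<not> cvec.dependent (B i)"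
    "\<And>i. i < r \<Longrightarrow> V i = cvec.span (B i)" by metis
  have B0: "b \<noteq> 0" if "i < r" "b \<in> B i" for i b
    using B(2)[OF that(1)] that(2) cvec.dependent_zero by blast
  have BV: "b \<in> V i" if "i < r" "b \<in> B i" for i b
    unfolding B(3)[OF that(1)] using that(2) by (rule cvec.span_base)
  have Bne: "\<exists>b. b \<in> B i" if i: "i < r" for i
  proof (rule ccontr)
    assume "\<nexists>b. b \<in> B i"
    then have "B i = {}" by blast
    then have "V i = {0}" using B(3)[OF i] by simp
    then show False using irr[OF i] by (simp add: irreducible_under_def)
  qed
  have unit: "\<exists>T. T \<in> generated_algebra (F i) \<and> T b = b \<and> (\<forall>c\<in>B i. c \<noteq> b \<longrightarrow> T c = 0)"
    if i: "i < r" and b: "b \<in> B i" for i b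
  proof -
    obtain T where "T \<in> generated_algebra (F i)" "T b = b" "\<And>c. c \<in> B i \<Longrightarrow> c \<noteq> b \<Longrightarrow> T c = 0"
      by (rule matrix_unit_in_generated_algebra[of "F i" "V i" "B i" b b])
        (use irr[OF i] F[OF i] B(1-3)[OF i] b BV[OF i b] in auto)
    then show ?thesis by blast
  qed
  define E where "E i b =
    (SOME T. T \<in> generated_algebra (F i) \<and> T b = b \<and> (\<forall>c\<in>B i. c \<noteq> b \<longrightarrow> T c = 0))" for i b
  have E_all: "E i b \<in> generated_algebra (F i) \<and> E i b b = b \<and> (\<forall>c\<in>B i. c \<noteq> b \<longrightarrow> E i b c = 0)"
    if "i < r" "b \<in> B i" for i b
    unfolding E_def by (rule someI_ex[OF unit[OF that]])
  have E: "E i b \<in> generated_algebra (F i)" "E i b b = b" "c \<in> B i \<Longrightarrow> c \<noteq> b \<Longrightarrow> E i b c = 0"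
    if "i < r" "b \<in> B i" for i b c
    using E_all[OF that] by simp_all
  have E_endo: "endo (V i) (E i b)" if "i < r" "b \<in> B i" for i b using alg E(1) that by blast
  have Esum: "(\<Sum>b\<in>B i. E i b v) = v" if i: "i < r" and v: "v \<in> V i" for i v
  proof (rule linear_on_span_eqI[of "B i" "\<lambda>v. \<Sum>b\<in>B i. E i b v" "\<lambda>v. v"])
    show "linear_on (cvec.span (B i)) (\<lambda>v. \<Sum>b\<in>B i. E i b v)"
      using endo_linear[OF E_endo[OF i]] B(3)[OF i] by (intro linear_on_sum_fun) simp
    show "(\<Sum>b\<in>B i. E i b c) = c" if c: "c \<in> B i" for c
    proof -
      have "(\<Sum>b\<in>B i. E i b c) = (\<Sum>b\<in>B i. if b = c then c else 0)"
        using E(2,3)[OF i] c by (intro sum.cong) auto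
      then show ?thesis using c B(1)[OF i] by simp
    qed
  qed (use v B(3)[OF i] endo_linear[OF endo_ident] in auto)
  have Erange: "E i b v \<in> cvec.span {b}" if i: "i < r" and b: "b \<in> B i" and v: "v \<in> V i" for i b v
  proof (rule span_closed_under[of "B i" "E i b"])
    show "linear_on (cvec.span (B i)) (E i b)" using endo_linear[OF E_endo[OF i b]] B(3)[OF i] by simp
    show "E i b c \<in> cvec.span {b}" if "c \<in> B i" for c
      using E(2,3)[OF i b] that cvec.span_base[of b "{b}"] cvec.span_zero by (cases "c = b") auto
  qed (use v B(3)[OF i] in auto)
  have slot_E_sum: "(\<Sum>b\<in>B i. slot r V i (E i b) t) = t" if i: "i < r" and t: "t \<in> ?TS" for i t
  proof (rule tensor_linear_unique[OF linear_on_sum_fun[OF linear_on_slot] endo_linear[OF endo_ident] _ t])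
    fix u assume u: "u \<in> ?P"
    then have ui: "u i \<in> V i" using i by auto
    have "(\<Sum>b\<in>B i. slot r V i (E i b) (?p u)) = (\<Sum>b\<in>B i. ?p (u(i := E i b (u i))))"
      using slot_pure[OF i E_endo[OF i] u] by (intro sum.cong) auto
    also have "\<dots> = ?p (u(i := \<Sum>b\<in>B i. E i b (u i)))"
      using endo_mem[OF E_endo[OF i] ui]
      by (intro linear_on_sum[OF linear_on_pure_tensor[OF u i] V(1)[OF i], symmetric])
    finally show "(\<Sum>b\<in>B i. slot r V i (E i b) (?p u)) = ?p u" using Esum[OF i ui] by simp
  qed
  have ne: "?TS \<noteq> {0}"
  proof -
    obtain u where u: "\<And>i. i < r \<Longrightarrow> u i \<in> B i" using Bne by metis
    let ?u = "restrict u {..<r}"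
    have "?u \<in> ?P" using u BV by auto
    moreover have "?p ?u \<noteq> 0" by (rule pure_tensor_nonzero) (use u B0 in auto)
    ultimately show ?thesis using pure_tensor_mem by blast
  qed
  show ?thesis
    unfolding irreducible_under_def
  proof (intro conjI allI impI ne)
    fix S assume S: "cvec.subspace S \<and> S \<subseteq> ?TS \<and>
      (\<forall>f\<in>{slot r V i f |i f. i < r \<and> f \<in> F i}. \<forall>v\<in>S. f v \<in> S)"
    then have Ssub: "cvec.subspace S" and STS: "S \<subseteq> ?TS" by simp_all
    have Sslot: "slot r V i f t \<in> S" if "i < r" "f \<in> F i" "t \<in> S" for i f t
    proof -
      have "slot r V i f \<in> {slot r V i f |i f. i < r \<and> f \<in> F i}" using that(1,2) by blast
      then show ?thesis using S that(3) by simp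
    qed
    have Salg: "slot r V i T t \<in> S" if i: "i < r" and T: "T \<in> generated_algebra (F i)" and t: "t \<in> S" for i T t
      using T
    proof induction
      case ident
      show ?case unfolding slot_ident[OF i subsetD[OF STS t]] by (rule t)
    next
      case (left_mult f T)
      have "slot r V i (\<lambda>v. f (T v)) t = slot r V i f (slot r V i T t)"
        using t STS by (intro slot_compose[OF i] F[OF i] alg[OF i] left_mult) auto
      then show ?case using Sslot[OF i left_mult(1) left_mult.IH] by simp
    next
      case (plus T R)
      note TR = alg[OF i plus(1)] alg[OF i plus(2)]
      have "slot r V i (\<lambda>v. T v + R v) t = slot r V i T t + slot r V i R t"
        by (rule slot_plus[where V = V, OF i TR endo_plus[OF V(1)[OF i] TR] refl subsetD[OF STS t]])
      show ?case unfolding \<open>slot r V i (\<lambda>v. T v + R v) t = _\<close> by (rule cvec.subspace_add[OF Ssub plus.IH])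
    next
      case (scaled T c)
      note T = alg[OF i scaled(1)]
      have "slot r V i (\<lambda>v. c *\<^sub>C T v) t = c *\<^sub>C slot r V i T t"
        by (rule slot_scaled[where V = V, OF i T endo_scaled[OF V(1)[OF i] T] refl subsetD[OF STS t]])
      show ?case unfolding \<open>slot r V i (\<lambda>v. c *\<^sub>C T v) t = _\<close> by (rule cvec.subspace_scale[OF Ssub scaled.IH])
    qed
    show "S = {0} \<or> S = ?TS"
    proof (cases "S = {0}")
      case False
      then obtain t0 where t0: "t0 \<in> S" "t0 \<noteq> 0" using cvec.subspace_0[OF Ssub] by blast
      have proj: "\<exists>t b. t \<in> S \<and> t \<noteq> 0 \<and> (\<forall>i<k. b i \<in> B i) \<and> t \<in> cvec.span (?p ` {u \<in> ?P. \<forall>i<k. u i = b i})"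
        if "k \<le> r" for k
        using that
      proof (induction k)
        case 0
        have "{u \<in> ?P. \<forall>i<0. u i = undefined i} = ?P" by blast
        then have "t0 \<in> cvec.span (?p ` {u \<in> ?P. \<forall>i<0. u i = undefined i})"
          using subsetD[OF STS t0(1)] unfolding tensor_space_def by (simp only:)
        with t0 show ?case by blast
      next
        case (Suc k)
        then have k: "k < r" by simp
        obtain t b where t: "t \<in> S" "t \<noteq> 0" "\<forall>i<k. b i \<in> B i"
          and tspan: "t \<in> cvec.span (?p ` {u \<in> ?P. \<forall>i<k. u i = b i})"
          using Suc.IH[OF less_imp_le[OF k]] by blast
        have "\<exists>c\<in>B k. slot r V k (E k c) t \<noteq> 0"
        proof (rule ccontr)
          assume "\<not> ?thesis"
          then have "(\<Sum>c\<in>B k. slot r V k (E k c) t) = 0" by (intro sum.neutral) auto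
          then show False using slot_E_sum[OF k] t STS by auto
        qed
        then obtain c where c: "c \<in> B k" "slot r V k (E k c) t \<noteq> 0" by blast
        let ?b = "b(k := c)"
        have "slot r V k (E k c) t \<in> cvec.span (?p ` {u \<in> ?P. \<forall>i<Suc k. u i = ?b i})"
          using tspan
        proof (rule span_closed_under[OF linear_on_slot])
          fix x assume "x \<in> ?p ` {u \<in> ?P. \<forall>i<k. u i = b i}"
          then obtain u where u: "u \<in> ?P" "\<forall>i<k. u i = b i" "x = ?p u" by blast
          then have uk: "u k \<in> V k" using k by auto
          obtain a where a: "E k c (u k) = a *\<^sub>C c"
            using Erange[OF k c(1) uk] by (auto simp: cvec.span_singleton)
          have "slot r V k (E k c) x = ?p (u(k := a *\<^sub>C c))"
            unfolding u(3) slot_pure[OF k E_endo[OF k c(1)] u(1)] a ..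
          also have "\<dots> = a *\<^sub>C ?p (u(k := c))"
            by (rule linear_on_scale[OF linear_on_pure_tensor[OF u(1) k] BV[OF k c(1)]])
          also have "\<dots> \<in> cvec.span (?p ` {u \<in> ?P. \<forall>i<Suc k. u i = ?b i})"
            using PiE_lessThan_upd[OF u(1) k BV[OF k c(1)]] u(2)
            by (intro cvec.span_scale cvec.span_base imageI) (auto simp: less_Suc_eq)
          finally show "slot r V k (E k c) x \<in> cvec.span (?p ` {u \<in> ?P. \<forall>i<Suc k. u i = ?b i})" .
        qed simp
        moreover have "slot r V k (E k c) t \<in> S" by (rule Salg[OF k E(1)[OF k c(1)] t(1)])
        moreover have "\<forall>i<Suc k. ?b i \<in> B i" using t(3) c(1) by (auto simp: less_Suc_eq)
        ultimately show ?case using c(2) by blast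
      qed
      obtain t b where t: "t \<in> S" "t \<noteq> 0" "\<forall>i<r. b i \<in> B i"
        and tspan: "t \<in> cvec.span (?p ` {u \<in> ?P. \<forall>i<r. u i = b i})" using proj[OF order_refl] by blast
      let ?w = "restrict b {..<r}"
      have w: "?w \<in> ?P" using t(3) BV by auto
      have "{u \<in> ?P. \<forall>i<r. u i = b i} \<subseteq> {?w}"
        by (auto simp: fun_eq_iff PiE_iff extensional_def)
      then have "?p ` {u \<in> ?P. \<forall>i<r. u i = b i} \<subseteq> {?p ?w}" by blast
      then have "t \<in> cvec.span {?p ?w}" using tspan cvec.span_mono by blast
      then obtain a where a: "t = a *\<^sub>C ?p ?w" by (auto simp: cvec.span_singleton)
      then have "a \<noteq> 0" using t(2) by auto
      then have "?p ?w = (1 / a) *\<^sub>C t" using a by (simp add: scaleC_scaleC scaleC_one)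
      then have pw: "?p ?w \<in> S" using cvec.subspace_scale[OF Ssub t(1)] by simp
      have "?p v \<in> S" if v: "v \<in> ?P" for v
      proof -
        let ?m = "\<lambda>k i. if i < k then v i else ?w i"
        have "?m k \<in> ?P \<and> ?p (?m k) \<in> S" if "k \<le> r" for k
          using that
        proof (induction k)
          case 0
          have "?m 0 = ?w" by (simp only: not_less0 if_False)
          then show ?case using w pw by (simp only: simp_thms)
        next
          case (Suc k)
          then have k: "k < r" and IH: "?m k \<in> ?P" "?p (?m k) \<in> S" by auto
          have bk: "b k \<in> V k" "b k \<noteq> 0" using t(3) BV B0 k by auto
          have "v k \<in> orbit (F k) (b k)"
            using irreducible_under_orbit[OF irr[OF k] V(1)[OF k] F[OF k] bk] v k by auto
          then obtain T where T: "T \<in> generated_algebra (F k)" "v k = T (b k)" by (auto simp: orbit_def)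
          have m: "?m (Suc k) = (?m k)(k := T (?m k k))" using T(2) k by (auto simp: fun_eq_iff less_Suc_eq)
          have "slot r V k T (?p (?m k)) = ?p (?m (Suc k))"
            unfolding m by (rule slot_pure[OF k alg[OF k T(1)] IH(1)])
          moreover have "slot r V k T (?p (?m k)) \<in> S" by (rule Salg[OF k T(1) IH(2)])
          moreover have "?m (Suc k) \<in> ?P" unfolding m by (rule slot_pure_mem[OF k alg[OF k T(1)] IH(1)])
          ultimately show ?case by simp
        qed
        from this[OF order_refl] have "?p (?m r) \<in> S" by blast
        moreover have "?m r = v" using v by (auto simp: fun_eq_iff PiE_iff extensional_def)
        ultimately show ?thesis by simp
      qed
      then have "?TS \<subseteq> S" unfolding tensor_space_def by (intro cvec.span_minimal Ssub) blast
      then show ?thesis using STS by blast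
    qed simp
  qed
qed

section \<open>Tensor products of modules\<close>

lemma lie_module_endo: "lie_module B M \<Longrightarrow> endo (mod_space M) (mod_act M x)"
  and lie_module_subspace: "lie_module B M \<Longrightarrow> cvec.subspace (mod_space M)"
  and lie_module_linear: "lie_module B M \<Longrightarrow> v \<in> mod_space M \<Longrightarrow> linear_on UNIV (\<lambda>x. mod_act M x v)"
  and lie_module_br: "lie_module B M \<Longrightarrow> v \<in> mod_space M \<Longrightarrow>
    mod_act M (B x y) v = mod_act M x (mod_act M y v) - mod_act M y (mod_act M x v)"
  by (auto simp: lie_module_def endo_def)

lemma irreducible_module_iff:
  "irreducible_module M \<longleftrightarrow> irreducible_under (range (mod_act M)) (mod_space M)"
  by (simp add: irreducible_module_def irreducible_under_def)

lemma mod_space_tensor [simp]: "mod_space (tensor_module r M) = tensor_space r (\<lambda>i. mod_space (M i))"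
  by (simp add: tensor_module_def)

lemma tensor_act_slots:
  assumes M: "\<And>i. i < r \<Longrightarrow> endo (mod_space (M i)) (mod_act (M i) x)"
    and t: "t \<in> tensor_space r (\<lambda>i. mod_space (M i))"
  shows "mod_act (tensor_module r M) x t = (\<Sum>i<r. slot r (\<lambda>i. mod_space (M i)) i (mod_act (M i) x) t)"
proof (rule tensor_linear_unique[OF _ linear_on_sum_fun[OF linear_on_slot] _ t])
  show "linear_on (tensor_space r (\<lambda>i. mod_space (M i))) (mod_act (tensor_module r M) x)"
    by (auto simp: linear_on_def tensor_module_def fun_eq_iff scaleC_fun_apply)
  fix u assume u: "u \<in> Pi\<^sub>E {..<r} (\<lambda>i. mod_space (M i))"
  have "mod_act (tensor_module r M) x (pure_tensor r (\<lambda>i. mod_space (M i)) u) =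
      (\<Sum>i<r. pure_tensor r (\<lambda>i. mod_space (M i)) (u(i := mod_act (M i) x (u i))))"
    by (rule tensor_act_pure[OF endo_linear[OF M] endo_mem[OF M] u])
  also have "\<dots> =
      (\<Sum>i<r. slot r (\<lambda>i. mod_space (M i)) i (mod_act (M i) x) (pure_tensor r (\<lambda>i. mod_space (M i)) u))"
  proof (rule sum.cong[OF refl])
    fix i assume "i \<in> {..<r}"
    then have i: "i < r" by simp
    show "pure_tensor r (\<lambda>i. mod_space (M i)) (u(i := mod_act (M i) x (u i))) =
        slot r (\<lambda>i. mod_space (M i)) i (mod_act (M i) x) (pure_tensor r (\<lambda>i. mod_space (M i)) u)"
      by (rule slot_pure[where V = "\<lambda>i. mod_space (M i)", OF i M[OF i] u, symmetric])
  qed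
  finally show "mod_act (tensor_module r M) x (pure_tensor r (\<lambda>i. mod_space (M i)) u) =
      (\<Sum>i<r. slot r (\<lambda>i. mod_space (M i)) i (mod_act (M i) x) (pure_tensor r (\<lambda>i. mod_space (M i)) u))" .
qed

text \<open>Operators on different factors commute, so only the diagonal terms of the commutator survive.\<close>

lemma lie_module_tensor:
  assumes M: "\<And>i. i < r \<Longrightarrow> lie_module B (M i)"
  shows "lie_module B (tensor_module r M)"
proof -
  let ?V = "\<lambda>i. mod_space (M i)"
  let ?TS = "tensor_space r ?V" and ?act = "mod_act (tensor_module r M)"
  let ?s = "\<lambda>i x. slot r ?V i (mod_act (M i) x)"
  have Me: "endo (?V i) (mod_act (M i) x)" if "i < r" for i x by (rule lie_module_endo[OF M[OF that]])
  have act: "?act x t = (\<Sum>i<r. ?s i x t)" if "t \<in> ?TS" for x t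
    by (rule tensor_act_slots[OF Me that])
  have se: "endo ?TS (?s i x)" if "i < r" for i x
    using slot_endo[of i r ?V, OF that Me[OF that]] .
  have TS: "cvec.subspace ?TS" by (rule subspace_tensor_space)
  have acte: "endo ?TS (?act x)" for x
  proof -
    have "endo ?TS (\<lambda>t. \<Sum>i<r. ?s i x t)" by (rule endo_sum_fun[OF TS]) (simp add: se)
    then show ?thesis using act TS
      by (simp add: endo_def linear_on_def cvec.subspace_add cvec.subspace_scale)
  qed
  have add: "?s i (x + y) t = ?s i x t + ?s i y t" if i: "i < r" and t: "t \<in> ?TS" for i x y t
    by (rule slot_plus[where V = ?V, OF i Me[OF i] Me[OF i] Me[OF i] _ t])
      (rule linear_on_add[OF lie_module_linear[OF M[OF i]] UNIV_I UNIV_I])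
  have scale: "?s i (c *\<^sub>C x) t = c *\<^sub>C ?s i x t" if i: "i < r" and t: "t \<in> ?TS" for i c x t
    by (rule slot_scaled[where V = ?V, OF i Me[OF i] Me[OF i] _ t])
      (rule linear_on_scale[OF lie_module_linear[OF M[OF i]] UNIV_I])
  have brk: "?s i (B x y) t = ?s i x (?s i y t) - ?s i y (?s i x t)" if i: "i < r" and t: "t \<in> ?TS" for i x y t
  proof -
    have "?s i (B x y) t = slot r ?V i (\<lambda>v. mod_act (M i) x (mod_act (M i) y v)) t -
        slot r ?V i (\<lambda>v. mod_act (M i) y (mod_act (M i) x v)) t"
      by (rule slot_minus[where V = ?V, OF i lie_module_subspace[OF M[OF i]] endo_compose[OF Me[OF i] Me[OF i]]
            endo_compose[OF Me[OF i] Me[OF i]] Me[OF i] _ t]) (rule lie_module_br[OF M[OF i]])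
    also have "slot r ?V i (\<lambda>v. mod_act (M i) x (mod_act (M i) y v)) t = ?s i x (?s i y t)"
      by (rule slot_compose[where V = ?V, OF i Me[OF i] Me[OF i] t])
    also have "slot r ?V i (\<lambda>v. mod_act (M i) y (mod_act (M i) x v)) t = ?s i y (?s i x t)"
      by (rule slot_compose[where V = ?V, OF i Me[OF i] Me[OF i] t])
    finally show ?thesis .
  qed
  have comm: "?s i x (?s j y t) = ?s j y (?s i x t)" if "i < r" "j < r" "i \<noteq> j" "t \<in> ?TS" for i j x y t
    by (rule slot_commute[where V = ?V, OF that(1-3) Me[OF that(1)] Me[OF that(2)] that(4)])
  show ?thesis
    unfolding lie_module_def mod_space_tensor
  proof (intro conjI allI ballI TS)
    fix x show "linear_on ?TS (?act x)" by (rule endo_linear[OF acte])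
  next
    fix x t assume "t \<in> ?TS" then show "?act x t \<in> ?TS" by (rule endo_mem[OF acte])
  next
    fix t assume t: "t \<in> ?TS"
    show "linear_on UNIV (\<lambda>x. ?act x t)"
      using add scale t by (intro linear_onI) (simp_all add: act sum.distrib cvec.scale_sum_right)
  next
    fix x y t assume t: "t \<in> ?TS"
    have two: "?act x (?act y t) = (\<Sum>i<r. \<Sum>j<r. ?s i x (?s j y t))" for x y
    proof -
      have "?act x (?act y t) = (\<Sum>i<r. ?s i x (?act y t))" by (rule act[OF endo_mem[OF acte t]])
      also have "\<dots> = (\<Sum>i<r. ?s i x (\<Sum>j<r. ?s j y t))" by (simp only: act[OF t])
      also have "\<dots> = (\<Sum>i<r. \<Sum>j<r. ?s i x (?s j y t))"
        using endo_mem[OF se t] by (intro sum.cong refl endo_sum[OF se TS]) auto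
      finally show ?thesis .
    qed
    have "?act x (?act y t) - ?act y (?act x t) =
        (\<Sum>i<r. \<Sum>j<r. ?s i x (?s j y t)) - (\<Sum>i<r. \<Sum>j<r. ?s j y (?s i x t))"
      unfolding two by (subst (2) sum.swap) (rule refl)
    also have "\<dots> = (\<Sum>i<r. \<Sum>j<r. ?s i x (?s j y t) - ?s j y (?s i x t))"
      by (simp add: sum_subtractf)
    also have "\<dots> = (\<Sum>i<r. \<Sum>j<r. if j = i then ?s i (B x y) t else 0)"
      using comm brk t by (intro sum.cong refl) auto
    also have "\<dots> = ?act (B x y) t" unfolding act[OF t] by (intro sum.cong) auto
    finally show "?act (B x y) t = ?act x (?act y t) - ?act y (?act x t)" by simp
  qed
qed

section \<open>Evaluation modules\<close>

lemma poly_mapping_sum_single: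
  "(\<Sum>n\<in>Poly_Mapping.keys f. Poly_Mapping.single n (Poly_Mapping.lookup f n)) = f"
proof (rule poly_mapping_eqI)
  fix k
  have "Poly_Mapping.lookup (\<Sum>n\<in>Poly_Mapping.keys f. Poly_Mapping.single n (Poly_Mapping.lookup f n)) k =
      (\<Sum>n\<in>Poly_Mapping.keys f. if n = k then Poly_Mapping.lookup f n else 0)"
    by (simp add: lookup_sum lookup_single when_def)
  also have "\<dots> = Poly_Mapping.lookup f k"
    by (simp add: in_keys_iff)
  finally show "Poly_Mapping.lookup (\<Sum>n\<in>Poly_Mapping.keys f. Poly_Mapping.single n
      (Poly_Mapping.lookup f n)) k =
      Poly_Mapping.lookup f k" .
qed

lemma affine_decomposition:
  fixes X :: "'g::complex_vector affine"
  shows "X = (\<Sum>n\<in>Poly_Mapping.keys (fst X). loop_elem (Poly_Mapping.lookup (fst X) n) n) + snd X *\<^sub>C (0, 1)"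
proof -
  have "fst (\<Sum>n\<in>A. loop_elem (g n) n) = (\<Sum>n\<in>A. Poly_Mapping.single n (g n))"
    and "snd (\<Sum>n\<in>A. loop_elem (g n) n) = 0" for A and g :: "int \<Rightarrow> 'g"
    by (induction A rule: infinite_finite_induct) (simp_all add: loop_elem_def)
  then show ?thesis
    by (simp add: prod_eq_iff scaleC_prod_def poly_mapping_sum_single scaleC_complex_def)
qed

lemma affine_act:
  assumes "lie_module B M" "v \<in> mod_space M"
  shows "mod_act M X v = (\<Sum>n\<in>Poly_Mapping.keys (fst X). mode M (Poly_Mapping.lookup (fst X) n) n v) +
    snd X *\<^sub>C mod_act M (0, 1) v"
proof -
  note lin = lie_module_linear[OF assms]
  have "mod_act M X v = mod_act M ((\<Sum>n\<in>Poly_Mapping.keys (fst X).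
      loop_elem (Poly_Mapping.lookup (fst X) n) n) + snd X *\<^sub>C (0, 1)) v"
    using affine_decomposition[of X] by simp
  then show ?thesis
    by (simp add: linear_on_add[OF lin] linear_on_scale[OF lin] linear_on_sum[OF lin
        cvec.subspace_UNIV] mode_def)
qed

lemma mode_linear:
  assumes "lie_module B M" "v \<in> mod_space M"
  shows "linear_on UNIV (\<lambda>a. mode M a n v)"
proof -
  note lin = lie_module_linear[OF assms]
  have "loop_elem (a + b) n = loop_elem a n + loop_elem b n" for a b :: 'a
    by (simp add: loop_elem_def single_add)
  moreover have "loop_elem (c *\<^sub>C a) n = c *\<^sub>C loop_elem a n" for c and a :: 'a
  proof -
    have "Poly_Mapping.single n (c *\<^sub>C a) = c *\<^sub>C Poly_Mapping.single n a"
      by (rule poly_mapping_eqI) (simp add: lookup_single scaleC_poly_mapping.rep_eq when_def)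
    then show ?thesis by (simp add: loop_elem_def scaleC_prod_def)
  qed
  ultimately show ?thesis
    unfolding mode_def by (intro linear_onI) (simp_all add: linear_on_add[OF lin] linear_on_scale[OF lin])
qed

lemma mod_space_evaluation [simp]: "mod_space (evaluation_module U z) = mod_space U"
  by (simp add: evaluation_module_def)

lemma evaluation_act_superset:
  assumes U: "lie_module br U" "u \<in> mod_space U" and "finite K" "Poly_Mapping.keys (fst X) \<subseteq> K"
  shows "mod_act (evaluation_module U z) X u =
    (\<Sum>n\<in>K. z powi n *\<^sub>C mod_act U (Poly_Mapping.lookup (fst X) n) u)"
proof -
  have "mod_act U 0 u = 0" using linear_on_zero[OF lie_module_linear[OF U] cvec.subspace_UNIV] .
  then show ?thesis
    unfolding evaluation_module_def lie_mod.simps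
    using assms(3,4) by (intro sum.mono_neutral_left) (auto simp: in_keys_iff)
qed

lemma evaluation_act_single:
  assumes U: "lie_module br U" "u \<in> mod_space U"
  shows "mod_act (evaluation_module U z) (Poly_Mapping.single n a, c) u = z powi n *\<^sub>C mod_act U a u"
  using evaluation_act_superset[OF U, of "{n}" "(Poly_Mapping.single n a, c)" z] by simp

lemma lie_module_evaluation:
  assumes U: "lie_module br U" and z: "z \<noteq> 0"
  shows "lie_module (affine_bracket br form) (evaluation_module U z)"
proof -
  let ?V = "mod_space U" and ?A = "mod_act (evaluation_module U z)"
  have V: "cvec.subspace ?V" by (rule lie_module_subspace[OF U])
  have A: "?A X = (\<lambda>u. \<Sum>n\<in>Poly_Mapping.keys (fst X). z powi n *\<^sub>C mod_act U (Poly_Mapping.lookup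
      (fst X) n) u)" for X
    by (simp add: evaluation_module_def)
  have Ae: "endo ?V (?A X)" for X
    unfolding A by (intro endo_sum_fun[OF V] endo_scaled[OF V] lie_module_endo[OF U])
  have lin: "linear_on UNIV (\<lambda>X. ?A X u)" if u: "u \<in> ?V" for u
  proof (rule linear_onI)
    fix X Y :: "'a affine"
    let ?K = "Poly_Mapping.keys (fst X) \<union> Poly_Mapping.keys (fst Y)"
    have sub: "Poly_Mapping.keys (fst (X + Y)) \<subseteq> ?K" by (simp add: keys_add)
    have "?A (X + Y) u = (\<Sum>n\<in>?K. z powi n *\<^sub>C mod_act U (Poly_Mapping.lookup (fst (X + Y)) n) u)"
      by (rule evaluation_act_superset[OF U u _ sub]) simp
    also have "\<dots> = (\<Sum>n\<in>?K. z powi n *\<^sub>C mod_act U (Poly_Mapping.lookup (fst X) n) u +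
        z powi n *\<^sub>C mod_act U (Poly_Mapping.lookup (fst Y) n) u)"
      by (simp add: lookup_add linear_on_add[OF lie_module_linear[OF U u]] scaleC_add_right)
    also have "\<dots> = ?A X u + ?A Y u"
      unfolding sum.distrib
      using evaluation_act_superset[OF U u, of ?K X z] evaluation_act_superset[OF U u, of ?K Y z] by simp
    finally show "?A (X + Y) u = ?A X u + ?A Y u" .
  next
    fix c and X :: "'a affine"
    have l: "Poly_Mapping.lookup (fst (c *\<^sub>C X)) n = c *\<^sub>C Poly_Mapping.lookup (fst X) n" for n
      by (simp add: scaleC_prod_def scaleC_poly_mapping.rep_eq)
    then have sub: "Poly_Mapping.keys (fst (c *\<^sub>C X)) \<subseteq> Poly_Mapping.keys (fst X)"
      by (auto simp: in_keys_iff)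
    have "?A (c *\<^sub>C X) u = (\<Sum>n\<in>Poly_Mapping.keys (fst X). z powi n *\<^sub>C mod_act U
        (Poly_Mapping.lookup (fst (c *\<^sub>C X)) n) u)"
      by (rule evaluation_act_superset[OF U u _ sub]) simp
    also have "\<dots> = c *\<^sub>C ?A X u"
      unfolding l A by (simp add: linear_on_scale[OF lie_module_linear[OF U u]] cvec.scale_sum_right
          scaleC_scaleC mult.commute)
    finally show "?A (c *\<^sub>C X) u = c *\<^sub>C ?A X u" .
  qed
  show ?thesis
    unfolding lie_module_def mod_space_evaluation
  proof (intro conjI allI ballI V)
    fix X u assume "u \<in> ?V" then show "?A X u \<in> ?V" by (rule endo_mem[OF Ae])
  next
    fix X show "linear_on ?V (?A X)" by (rule endo_linear[OF Ae])
  next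
    fix u assume "u \<in> ?V" then show "linear_on UNIV (\<lambda>X. ?A X u)" by (rule lin)
  next
    fix X Y :: "'a affine" and u assume u: "u \<in> ?V"
    let ?KX = "Poly_Mapping.keys (fst X)" and ?KY = "Poly_Mapping.keys (fst Y)"
    let ?x = "\<lambda>n. mod_act U (Poly_Mapping.lookup (fst X) n)" and ?y = "\<lambda>n. mod_act U
        (Poly_Mapping.lookup (fst Y) n)"
    note Ue = lie_module_endo[OF U]
    have two: "(\<Sum>m\<in>K. z powi m *\<^sub>C p m (\<Sum>n\<in>L. z powi n *\<^sub>C q n u)) =
        (\<Sum>m\<in>K. \<Sum>n\<in>L. z powi (m + n) *\<^sub>C p m (q n u))"
      if p: "\<And>m. endo ?V (p m)" and q: "\<And>m. endo ?V (q m)" for p q :: "int \<Rightarrow> _ \<Rightarrow> _" and K L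
    proof (rule sum.cong[OF refl])
      fix m
      have "p m (\<Sum>n\<in>L. z powi n *\<^sub>C q n u) = (\<Sum>n\<in>L. z powi n *\<^sub>C p m (q n u))"
        using endo_mem[OF q u] by (subst endo_sum[OF p V]) (auto simp: endo_scale[OF p]
            cvec.subspace_scale[OF V])
      then show "z powi m *\<^sub>C p m (\<Sum>n\<in>L. z powi n *\<^sub>C q n u) = (\<Sum>n\<in>L. z powi (m + n) *\<^sub>C p m (q n u))"
        using z by (simp add: cvec.scale_sum_right scaleC_scaleC power_int_add)
    qed
    have "?A (affine_bracket br form X Y) u =
        (\<Sum>m\<in>?KX. \<Sum>n\<in>?KY. z powi (m + n) *\<^sub>C mod_act U (br (Poly_Mapping.lookup (fst X) m)
            (Poly_Mapping.lookup (fst Y) n)) u)"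
      unfolding affine_bracket_def Let_def
      by (simp add: linear_on_sum[OF lin[OF u] cvec.subspace_UNIV] evaluation_act_single[OF U u])
    also have "\<dots> = (\<Sum>m\<in>?KX. \<Sum>n\<in>?KY. z powi (m + n) *\<^sub>C ?x m (?y n u)) -
        (\<Sum>m\<in>?KX. \<Sum>n\<in>?KY. z powi (m + n) *\<^sub>C ?y n (?x m u))"
      by (simp add: lie_module_br[OF U u] cvec.scale_right_diff_distrib sum_subtractf)
    also have "(\<Sum>m\<in>?KX. \<Sum>n\<in>?KY. z powi (m + n) *\<^sub>C ?y n (?x m u)) =
        (\<Sum>n\<in>?KY. \<Sum>m\<in>?KX. z powi (n + m) *\<^sub>C ?y n (?x m u))"
      by (subst sum.swap) (simp only: add.commute)
    also have "(\<Sum>m\<in>?KX. \<Sum>n\<in>?KY. z powi (m + n) *\<^sub>C ?x m (?y n u)) = ?A X (?A Y u)"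
      unfolding A by (rule two[OF Ue Ue, symmetric])
    also have "(\<Sum>n\<in>?KY. \<Sum>m\<in>?KX. z powi (n + m) *\<^sub>C ?y n (?x m u)) = ?A Y (?A X u)"
      unfolding A by (rule two[OF Ue Ue, symmetric])
    finally show "?A (affine_bracket br form X Y) u = ?A X (?A Y u) - ?A Y (?A X u)" .
  qed
qed

text \<open>The eigenvectors of a suitable \<open>h \<in> H\<close> span the module, because their span is invariant, and a
  root vector shifts the eigenvalue, of which there are only finitely many.\<close>

lemma root_vector_locally_nilpotent:
  assumes "lie_algebra br" and tor: "toral br H" and U: "lie_module br U" "irreducible_module U"
      "finite_dim (mod_space U)"
    and a: "a \<in> root_vectors br H"
  shows "locally_nilpotent (mod_space U) (mod_act U a)"
proof -
  interpret lie_algebra br by fact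
  let ?V = "mod_space U" and ?A = "mod_act U"
  have V: "cvec.subspace ?V" by (rule lie_module_subspace[OF U(1)])
  note Ue = lie_module_endo[OF U(1)]
  obtain l h where h: "h \<in> H" "l h \<noteq> 0" and bra: "br h a = l h *\<^sub>C a"
    using a by (auto simp: root_vectors_def nonvanishing_def root_space_def)
  have shift: "?A h (?A x v) = (c + d) *\<^sub>C ?A x v"
    if "br h x = c *\<^sub>C x" "v \<in> ?V" "?A h v = d *\<^sub>C v" for x c d v
  proof -
    have "?A (br h x) v = c *\<^sub>C ?A x v"
      unfolding that(1) by (rule linear_on_scale[OF lie_module_linear[OF U(1) that(2)] UNIV_I])
    then show ?thesis
      using lie_module_br[OF U(1) that(2), of h x] that(3) endo_scale[OF Ue that(2)]
      by (simp add: scaleC_add_left diff_eq_eq)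
  qed
  define E where "E = {v \<in> ?V. \<exists>d. ?A h v = d *\<^sub>C v}"
  have EV: "cvec.span E \<subseteq> ?V" by (rule cvec.span_minimal[OF _ V]) (auto simp: E_def)
  obtain B where B: "cvec.span B = UNIV" "\<forall>b\<in>B. \<exists>c. br h b = c *\<^sub>C b"
    using tor h(1) by (auto simp: toral_def ad_diagonalizable_def)
  have closed: "?A x v \<in> cvec.span E" if v: "v \<in> cvec.span E" for x v
  proof -
    have gens: "?A b v \<in> cvec.span E" if b: "b \<in> B" for b
      using v
    proof (rule span_closed_under[OF linear_on_subset[OF endo_linear[OF Ue] EV]])
      fix e assume "e \<in> E"
      then obtain d where e: "e \<in> ?V" "?A h e = d *\<^sub>C e" by (auto simp: E_def)
      obtain c where "br h b = c *\<^sub>C b" using B(2) b by blast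
      from shift[OF this e] have "?A b e \<in> E" using endo_mem[OF Ue e(1)] by (auto simp: E_def)
      then show "?A b e \<in> cvec.span E" by (rule cvec.span_base)
    qed simp
    have lin: "linear_on (cvec.span B) (\<lambda>x. ?A x v)"
      unfolding B(1) by (rule lie_module_linear[OF U(1) subsetD[OF EV v]])
    have "x \<in> cvec.span B" using B(1) by simp
    from span_closed_under[OF lin this gens cvec.subspace_span] show ?thesis .
  qed
  have "?V \<noteq> {0}" using U(2) by (simp add: irreducible_module_def)
  then obtain d v where v: "v \<in> ?V" "v \<noteq> 0" "?A h v = d *\<^sub>C v"
    by (rule eigenvector_exists[OF U(3) V _ Ue])
  then have "v \<in> cvec.span E" by (intro cvec.span_base) (auto simp: E_def)
  then have "cvec.span E \<noteq> {0}" using v(2) by auto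
  moreover have "cvec.subspace (cvec.span E) \<and> cvec.span E \<subseteq> ?V \<and> (\<forall>x. \<forall>v\<in>cvec.span E. ?A x v \<in> cvec.span E)"
    using EV closed by simp
  then have "cvec.span E = {0} \<or> cvec.span E = ?V"
    by (rule U(2)[unfolded irreducible_module_def, THEN conjunct2, THEN spec, THEN mp])
  ultimately have EV: "cvec.span E = ?V" by simp
  have "locally_nilpotent (cvec.span E) (?A a)"
  proof (rule locally_nilpotent_span)
    show "endo (cvec.span E) (?A a)" unfolding EV by (rule Ue)
    fix v assume "v \<in> E"
    then obtain d where v: "v \<in> ?V" "?A h v = d *\<^sub>C v" by (auto simp: E_def)
    have aV: "(?A a ^^ k) v \<in> ?V" for k by (rule endo_mem[OF endo_funpow[OF Ue] v(1)])
    have eig: "?A h ((?A a ^^ k) v) = (of_nat k * l h + d) *\<^sub>C (?A a ^^ k) v" for k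
    proof (induction k)
      case (Suc k)
      have "?A h (?A a ((?A a ^^ k) v)) = (l h + (of_nat k * l h + d)) *\<^sub>C ?A a ((?A a ^^ k) v)"
        by (rule shift[OF bra aV Suc])
      then show ?case by (simp add: algebra_simps)
    qed (simp add: v)
    show "\<exists>N. (?A a ^^ N) v = 0"
      by (rule eigenvector_sequence_vanishes[OF U(3) V Ue _ aV eig]) (use h(2) in \<open>auto simp: inj_def\<close>)
  qed
  then show ?thesis unfolding EV .
qed

section \<open>Tensor products of evaluation modules\<close>

locale evaluation_tensor =
  fixes br :: "'g::complex_vector \<Rightarrow> 'g \<Rightarrow> 'g" and r :: nat
    and U :: "nat \<Rightarrow> ('g, 'v::complex_vector) lie_mod" and z :: "nat \<Rightarrow> complex"
  assumes U: "i < r \<Longrightarrow> lie_module br (U i)" "i < r \<Longrightarrow> irreducible_module (U i)"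
      "i < r \<Longrightarrow> finite_dim (mod_space (U i))"
    and z0: "i < r \<Longrightarrow> z i \<noteq> 0" and zinj: "inj_on z {..<r}"
begin

abbreviation "M \<equiv> \<lambda>i. evaluation_module (U i) (z i)"
abbreviation "V \<equiv> \<lambda>i. mod_space (U i)"
abbreviation "W \<equiv> tensor_module r M"
abbreviation "TS \<equiv> tensor_space r V"

lemma mod_space_W [simp]: "mod_space W = TS"
  by simp

lemma lie_module_W: "lie_module (affine_bracket br form) W"
  by (rule lie_module_tensor) (rule lie_module_evaluation[OF U(1) z0])

lemma act_slots: "t \<in> TS \<Longrightarrow> mod_act W X t = (\<Sum>i<r. slot r V i (mod_act (M i) X) t)"
  using tensor_act_slots[where M = M, OF lie_module_endo[OF lie_module_evaluation[OF U(1) z0]]]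
  unfolding mod_space_evaluation .

lemma slot_U_endo: "i < r \<Longrightarrow> endo TS (slot r V i (mod_act (U i) a))"
  by (rule slot_endo[where V = V, OF _ lie_module_endo[OF U(1)]])

lemma mode_W:
  assumes t: "t \<in> TS"
  shows "mode W a n t = (\<Sum>i<r. z i powi n *\<^sub>C slot r V i (mod_act (U i) a) t)"
  unfolding mode_def act_slots[OF t]
proof (rule sum.cong[OF refl])
  fix i assume "i \<in> {..<r}"
  then have i: "i < r" by simp
  have "endo (V i) (mod_act (M i) (loop_elem a n))"
    using lie_module_endo[OF lie_module_evaluation[OF U(1)[OF i] z0[OF i]]] by simp
  then show "slot r V i (mod_act (M i) (loop_elem a n)) t = z i powi n *\<^sub>C slot r V i (mod_act (U i) a) t"
    by (intro slot_scaled[where V = V, OF i lie_module_endo[OF U(1)[OF i]] _ _ t])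
      (simp_all add: loop_elem_def evaluation_act_single[OF U(1)[OF i]])
qed

lemma central_W:
  assumes t: "t \<in> TS"
  shows "mod_act W (0, c) t = 0"
  unfolding act_slots[OF t]
proof (rule sum.neutral, rule ballI)
  fix i assume "i \<in> {..<r}"
  then have i: "i < r" by simp
  have zero: "mod_act (M i) (0, c) = (\<lambda>_. 0)" by (simp add: evaluation_module_def)
  have "endo (V i) (\<lambda>_. 0)"
    using cvec.subspace_0[OF lie_module_subspace[OF U(1)[OF i]]] by (simp add: endo_def linear_on_def)
  then have "slot r V i (\<lambda>_. 0) t = 0 *\<^sub>C slot r V i (\<lambda>v. v) t"
    by (intro slot_scaled[where V = V, OF i endo_ident _ _ t]) simp_all
  then show "slot r V i (mod_act (M i) (0, c)) t = 0" unfolding zero by simp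
qed

text \<open>The mode \<open>a(n)\<close> acts as \<open>\<Sum>\<^sub>j z\<^sub>j\<^sup>n a\<^sup>(\<^sup>j\<^sup>)\<close>, where \<open>a\<^sup>(\<^sup>j\<^sup>)\<close> acts on the \<open>j\<close>-th factor.
    Weighting the modes with
  the coefficients of the Lagrange polynomial at \<open>z\<^sub>i\<close> leaves the term \<open>j = i\<close>.\<close>

lemma slot_interpolate:
  assumes t: "t \<in> TS" and i: "i < r"
  shows "slot r V i (mod_act (U i) a) t =
    poly_comb (lagrange_poly (z ` {..<r}) (z i)) (\<lambda>n. mode W a (int n) t)"
proof -
  let ?l = "lagrange_poly (z ` {..<r}) (z i)" and ?X = "\<lambda>j. slot r V j (mod_act (U j) a) t"
  have "poly_comb ?l (\<lambda>n. mode W a (int n) t) = poly_comb ?l (\<lambda>n. \<Sum>j<r. z j ^ n *\<^sub>C ?X j)"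
    unfolding mode_W[OF t] by simp
  also have "\<dots> = (\<Sum>j<r. poly_comb ?l (\<lambda>n. z j ^ n *\<^sub>C ?X j))"
    unfolding poly_comb_def cvec.scale_sum_right by (rule sum.swap)
  also have "\<dots> = (\<Sum>j<r. if j = i then ?X j else 0)"
    unfolding poly_comb_geometric
    using i inj_onD[OF zinj] by (intro sum.cong) (auto simp: poly_lagrange_poly scaleC_one)
  finally show ?thesis using i by simp
qed

lemma irreducible_W: "irreducible_module W"
proof -
  have tens: "irreducible_under {slot r V i f | i f. i < r \<and> f \<in> range (mod_act (U i))} TS"
  proof (rule irreducible_tensor_space)
    fix i assume i: "i < r"
    show "cvec.subspace (V i)" by (rule lie_module_subspace[OF U(1)[OF i]])
    show "finite_dim (V i)" by (rule U(3)[OF i])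
    show "irreducible_under (range (mod_act (U i))) (V i)"
      using U(2)[OF i] by (simp add: irreducible_module_iff)
    fix f assume "f \<in> range (mod_act (U i))"
    then show "endo (V i) f" using lie_module_endo[OF U(1)[OF i]] by auto
  qed
  show ?thesis
    unfolding irreducible_module_iff irreducible_under_def mod_space_W
  proof (intro conjI allI impI)
    show "TS \<noteq> {0}" using tens by (simp add: irreducible_under_def)
    fix S assume S: "cvec.subspace S \<and> S \<subseteq> TS \<and> (\<forall>f\<in>range (mod_act W). \<forall>v\<in>S. f v \<in> S)"
    note Ssub = conjunct1[OF S] and STS = conjunct1[OF conjunct2[OF S]] and Sact = conjunct2[OF conjunct2[OF S]]
    have inv: "slot r V i (mod_act (U i) a) v \<in> S" if i: "i < r" and v: "v \<in> S" for i a v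
    proof -
      have "mode W a n v \<in> S" for n
        unfolding mode_def by (rule bspec[OF bspec[OF Sact rangeI] v])
      then show ?thesis
        unfolding slot_interpolate[OF subsetD[OF STS v] i] by (intro poly_comb_mem Ssub)
    qed
    show "S = {0} \<or> S = TS"
      by (rule irreducible_underD[OF tens Ssub STS]) (clarify, rule inv)
  qed
qed

lemma integrable_W:
  assumes "lie_algebra br" "toral br H"
  shows "integrable_module br H W"
  unfolding integrable_module_def mod_space_W
proof (intro ballI allI)
  fix \<alpha> a n t assume \<alpha>: "\<alpha> \<in> roots br H" and "a \<in> root_space br H \<alpha>" and t: "t \<in> TS"
  then have a: "a \<in> root_vectors br H" by (auto simp: root_vectors_def nonvanishing_def roots_def)
  let ?f = "\<lambda>i. slot r V i (mod_act (U i) a)"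
  note Ue = lie_module_endo[OF U(1)]
  have nil: "locally_nilpotent TS (\<lambda>t. \<Sum>i<r. z i powi n *\<^sub>C ?f i t)"
  proof (rule locally_nilpotent_sum[OF subspace_tensor_space])
    fix i assume "i \<in> {..<r}"
    then have i: "i < r" by simp
    show "endo TS (\<lambda>t. z i powi n *\<^sub>C ?f i t)"
      by (rule endo_scaled[OF subspace_tensor_space slot_U_endo[OF i]])
    have "locally_nilpotent TS (?f i)"
      by (rule locally_nilpotent_slot[where V = V, OF i lie_module_subspace[OF U(1)[OF i]] Ue[OF i]
            root_vector_locally_nilpotent[OF assms U(1)[OF i] U(2)[OF i] U(3)[OF i] a]])
    then show "locally_nilpotent TS (\<lambda>t. z i powi n *\<^sub>C ?f i t)"
      by (rule locally_nilpotent_scaled[OF subspace_tensor_space slot_U_endo[OF i]])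
  next
    fix i j t assume "i \<in> {..<r}" "j \<in> {..<r}" and t: "t \<in> TS"
    then have ij: "i < r" "j < r" by auto
    have "?f i (?f j t) = ?f j (?f i t)"
    proof (cases "i = j")
      case False
      then show ?thesis by (rule slot_commute[where V = V, OF ij _ Ue[OF ij(1)] Ue[OF ij(2)] t])
    qed simp
    then show "z i powi n *\<^sub>C ?f i (z j powi n *\<^sub>C ?f j t) = z j powi n *\<^sub>C ?f j (z i powi n *\<^sub>C ?f i t)"
      using endo_mem[OF slot_U_endo[OF ij(1)] t] endo_mem[OF slot_U_endo[OF ij(2)] t]
      by (simp add: endo_scale[OF slot_U_endo] ij scaleC_scaleC mult.commute)
  qed
  have "locally_nilpotent TS (mode W a n) \<longleftrightarrow> locally_nilpotent TS (\<lambda>t. \<Sum>i<r. z i powi n *\<^sub>C ?f i t)"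
  proof (rule locally_nilpotent_cong)
    show "mode W a n t \<in> TS" if "t \<in> TS" for t
      unfolding mode_def using endo_mem[OF lie_module_endo[OF lie_module_W]] that by simp
  qed (rule mode_W)
  then show "\<exists>N. (mode W a n ^^ N) t = 0" using nil t by (simp add: locally_nilpotent_def)
qed

text \<open>Multiplying \<open>a(x)\<close> by \<open>\<Prod>(x - z\<^sub>j)\<close> multiplies the contribution of the \<open>j\<close>-th factor by the value of
  the polynomial at \<open>z\<^sub>j\<close>, which is zero.\<close>

lemma in_category_E_W: "in_category_E W"
  unfolding in_category_E_def
proof (intro exI[of _ "node_poly (z ` {..<r})"] conjI allI ballI)
  let ?p = "node_poly (z ` {..<r})"
  show "?p \<noteq> 0" by (auto simp: node_poly_def prod_zero_iff)
  fix a t assume "t \<in> mod_space W"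
  then have t: "t \<in> TS" by simp
  let ?X = "\<lambda>j. slot r V j (mod_act (U j) a) t"
  show "poly_times_series ?p (field_series W a t) = (\<lambda>k. 0)"
  proof
    fix k
    have "poly_times_series ?p (field_series W a t) k =
        poly_comb ?p (\<lambda>i. mode W a (- (k - int i) - 1) t)"
      by (simp add: poly_times_series_def field_series_def poly_comb_def)
    also have "\<dots> = poly_comb ?p (\<lambda>i. \<Sum>j<r. z j ^ i *\<^sub>C z j powi (- k - 1) *\<^sub>C ?X j)"
    proof -
      have "z j powi (- (k - int i) - 1) = z j ^ i * z j powi (- k - 1)" if "j < r" for i j
        using power_int_add[of "z j" "int i" "- k - 1"] z0[OF that] by (simp add: algebra_simps)
      then show ?thesis unfolding mode_W[OF t] by (simp add: scaleC_scaleC)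
    qed
    also have "\<dots> = (\<Sum>j<r. poly_comb ?p (\<lambda>i. z j ^ i *\<^sub>C z j powi (- k - 1) *\<^sub>C ?X j))"
      unfolding poly_comb_def cvec.scale_sum_right by (rule sum.swap)
    also have "\<dots> = 0"
    proof (rule sum.neutral, rule ballI)
      fix j assume "j \<in> {..<r}"
      then have "poly ?p (z j) = 0" by (auto simp: node_poly_def poly_prod)
      then show "poly_comb ?p (\<lambda>i. z j ^ i *\<^sub>C z j powi (- k - 1) *\<^sub>C ?X j) = 0"
        unfolding poly_comb_geometric by simp
    qed
    finally show "poly_times_series ?p (field_series W a t) k = 0" .
  qed
qed

end

section \<open>Linear recurrences\<close>

text \<open>A recurrence whose constant coefficient is nonzero can be solved for its first term, so it runs
  backwards from the nonnegative indices to all of them.\<close>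

lemma recurrence_mem:
  fixes D :: "int \<Rightarrow> 'v::complex_vector"
  assumes S: "cvec.subspace S" and p0: "coeff p 0 \<noteq> 0"
    and rec: "\<And>m. poly_comb p (\<lambda>i. D (m + int i)) = 0" and nonneg: "\<And>n. 0 \<le> n \<Longrightarrow> D n \<in> S"
  shows "D n \<in> S"
proof -
  have "D m \<in> S" if "- int N \<le> m" for N m
    using that
  proof (induction N arbitrary: m)
    case 0
    then show ?case by (intro nonneg) simp
  next
    case (Suc N)
    obtain a q where p: "p = pCons a q" by (cases p)
    have "a *\<^sub>C D m + poly_comb q (\<lambda>i. D (m + int (Suc i))) = 0"
      using rec[of m] unfolding p poly_comb_pCons by simp
    then have "D m = (- 1 / a) *\<^sub>C poly_comb q (\<lambda>i. D (m + int (Suc i)))"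
    proof -
      assume eq: "a *\<^sub>C D m + poly_comb q (\<lambda>i. D (m + int (Suc i))) = 0"
      have "a \<noteq> 0" using p0 p by simp
      then have "D m = (1 / a) *\<^sub>C a *\<^sub>C D m" by (simp add: scaleC_scaleC scaleC_one)
      also have "a *\<^sub>C D m = - poly_comb q (\<lambda>i. D (m + int (Suc i)))" using eq by (simp add:
          eq_neg_iff_add_eq_0)
      finally show ?thesis by simp
    qed
    moreover have "poly_comb q (\<lambda>i. D (m + int (Suc i))) \<in> S"
    proof (rule poly_comb_mem[OF S])
      show "D (m + int (Suc i)) \<in> S" for i using Suc.prems by (intro Suc.IH) simp
    qed
    ultimately show ?case by (simp only: cvec.subspace_scale[OF S])
  qed
  from this[of "nat (- n)" n] show ?thesis by simp
qed

section \<open>The tensor map of commuting families\<close>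

fun chain :: "(nat \<Rightarrow> 'v \<Rightarrow> 'v) \<Rightarrow> nat \<Rightarrow> 'v \<Rightarrow> 'v" where
  "chain T 0 w = w"
| "chain T (Suc k) w = T k (chain T k w)"

lemma chain_endo: "(\<And>j. j < k \<Longrightarrow> endo V (T j)) \<Longrightarrow> endo V (chain T k)"
proof (induction k)
  case 0
  have "chain T 0 = (\<lambda>v. v)" by (rule ext) simp
  then show ?case using endo_ident by simp
next
  case (Suc k)
  have "chain T (Suc k) = (\<lambda>v. T k (chain T k v))" by (rule ext) simp
  then show ?case using endo_compose[of V "T k" "chain T k"] Suc by simp
qed

lemma chain_cong: "(\<And>j. j < k \<Longrightarrow> T j = R j) \<Longrightarrow> chain T k w = chain R k w"
  by (induction k) simp_all

lemma chain_commute: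
  assumes T: "\<And>j. j < k \<Longrightarrow> endo V (T j)" and "\<And>j v. j < k \<Longrightarrow> v \<in> V \<Longrightarrow> S (T j v) = T j (S v)" and w: "w \<in> V"
  shows "S (chain T k w) = chain T k (S w)"
  using assms(1,2)
proof (induction k)
  case (Suc k)
  have "chain T k w \<in> V" using endo_mem[OF chain_endo w] Suc.prems(1) by simp
  then have "S (T k (chain T k w)) = T k (S (chain T k w))" by (intro Suc.prems(2)) simp_all
  then show ?case using Suc by simp
qed simp

lemma chain_extract:
  assumes T: "\<And>j. j < k \<Longrightarrow> endo V (T j)" and i: "i < k"
    and comm: "\<And>j v. j < k \<Longrightarrow> j \<noteq> i \<Longrightarrow> v \<in> V \<Longrightarrow> T i (T j v) = T j (T i v)" and w: "w \<in> V"
  shows "chain T k w = chain (T(i := \<lambda>v. v)) k (T i w)"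
  using i T comm
proof (induction k)
  case (Suc k)
  show ?case
  proof (cases "i = k")
    case True
    have "T k (chain T k w) = chain T k (T k w)"
      by (rule chain_commute[OF _ _ w]) (use Suc.prems True in auto)
    moreover have "chain T k (T k w) = chain (T(i := \<lambda>v. v)) k (T k w)"
      by (rule chain_cong) (use True in auto)
    ultimately show ?thesis unfolding True by (simp only: chain.simps fun_upd_same)
  next
    case False
    then have "i < k" using Suc.prems(1) by simp
    then have "chain T k w = chain (T(i := \<lambda>v. v)) k (T i w)"
      by (rule Suc.IH) (use Suc.prems in auto)
    then show ?thesis
      using False by (simp only: chain.simps fun_upd_other[OF not_sym] not_False_eq_True)
  qed
qed simp

text \<open>A vector \<open>T w\<close> in the orbit of \<open>w\<close> under one family determines \<open>T\<close> on everything obtained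
  from \<open>w\<close> by the other families, because these commute with \<open>T\<close>. So
  \<open>T\<^sub>0 w \<otimes> \<dots> \<otimes> T\<^sub>r\<^sub>-\<^sub>1 w \<mapsto> T\<^sub>r\<^sub>-\<^sub>1 \<dots> T\<^sub>0 w\<close> is well defined and multilinear.\<close>

lemma tensor_of_orbits:
  fixes F :: "nat \<Rightarrow> ('v::complex_vector \<Rightarrow> 'v) set"
  assumes V: "cvec.subspace V" and w: "w \<in> V"
    and F: "\<And>i f. i < r \<Longrightarrow> f \<in> F i \<Longrightarrow> endo V f"
    and comm: "\<And>i j f g v. i < r \<Longrightarrow> j < r \<Longrightarrow> i \<noteq> j \<Longrightarrow> f \<in> F i \<Longrightarrow> g \<in> F j \<Longrightarrow> v \<in> V \<Longrightarrow> f (g v) = g (f v)"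
  defines "Orb \<equiv> \<lambda>i. orbit (F i) w"
  obtains G where "linear_on (tensor_space r Orb) G" "\<And>t. t \<in> tensor_space r Orb \<Longrightarrow> G t \<in> V"
    "G (pure_tensor r Orb (restrict (\<lambda>_. w) {..<r})) = w"
    "\<And>i f t. i < r \<Longrightarrow> f \<in> F i \<Longrightarrow> t \<in> tensor_space r Orb \<Longrightarrow> G (slot r Orb i f t) = f (G t)"
proof -
  let ?P = "Pi\<^sub>E {..<r} Orb"
  have alg: "endo V T" if "i < r" "T \<in> generated_algebra (F i)" for i T
    by (rule generated_algebra_endo[OF that(2) V F[OF that(1)]])
  have acomm: "T (R v) = R (T v)"
    if "i < r" "j < r" "i \<noteq> j" "T \<in> generated_algebra (F i)" "R \<in> generated_algebra (F j)" "v \<in> V" for i j T R v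
    by (rule generated_algebra_commute[OF that(4,5) V F[OF that(1)] F[OF that(2)] _ that(6)])
      (assumption, assumption, rule comm[OF that(1-3)])
  have Orb_V: "Orb i \<subseteq> V" if i: "i < r" for i
    unfolding Orb_def
  proof (rule orbit_subset[OF V])
    show "f v \<in> V" if "f \<in> F i" "v \<in> V" for f v using endo_mem[OF F[OF i that(1)] that(2)] .
  qed (rule w)
  \<comment> \<open>A choice of \<open>T\<close> with \<open>T w = u\<close>. In \<open>g\<close> the choice in position \<open>i\<close> can be pulled out to the right, and
    \<open>C u i\<close> is what remains, so \<open>g\<close> depends on \<open>u i\<close> alone there.\<close>
  define sel where "sel i u = (SOME T. T \<in> generated_algebra (F i) \<and> T w = u)" for i u
  have sel: "sel i u \<in> generated_algebra (F i) \<and> sel i u w = u" if "u \<in> Orb i" for i u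
  proof -
    have "\<exists>T. T \<in> generated_algebra (F i) \<and> T w = u" using that unfolding Orb_def orbit_def by blast
    then show ?thesis unfolding sel_def by (rule someI_ex)
  qed
  define g where "g u = chain (\<lambda>i. sel i (u i)) r w" for u
  define C where "C u i = chain ((\<lambda>i. sel i (u i))(i := \<lambda>v. v)) r" for u i
  have selP: "sel j (u j) \<in> generated_algebra (F j)" "sel j (u j) w = u j" if "u \<in> ?P" "j < r" for u j
    using sel[of "u j" j] that by auto
  have Cop: "endo V (((\<lambda>i. sel i (u i))(i := \<lambda>v. v)) j)" if "u \<in> ?P" "j < r" for u i j
  proof (cases "j = i")
    case True
    then show ?thesis unfolding True fun_upd_same by (intro endo_ident)
  next
    case False
    show ?thesis unfolding fun_upd_other[OF False] by (rule alg[OF that(2) selP(1)[OF that]])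
  qed
  have C_endo: "endo V (C u i)" if "u \<in> ?P" for u i
    unfolding C_def by (rule chain_endo) (rule Cop[OF that])
  have gC: "g u = C u i (u i)" if u: "u \<in> ?P" and i: "i < r" for u i
  proof -
    have "chain (\<lambda>i. sel i (u i)) r w = chain ((\<lambda>i. sel i (u i))(i := \<lambda>v. v)) r (sel i (u i) w)"
    proof (rule chain_extract[OF _ i _ w])
      show "endo V (sel j (u j))" if "j < r" for j using alg[OF that selP(1)[OF u that]] .
      show "sel i (u i) (sel j (u j) v) = sel j (u j) (sel i (u i) v)" if "j < r" "j \<noteq> i" "v \<in> V" for j v
        using acomm[OF i that(1) that(2)[symmetric] selP(1)[OF u i] selP(1)[OF u that(1)] that(3)] .
    qed
    then show ?thesis by (simp only: g_def C_def selP(2)[OF u i])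
  qed
  have Cupd: "C (u(i := v)) i = C u i" for u i v
  proof -
    have "(\<lambda>j. sel j ((u(i := v)) j))(i := \<lambda>v. v) = (\<lambda>j. sel j (u j))(i := \<lambda>v. v)" by (rule ext) simp
    then show ?thesis by (simp only: C_def)
  qed
  have gupd: "g (u(i := v)) = C u i v" if u: "u \<in> ?P" and i: "i < r" and v: "v \<in> Orb i" for u i v
    using gC[OF PiE_lessThan_upd[OF u i v] i] by (simp only: Cupd fun_upd_same)
  have mult: "multilinear r Orb g"
    unfolding multilinear_def
  proof (intro ballI allI impI)
    fix u i assume u: "u \<in> ?P" and i: "i < r"
    have lin: "linear_on (Orb i) (C u i)" by (rule linear_on_subset[OF endo_linear[OF C_endo[OF u]]
        Orb_V[OF i]])
    have sub: "cvec.subspace (Orb i)" unfolding Orb_def by (rule subspace_orbit)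
    show "linear_on (Orb i) (\<lambda>v. g (u(i := v)))"
    proof (rule linear_onI)
      fix x y assume "x \<in> Orb i" "y \<in> Orb i"
      then show "g (u(i := x + y)) = g (u(i := x)) + g (u(i := y))"
        using gupd[OF u i] linear_on_add[OF lin] cvec.subspace_add[OF sub] by simp
    next
      fix c x assume "x \<in> Orb i"
      then show "g (u(i := c *\<^sub>C x)) = c *\<^sub>C g (u(i := x))"
        using gupd[OF u i] linear_on_scale[OF lin] cvec.subspace_scale[OF sub] by simp
    qed
  qed
  obtain G where G: "linear_on (tensor_space r Orb) G" "\<forall>u\<in>?P. G (pure_tensor r Orb u) = g u"
    using tensor_universal[OF mult] by blast
  have Orb_endo: "endo (Orb i) f" if i: "i < r" and f: "f \<in> F i" for i f
  proof (rule endo_subset[OF F[OF i f] Orb_V[OF i]])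
    show "f v \<in> Orb i" if "v \<in> Orb i" for v using orbit_closed[OF f] that unfolding Orb_def .
  qed
  have gV: "g u \<in> V" if "u \<in> ?P" for u
    unfolding g_def by (rule endo_mem[OF chain_endo w]) (rule alg[OF _ selP(1)[OF that]])
  have GV: "G t \<in> V" if "t \<in> tensor_space r Orb" for t
    using G(1) that unfolding tensor_space_def
    by (rule span_closed_under) (use G(2) gV V in auto)
  show thesis
  proof (rule that[OF G(1)])
    show "G t \<in> V" if "t \<in> tensor_space r Orb" for t by (rule GV[OF that])
    have w0: "restrict (\<lambda>_. w) {..<r} \<in> ?P" by (auto simp: Orb_def orbit_self)
    have "chain (\<lambda>i. sel i (restrict (\<lambda>_. w) {..<r} i)) k w = w" if "k \<le> r" for k
      using that
    proof (induction k)
      case (Suc k)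
      then have "sel k (restrict (\<lambda>_. w) {..<r} k) w = w" using selP(2)[OF w0, of k] by simp
      then show ?case using Suc by simp
    qed simp
    then show "G (pure_tensor r Orb (restrict (\<lambda>_. w) {..<r})) = w"
      using G(2) w0 by (simp add: g_def)
  next
    fix i f t assume i: "i < r" and f: "f \<in> F i" and t: "t \<in> tensor_space r Orb"
    show "G (slot r Orb i f t) = f (G t)"
    proof (rule tensor_linear_unique[OF _ _ _ t])
      show "linear_on (tensor_space r Orb) (\<lambda>t. G (slot r Orb i f t))"
        by (rule linear_on_compose[OF linear_on_slot _ G(1)])
          (rule endo_mem[OF slot_endo[where V = Orb, OF i Orb_endo[OF i f]]])
      show "linear_on (tensor_space r Orb) (\<lambda>t. f (G t))"
        by (rule linear_on_compose[OF G(1) GV endo_linear[OF F[OF i f]]])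
      fix u assume u: "u \<in> ?P"
      have ui: "u i \<in> Orb i" using u i by auto
      have "G (slot r Orb i f (pure_tensor r Orb u)) = G (pure_tensor r Orb (u(i := f (u i))))"
        by (simp only: slot_pure[where V = Orb, OF i Orb_endo[OF i f] u])
      also have "\<dots> = g (u(i := f (u i)))"
        using G(2) slot_pure_mem[where V = Orb, OF i Orb_endo[OF i f] u] by blast
      also have "\<dots> = C u i (f (u i))" by (rule gupd[OF u i endo_mem[OF Orb_endo[OF i f] ui]])
      also have "\<dots> = f (C u i (u i))"
        unfolding C_def
      proof (rule chain_commute[OF Cop[OF u], symmetric])
        fix j v assume j: "j < r" and v: "v \<in> V"
        show "f (((\<lambda>i. sel i (u i))(i := \<lambda>v. v)) j v) = ((\<lambda>i. sel i (u i))(i := \<lambda>v. v)) j (f v)"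
        proof (cases "j = i")
          case False
          then show ?thesis
            using acomm[OF i j _ generated_algebra_base[OF f] selP(1)[OF u j] v] by simp
        qed simp
      qed (use ui Orb_V[OF i] in auto)
      also have "\<dots> = f (G (pure_tensor r Orb u))" using gC[OF u i] G(2) u by simp
      finally show "G (slot r Orb i f (pure_tensor r Orb u)) = f (G (pure_tensor r Orb u))" .
    qed
  qed
qed

section \<open>Irreducible integrable modules in the category\<close>

text \<open>Schur's lemma: the kernel and the image of \<open>G\<close> are submodules.\<close>

lemma module_iso_of_nonzero_hom:
  assumes M: "lie_module B M" "irreducible_module M" and N: "lie_module B N" "irreducible_module N"
    and G: "linear_on (mod_space N) G" "\<And>t. t \<in> mod_space N \<Longrightarrow> G t \<in> mod_space M"
    and hom: "\<And>X t. t \<in> mod_space N \<Longrightarrow> G (mod_act N X t) = mod_act M X (G t)"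
    and nz: "s \<in> mod_space N" "G s \<noteq> 0"
  shows "module_iso M N"
proof -
  let ?M = "mod_space M" and ?N = "mod_space N"
  note Me = lie_module_endo[OF M(1)] and Ne = lie_module_endo[OF N(1)]
  have Ms: "cvec.subspace ?M" and Ns: "cvec.subspace ?N"
    using lie_module_subspace M(1) N(1) by blast+
  have irrM: "irreducible_under (range (mod_act M)) ?M" and irrN: "irreducible_under (range (mod_act N)) ?N"
    using M(2) N(2) by (simp_all add: irreducible_module_iff)
  have "G ` ?N = {0} \<or> G ` ?N = ?M"
  proof (rule irreducible_underD[OF irrM subspace_image_on[OF Ns G(1)]])
    show "G ` ?N \<subseteq> ?M" using G(2) by blast
    show "\<forall>f\<in>range (mod_act M). \<forall>v\<in>G ` ?N. f v \<in> G ` ?N"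
    proof clarify
      fix X t assume t: "t \<in> ?N"
      have "mod_act M X (G t) = G (mod_act N X t)" by (rule hom[OF t, symmetric])
      then show "mod_act M X (G t) \<in> G ` ?N" using endo_mem[OF Ne t] by (rule image_eqI)
    qed
  qed
  then have surj: "G ` ?N = ?M" using nz by auto
  let ?K = "{t \<in> ?N. G t = 0}"
  have "?K = {0} \<or> ?K = ?N"
  proof (rule irreducible_underD[OF irrN subspace_kernel_on[OF Ns G(1)]])
    show "\<forall>f\<in>range (mod_act N). \<forall>v\<in>?K. f v \<in> ?K"
    proof clarify
      fix X t assume t: "t \<in> ?N" "G t = 0"
      then show "mod_act N X t \<in> ?N \<and> G (mod_act N X t) = 0"
        using hom[OF t(1), of X] endo_mem[OF Ne t(1)] endo_zero[OF Me Ms] by simp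
    qed
  qed auto
  then have ker: "?K = {0}" using nz by auto
  have inj: "inj_on G ?N"
  proof (rule inj_onI)
    fix s t assume st: "s \<in> ?N" "t \<in> ?N" "G s = G t"
    then have "s - t \<in> ?K" using linear_on_diff[OF G(1) Ns] cvec.subspace_diff[OF Ns] by simp
    then show "s = t" using ker by simp
  qed
  define J where "J = inv_into ?N G"
  have J: "J v \<in> ?N" "G (J v) = v" if "v \<in> ?M" for v
    using that surj unfolding J_def by (auto intro: inv_into_into f_inv_into_f)
  have JI: "J v = t" if "t \<in> ?N" "G t = v" for v t
    using inv_into_f_f[OF inj that(1)] that(2) by (simp add: J_def)
  show ?thesis
    unfolding module_iso_def
  proof (intro exI[of _ J] conjI allI ballI)
    show "bij_betw J ?M ?N"
      using bij_betw_inv_into[of G ?N ?M] inj surj by (simp add: J_def bij_betw_def)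
    show "linear_on ?M J"
    proof (rule linear_onI)
      fix x y assume xy: "x \<in> ?M" "y \<in> ?M"
      show "J (x + y) = J x + J y"
        by (rule JI) (simp_all add: J xy cvec.subspace_add[OF Ns] linear_on_add[OF G(1)])
    next
      fix c x assume x: "x \<in> ?M"
      show "J (c *\<^sub>C x) = c *\<^sub>C J x"
        by (rule JI) (simp_all add: J x cvec.subspace_scale[OF Ns] linear_on_scale[OF G(1)])
    qed
    fix X v assume v: "v \<in> ?M"
    show "J (mod_act M X v) = mod_act N X (J v)"
      by (rule JI) (simp_all add: J v hom endo_mem[OF Ne])
  qed
qed

lemma in_category_E_recurrence:
  assumes "in_category_E W"
  obtains p where "p \<noteq> 0"
    "\<And>a v m. v \<in> mod_space W \<Longrightarrow> poly_comb p (\<lambda>i. mode W a (m + int i) v) = 0"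
proof -
  obtain p where p: "p \<noteq> 0"
    "\<And>a w. w \<in> mod_space W \<Longrightarrow> poly_times_series p (field_series W a w) = (\<lambda>k. 0)"
    using assms unfolding in_category_E_def by blast
  have "poly_comb p (\<lambda>i. mode W a (m + int i) v) = 0" if "v \<in> mod_space W" for a v m
  proof -
    have "poly_comb p (\<lambda>i. mode W a (m + int i) v) = poly_times_series p (field_series W a v) (- m - 1)"
      by (simp add: poly_comb_def poly_times_series_def field_series_def algebra_simps)
    then show ?thesis by (simp only: p(2)[OF that])
  qed
  with p(1) show thesis by (rule that)
qed

text \<open>The polynomial may be chosen with a nonzero constant term, since multiplying a series by \<open>x\<close> only
  shifts it, and with a root, which ensures that there is at least one node.\<close>

lemma normalize_recurrence:
  assumes "p \<noteq> 0" and rec: "\<And>x m. x \<in> I \<Longrightarrow> poly_comb p (\<lambda>i. D x (m + int i)) = 0"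
  obtains q where "coeff q 0 \<noteq> 0" "poly q 1 = 0"
    "\<And>x m. x \<in> I \<Longrightarrow> poly_comb q (\<lambda>i. D x (m + int i)) = 0"
proof -
  obtain s where s: "p = [:- 0, 1:] ^ order 0 p * s" "\<not> [:- 0, 1:] dvd s"
    using order_decomp[OF assms(1)] by blast
  have "p = monom 1 (order 0 p) * s" using s(1) by (simp add: monom_altdef)
  then have srec: "poly_comb s (\<lambda>i. D x (m + int i)) = 0" if "x \<in> I" for x m
  proof -
    assume p: "p = monom 1 (order 0 p) * s"
    have "poly_comb p (\<lambda>i. D x (m - int (order 0 p) + int i)) = 0" by (rule rec[OF that])
    then show ?thesis
      by (subst (asm) p) (simp add: poly_comb_mult poly_comb_monom scaleC_one algebra_simps)
  qed
  have "poly s 0 \<noteq> 0" using s(2) by (simp add: poly_eq_0_iff_dvd)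
  let ?q = "[:- 1, 1:] * s"
  show thesis
  proof (rule that[of ?q])
    have "poly ?q 0 \<noteq> 0" using \<open>poly s 0 \<noteq> 0\<close> by simp
    then show "coeff ?q 0 \<noteq> 0" unfolding poly_0_coeff_0 .
    show "poly ?q 1 = 0" by simp
    fix x m assume x: "x \<in> I"
    have "poly_comb s (\<lambda>j. D x (m + int (i + j))) = 0" for i
      using srec[OF x, of "m + int i"] by (simp add: add.assoc)
    then show "poly_comb ?q (\<lambda>i. D x (m + int i)) = 0"
      unfolding poly_comb_mult by (simp add: poly_comb_def)
  qed
qed

lemma form_zero:
  assumes "lie_algebra br" "\<And>x y. form x y = c * killing_form br x y"
  shows "form 0 x = 0" "form x 0 = 0"
proof -
  interpret lie_algebra br by fact
  have "killing_form br 0 x = 0" "killing_form br x 0 = 0"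
    by (simp_all add: killing_form_def endo_trace_def Let_def br_zero_left br_zero_right
        cvec.representation_zero)
  then show "form 0 x = 0" "form x 0 = 0" using assms(2) by simp_all
qed

lemma mode_bracket:
  assumes "lie_algebra br" and form0: "\<And>x. form 0 x = 0" "\<And>x. form x 0 = 0"
    and W: "lie_module (affine_bracket br form) W" and v: "v \<in> mod_space W"
  shows "mode W a m (mode W b n v) - mode W b n (mode W a m v) =
    mode W (br a b) (m + n) v + (if m + n = 0 then of_int m * form a b else 0) *\<^sub>C mod_act W (0, 1) v"
proof -
  note lin = lie_module_linear[OF W v]
  have "affine_bracket br form (loop_elem a m) (loop_elem b n) =
      loop_elem (br a b) (m + n) + (if m + n = 0 then of_int m * form a b else 0) *\<^sub>C (0, 1)"
    unfolding affine_bracket_loop_elem[OF assms(1), of form, OF form0]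
    by (simp add: loop_elem_def scaleC_prod_def scaleC_complex_def)
  then show ?thesis
    using lie_module_br[OF W v, of "loop_elem a m" "loop_elem b n"]
    by (simp add: mode_def linear_on_add[OF lin] linear_on_scale[OF lin])
qed

text \<open>The commutator of the series \<open>p(x) a(x) = 0\<close> with \<open>b(n)\<close> isolates \<open>\<langle>a, b\<rangle> \<^bold>k\<close>.\<close>

lemma level_zero:
  assumes "lie_algebra br" and form0: "\<And>x. form 0 x = 0" "\<And>x. form x 0 = 0" and ab: "form a b \<noteq> 0"
    and W: "lie_module (affine_bracket br form) W" and p: "p \<noteq> 0"
    and rec: "\<And>a v m. v \<in> mod_space W \<Longrightarrow> poly_comb p (\<lambda>i. mode W a (m + int i) v) = 0"
    and v: "v \<in> mod_space W"
  shows "mod_act W (0, 1) v = 0"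
proof -
  let ?d = "degree p" and ?k = "mod_act W (0, 1) v"
  have Wsub: "cvec.subspace (mod_space W)" by (rule lie_module_subspace[OF W])
  note We = lie_module_endo[OF W]
  have me: "endo (mod_space W) (mode W a n)" for a n unfolding mode_def by (rule We)
  note br = mode_bracket[OF assms(1), of form, OF form0 W v]
  \<comment> \<open>With \<open>n = - 1\<close> and this range of \<open>m\<close>, the central term occurs for the leading coefficient of \<open>p\<close>
    only, there with \<open>m = 1\<close>.\<close>
  let ?m = "\<lambda>i. 1 - int ?d + int i"
  have "0 = poly_comb p (\<lambda>i. mode W a (?m i) (mode W b (- 1) v)) -
      mode W b (- 1) (poly_comb p (\<lambda>i. mode W a (?m i) v))"
    using rec[OF v] rec[OF endo_mem[OF me v]] endo_zero[OF me Wsub] by simp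
  also have "mode W b (- 1) (poly_comb p (\<lambda>i. mode W a (?m i) v)) =
      poly_comb p (\<lambda>i. mode W b (- 1) (mode W a (?m i) v))"
    by (rule linear_on_poly_comb[OF endo_linear[OF me] Wsub endo_mem[OF me v]])
  also have "poly_comb p (\<lambda>i. mode W a (?m i) (mode W b (- 1) v)) - \<dots> =
      poly_comb p (\<lambda>i. mode W (br a b) (?m i + - 1) v +
        (if ?m i + - 1 = 0 then of_int (?m i) * form a b else 0) *\<^sub>C ?k)"
    unfolding poly_comb_minus[symmetric] br ..
  also have "\<dots> = poly_comb p (\<lambda>i. mode W (br a b) (- int ?d + int i) v) +
      poly_comb p (\<lambda>i. (if i = ?d then form a b else 0) *\<^sub>C ?k)"
    unfolding poly_comb_plus
    by (intro arg_cong2[of _ _ _ _ "(+)"] arg_cong[of _ _ "poly_comb p"] ext) auto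
  also have "\<dots> = poly_comb p (\<lambda>i. (if i = ?d then form a b else 0) *\<^sub>C ?k)"
    by (simp only: rec[OF v] add_0_left)
  also have "\<dots> = (\<Sum>i\<le>?d. if i = ?d then (coeff p i * form a b) *\<^sub>C ?k else 0)"
    unfolding poly_comb_def by (intro sum.cong) (auto simp: scaleC_scaleC)
  also have "\<dots> = (lead_coeff p * form a b) *\<^sub>C ?k" by simp
  finally show ?thesis using p ab by (simp add: eq_commute[of 0])
qed

text \<open>The factors are realized inside \<open>W\<close> itself, as the orbits of one vector under the copies of \<open>\<gg>\<close> at
  the nodes.\<close>

lemma evaluation_tensor_of_irreducible:
  fixes br :: "'g::complex_vector \<Rightarrow> 'g \<Rightarrow> 'g" and form :: "'g \<Rightarrow> 'g \<Rightarrow> complex"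
    and W :: "('g affine, 'w::complex_vector) lie_mod"
  assumes simple: "simple_lie_algebra br" and fd: "finite_dim (UNIV :: 'g set)"
    and tor: "toral br H" and norm: "normalized_form br H form"
    and W: "lie_module (affine_bracket br form) W" "irreducible_module W" "integrable_module br H W"
        "in_category_E W"
  shows "\<exists>r (U :: nat \<Rightarrow> ('g, 'w) lie_mod) z. r \<ge> 1 \<and>
    (\<forall>i<r. lie_module br (U i) \<and> irreducible_module (U i) \<and> finite_dim (mod_space (U i))) \<and>
    (\<forall>i<r. z i \<noteq> 0) \<and> inj_on z {..<r} \<and>
    module_iso W (tensor_module r (\<lambda>i. evaluation_module (U i) (z i)))"
proof -
  let ?V = "mod_space W"
  have lie: "lie_algebra br" using simple by (simp add: simple_lie_algebra_def)
  have V: "cvec.subspace ?V" by (rule lie_module_subspace[OF W(1)])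
  have me: "endo ?V (mode W a n)" for a n unfolding mode_def by (rule lie_module_endo[OF W(1)])
  obtain c where c: "\<And>x y. form x y = c * killing_form br x y"
    using norm unfolding normalized_form_def by blast
  note form0 = form_zero[OF lie, of form, OF c]
  obtain \<alpha> where \<alpha>: "\<alpha> \<in> roots br H" "squared_length form H \<alpha> = 2"
    using norm unfolding normalized_form_def by blast
  then have ne: "roots br H \<noteq> {}" by blast
  \<comment> \<open>A root of squared length 2 shows that the form is nonzero.\<close>
  define t where "t = dual_element form H \<alpha>"
  have tt: "form t t \<noteq> 0" using \<alpha>(2) by (simp add: squared_length_def t_def)
  obtain p0 where p0: "p0 \<noteq> 0"
    and rec0: "\<And>a v m. v \<in> ?V \<Longrightarrow> poly_comb p0 (\<lambda>i. mode W a (m + int i) v) = 0"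
    by (rule in_category_E_recurrence[OF W(4)]) blast
  have central: "mod_act W (0, 1) v = 0" if "v \<in> ?V" for v
    by (rule level_zero[OF lie, of form, OF form0 tt W(1) p0 rec0 that])
  have act: "mod_act W X v = (\<Sum>n\<in>Poly_Mapping.keys (fst X). mode W (Poly_Mapping.lookup (fst X) n) n v)"
    if "v \<in> ?V" for X v
    using affine_act[OF W(1) that, of X] central[OF that] by simp
  obtain p where p: "coeff p 0 \<noteq> 0" "poly p 1 = 0"
    and rec': "\<And>x m. x \<in> {x. snd x \<in> ?V} \<Longrightarrow> poly_comb p (\<lambda>i. mode W (fst x) (m + int i) (snd x)) = 0"
    by (rule normalize_recurrence[of p0 "{x. snd x \<in> ?V}" "\<lambda>x n. mode W (fst x) n (snd x)", OF p0])
      (use rec0 in auto)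
  have rec: "poly_comb p (\<lambda>i. mode W a (m + int i) v) = 0" if "v \<in> ?V" for a v m
    using rec'[of "(a, v)" m] that by simp
  have mode_mem: "mode W a n v \<in> S"
    if "cvec.subspace S" "v \<in> ?V" "\<And>m. mode W a (int m) v \<in> S" for S a n v
  proof (rule recurrence_mem[OF that(1) p(1) rec[OF that(2)]])
    fix n :: int assume "0 \<le> n"
    then show "mode W a n v \<in> S" using that(3)[of "nat n"] by simp
  qed
  interpret cm: current_module br H ?V "\<lambda>a n. mode W a (int n)" p
  proof (unfold_locales; (fact simple fd tor ne V me)?)
    show "p \<noteq> 0" using p(1) by auto
    show "poly_comb p (\<lambda>i. mode W a (int (n + i)) v) = 0" if "v \<in> ?V" for a n v
      using rec[OF that, of a "int n"] by simp
    show "linear_on UNIV (\<lambda>a. mode W a (int n) v)" if "v \<in> ?V" for v n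
      by (rule mode_linear[OF W(1) that])
    show "mode W (br a b) (int (m + n)) v =
        mode W a (int m) (mode W b (int n) v) - mode W b (int n) (mode W a (int m) v)"
      if "v \<in> ?V" for a b m n v
      using mode_bracket[OF lie, of form, OF form0 W(1) that, of a "int m" b "int n"] central[OF that] by simp
    show "locally_nilpotent ?V (mode W a (int n))" if a: "a \<in> root_vectors br H" for a n
    proof (cases "a = 0")
      case True
      have "mode W 0 (int n) v = 0" if "v \<in> ?V" for v
        using linear_on_zero[OF mode_linear[OF W(1) that] cvec.subspace_UNIV] .
      then have "(mode W a (int n) ^^ 1) v = 0" if "v \<in> ?V" for v using True that by simp
      then show ?thesis unfolding locally_nilpotent_def by blast
    next
      case False
      obtain l where l: "nonvanishing H l" "a \<in> root_space br H l" using a by (auto simp: root_vectors_def)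
      have H: "cvec.subspace H" using tor by (simp add: toral_def)
      note lie_algebra.root_space_is_root[OF lie H l False]
      then show ?thesis using W(3) unfolding integrable_module_def locally_nilpotent_def by blast
    qed
    show "irreducible_under {mode W a (int n) |a n. True} ?V"
      unfolding irreducible_under_def
    proof (intro conjI allI impI)
      show "?V \<noteq> {0}" using W(2) by (simp add: irreducible_module_def)
      fix S assume S: "cvec.subspace S \<and> S \<subseteq> ?V \<and> (\<forall>f\<in>{mode W a (int n) |a n. True}. \<forall>v\<in>S. f v \<in> S)"
      note Ssub = conjunct1[OF S] and SV = conjunct1[OF conjunct2[OF S]] and Smode = conjunct2[OF
          conjunct2[OF S]]
      have nat_mode: "mode W a (int m) v \<in> S" if "v \<in> S" for a m v
      proof -
        have "mode W a (int m) \<in> {mode W a (int n) |a n. True}" by blast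
        from bspec[OF bspec[OF Smode this] that] show ?thesis .
      qed
      have "mode W a n v \<in> S" if "v \<in> S" for a n v
        by (rule mode_mem[OF Ssub subsetD[OF SV that] nat_mode[OF that]])
      then have act_mem: "mod_act W X v \<in> S" if "v \<in> S" for X v
        unfolding act[OF subsetD[OF SV that]] using that by (intro cvec.subspace_sum[OF Ssub])
      show "S = {0} \<or> S = ?V"
        by (rule irreducible_underD[OF W(2)[unfolded irreducible_module_iff] Ssub SV]) (clarify, rule act_mem)
    qed
  qed
  have nodes: "finite cm.nodes" "1 \<in> cm.nodes" "0 \<notin> cm.nodes"
    using cm.finite_nodes p by (simp_all add: cm.nodes_def poly_0_coeff_0)
  have mode_nodes: "mode W a n v = (\<Sum>z\<in>cm.nodes. z powi n *\<^sub>C cm.node_act z a v)" if v: "v \<in> ?V" for a n v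
  proof -
    let ?X = "\<lambda>z. cm.node_act z a v"
    let ?D = "\<lambda>n. mode W a n v - (\<Sum>z\<in>cm.nodes. z powi n *\<^sub>C ?X z)"
    have "?D n \<in> {0}"
    proof (rule recurrence_mem[OF cvec.subspace_single_0 p(1)])
      fix m :: int
      have "z powi (m + int i) = z ^ i * z powi m" if "z \<in> cm.nodes" for z i
        using nodes(3) that power_int_add[of z "int i" m] by (auto simp: add.commute)
      then have "poly_comb p (\<lambda>i. \<Sum>z\<in>cm.nodes. z powi (m + int i) *\<^sub>C ?X z) =
          poly_comb p (\<lambda>i. \<Sum>z\<in>cm.nodes. z ^ i *\<^sub>C z powi m *\<^sub>C ?X z)"
        by (simp add: scaleC_scaleC)
      also have "\<dots> = (\<Sum>z\<in>cm.nodes. poly_comb p (\<lambda>i. z ^ i *\<^sub>C z powi m *\<^sub>C ?X z))"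
        unfolding poly_comb_def cvec.scale_sum_right by (rule sum.swap)
      also have "\<dots> = 0"
        unfolding poly_comb_geometric by (intro sum.neutral) (simp add: cm.nodes_def)
      finally show "poly_comb p (\<lambda>i. ?D (m + int i)) = 0"
        unfolding poly_comb_minus rec[OF v] by simp
    next
      fix n :: int assume "0 \<le> n"
      then show "?D n \<in> {0}" using cm.act_nodes[OF v, of a "nat n"] by (simp add: power_int_def)
    qed
    then show ?thesis by simp
  qed
  have Vne: "?V \<noteq> {0}" using W(2) by (simp add: irreducible_module_def)
  have node_comm: "cm.node_act z a (cm.node_act w b v) = cm.node_act w b (cm.node_act z a v)"
    if "z \<in> cm.nodes" "w \<in> cm.nodes" "z \<noteq> w" "v \<in> ?V" for z w a b v
    using cm.node_act_br[OF that(4,1,2), of a b] that(3) by simp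
  obtain w0 where w0: "w0 \<in> ?V" "w0 \<noteq> 0"
    and irr: "\<And>z. z \<in> cm.nodes \<Longrightarrow> irreducible_under (range (cm.node_act z)) (orbit (range (cm.node_act z)) w0)"
  proof (rule vector_with_irreducible_orbits[of ?V cm.nodes "\<lambda>z. range (cm.node_act z)"])
    show "endo ?V f" if "f \<in> range (cm.node_act z)" for z f using that cm.node_act_endo by auto
    show "f (g v) = g (f v)" if "z \<in> cm.nodes" "w \<in> cm.nodes" "z \<noteq> w" "f \<in> range (cm.node_act z)"
      "g \<in> range (cm.node_act w)" "v \<in> ?V" for z w f g v
      using that node_comm by auto
  qed (use V cm.finite_dim_module Vne nodes(1) in auto)
  define r where "r = card cm.nodes"
  have "r \<ge> 1" unfolding r_def using nodes card_gt_0_iff[of cm.nodes] by (simp add: Suc_le_eq) blast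
  obtain e where e: "bij_betw e {..<r} cm.nodes"
    using ex_bij_betw_nat_finite[OF nodes(1)] by (auto simp: r_def atLeast0LessThan)
  have eZ: "e i \<in> cm.nodes" if "i < r" for i using bij_betwE[OF e] that by auto
  have einj: "inj_on e {..<r}" using e by (simp add: bij_betw_def)
  define F where "F i = range (cm.node_act (e i))" for i
  define U :: "nat \<Rightarrow> ('g, 'w) lie_mod" where
    "U i = \<lparr>mod_space = orbit (F i) w0, mod_act = cm.node_act (e i)\<rparr>" for i
  have Usp: "mod_space (U i) = orbit (F i) w0" and Uact: "mod_act (U i) = cm.node_act (e i)" for i
    by (simp_all add: U_def)
  have UV: "mod_space (U i) \<subseteq> ?V" for i
    unfolding Usp
  proof (rule orbit_subset[OF V _ w0(1)])
    show "f v \<in> ?V" if "f \<in> F i" "v \<in> ?V" for f v using that cm.node_act_mem by (auto simp: F_def)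
  qed
  have Umod: "lie_module br (U i)" if i: "i < r" for i
    unfolding lie_module_def
  proof (intro conjI allI ballI)
    show "cvec.subspace (mod_space (U i))" unfolding Usp by (rule subspace_orbit)
    show "mod_act (U i) x v \<in> mod_space (U i)" if "v \<in> mod_space (U i)" for x v
      using that orbit_closed[of "cm.node_act (e i) x" "F i" v w0] unfolding Usp Uact by (simp add: F_def)
    show "linear_on (mod_space (U i)) (mod_act (U i) x)" for x
      unfolding Uact by (rule linear_on_subset[OF endo_linear[OF cm.node_act_endo] UV])
    show "linear_on UNIV (\<lambda>x. mod_act (U i) x v)" if "v \<in> mod_space (U i)" for v
      unfolding Uact by (rule cm.node_act_linear[OF subsetD[OF UV that]])
    show "mod_act (U i) (br x y) v = mod_act (U i) x (mod_act (U i) y v) - mod_act (U i) y (mod_act (U i) x v)"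
      if "v \<in> mod_space (U i)" for x y v
      using cm.node_act_br[OF subsetD[OF UV that] eZ[OF i] eZ[OF i], of x y] unfolding Uact by simp
  qed
  have Uirr: "irreducible_module (U i)" if i: "i < r" for i
    using irr[OF eZ[OF i]] unfolding irreducible_module_iff Usp Uact F_def .
  have Ufd: "finite_dim (mod_space (U i))" for i
    by (rule finite_dim_subspace[OF cm.finite_dim_module _ UV]) (simp add: Usp subspace_orbit)
  have e0: "e i \<noteq> 0" if "i < r" for i using eZ[OF that] nodes(3) by auto
  interpret ev: evaluation_tensor br r U e
    by unfold_locales (simp_all add: Umod Uirr Ufd e0 einj)
  obtain G where G: "linear_on ev.TS G" "\<And>t. t \<in> ev.TS \<Longrightarrow> G t \<in> ?V"
    "G (pure_tensor r ev.V (restrict (\<lambda>_. w0) {..<r})) = w0"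
    and Gslot: "\<And>i f t. i < r \<Longrightarrow> f \<in> F i \<Longrightarrow> t \<in> ev.TS \<Longrightarrow> G (slot r ev.V i f t) = f (G t)"
  proof (rule tensor_of_orbits[of ?V w0 r F, folded Usp, OF V w0(1)])
    show "endo ?V f" if "f \<in> F i" for i f using that cm.node_act_endo by (auto simp: F_def)
    show "f (g v) = g (f v)" if "i < r" "j < r" "i \<noteq> j" "f \<in> F i" "g \<in> F j" "v \<in> ?V" for i j f g v
      using that node_comm[OF eZ[OF that(1)] eZ[OF that(2)]] inj_onD[OF einj, of i j] by (auto simp: F_def)
  qed blast
  have Gmode: "G (mode ev.W a n t) = mode W a n (G t)" if t: "t \<in> ev.TS" for a n t
  proof -
    have Gi: "G (slot r ev.V i (mod_act (U i) a) t) = cm.node_act (e i) a (G t)" if "i < r" for i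
      unfolding Uact by (rule Gslot[OF that _ t]) (simp add: F_def)
    have mem: "slot r ev.V i (mod_act (U i) a) t \<in> ev.TS" if "i < r" for i
      by (rule endo_mem[OF ev.slot_U_endo[OF that] t])
    have "G (mode ev.W a n t) = (\<Sum>i<r. G (e i powi n *\<^sub>C slot r ev.V i (mod_act (U i) a) t))"
      unfolding ev.mode_W[OF t] using mem
      by (intro linear_on_sum[OF G(1) subspace_tensor_space] cvec.subspace_scale[OF subspace_tensor_space]) simp
    also have "\<dots> = (\<Sum>i<r. e i powi n *\<^sub>C cm.node_act (e i) a (G t))"
      by (intro sum.cong refl) (simp add: linear_on_scale[OF G(1) mem] Gi)
    also have "\<dots> = (\<Sum>z\<in>cm.nodes. z powi n *\<^sub>C cm.node_act z a (G t))"
      by (rule sum.reindex_bij_betw[OF e])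
    finally show ?thesis using mode_nodes[OF G(2)[OF t]] by simp
  qed
  have "module_iso W ev.W"
  proof (rule module_iso_of_nonzero_hom[OF W(1,2) ev.lie_module_W ev.irreducible_W])
    show "linear_on (mod_space ev.W) G" using G(1) by simp
    show "G t \<in> ?V" if "t \<in> mod_space ev.W" for t using G(2) that by simp
    show "G (mod_act ev.W X t) = mod_act W X (G t)" if "t \<in> mod_space ev.W" for X t
    proof -
      have t: "t \<in> ev.TS" using that by simp
      have mem: "mode ev.W a n t \<in> ev.TS" for a n
        unfolding mode_def using endo_mem[OF lie_module_endo[OF ev.lie_module_W] that] by simp
      have "mod_act ev.W X t = (\<Sum>n\<in>Poly_Mapping.keys (fst X). mode ev.W (Poly_Mapping.lookup (fst X) n) n t)"
        using affine_act[OF ev.lie_module_W that, of X] ev.central_W[OF t] by simp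
      then have "G (mod_act ev.W X t) = (\<Sum>n\<in>Poly_Mapping.keys (fst X). G (mode ev.W
          (Poly_Mapping.lookup (fst X) n) n t))"
        using linear_on_sum[OF G(1) subspace_tensor_space mem] by simp
      then show ?thesis unfolding Gmode[OF t] act[OF G(2)[OF t]] .
    qed
    show "pure_tensor r ev.V (restrict (\<lambda>_. w0) {..<r}) \<in> mod_space ev.W"
      unfolding ev.mod_space_W by (rule pure_tensor_mem) (auto simp: Usp orbit_self)
    show "G (pure_tensor r ev.V (restrict (\<lambda>_. w0) {..<r})) \<noteq> 0" using G(3) w0(2) by simp
  qed
  then show ?thesis
    using \<open>r \<ge> 1\<close> Umod Uirr Ufd e0 einj by blast
qed

theorem proposition3p21:
  fixes br :: "'g::complex_vector \<Rightarrow> 'g \<Rightarrow> 'g"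
    and form :: "'g \<Rightarrow> 'g \<Rightarrow> complex"
    and H :: "'g set"
  assumes "simple_lie_algebra br"
    and "finite_dim (UNIV :: 'g set)"
    and "cartan_subalgebra br H"
    and "normalized_form br H form"
  shows
    "(\<forall>W :: ('g affine, 'w::complex_vector) lie_mod.
        lie_module (affine_bracket br form) W \<and> irreducible_module W \<and>
        integrable_module br H W \<and> in_category_E W \<longrightarrow>
        (\<exists>r (U :: nat \<Rightarrow> ('g, 'w) lie_mod) z.
          r \<ge> 1 \<and>
          (\<forall>i<r. lie_module br (U i) \<and> irreducible_module (U i) \<and> finite_dim (mod_space (U i))) \<and>
          (\<forall>i<r. z i \<noteq> 0) \<and> inj_on z {..<r} \<and>
          module_iso W (tensor_module r (\<lambda>i. evaluation_module (U i) (z i))))) \<and>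
     (\<forall>r (U :: nat \<Rightarrow> ('g, 'u::complex_vector) lie_mod) z.
        r \<ge> 1 \<and>
        (\<forall>i<r. lie_module br (U i) \<and> irreducible_module (U i) \<and> finite_dim (mod_space (U i))) \<and>
        (\<forall>i<r. z i \<noteq> 0) \<and> inj_on z {..<r} \<longrightarrow>
        (let W = tensor_module r (\<lambda>i. evaluation_module (U i) (z i)) in
          lie_module (affine_bracket br form) W \<and> irreducible_module W \<and>
          integrable_module br H W \<and> in_category_E W))"
proof (intro conjI allI impI)
  have tor: "toral br H" using assms(3) by (simp add: cartan_subalgebra_def)
  fix W :: "('g affine, 'w) lie_mod"
  assume "lie_module (affine_bracket br form) W \<and> irreducible_module W \<and>
    integrable_module br H W \<and> in_category_E W"
  then show "\<exists>r (U :: nat \<Rightarrow> ('g, 'w) lie_mod) z. r \<ge> 1 \<and>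
      (\<forall>i<r. lie_module br (U i) \<and> irreducible_module (U i) \<and> finite_dim (mod_space (U i))) \<and>
      (\<forall>i<r. z i \<noteq> 0) \<and> inj_on z {..<r} \<and>
      module_iso W (tensor_module r (\<lambda>i. evaluation_module (U i) (z i)))"
    by (elim conjE) (rule evaluation_tensor_of_irreducible[OF assms(1,2) tor assms(4)])
next
  have tor: "toral br H" using assms(3) by (simp add: cartan_subalgebra_def)
  have lie: "lie_algebra br" using assms(1) by (simp add: simple_lie_algebra_def)
  fix r and U :: "nat \<Rightarrow> ('g, 'u) lie_mod" and z :: "nat \<Rightarrow> complex"
  assume *: "r \<ge> 1 \<and>
    (\<forall>i<r. lie_module br (U i) \<and> irreducible_module (U i) \<and> finite_dim (mod_space (U i))) \<and>
    (\<forall>i<r. z i \<noteq> 0) \<and> inj_on z {..<r}"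
  interpret evaluation_tensor br r U z by unfold_locales (use * in simp_all)
  show "let W = tensor_module r (\<lambda>i. evaluation_module (U i) (z i)) in
      lie_module (affine_bracket br form) W \<and> irreducible_module W \<and>
      integrable_module br H W \<and> in_category_E W"
    unfolding Let_def using lie_module_W irreducible_W integrable_W[OF lie tor] in_category_E_W by simp
qed

end
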